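(* Let $d\geq 2$. There is a bijection (given by the correspondence described in the context) between: (i) $[\![n,k,d]\!]_{2^h}$ stabiliser codes; (ii) quantum sets of $n$ symplectic polar spaces of rank $h$ in $\mathrm{PG}(h(n-k)-1,2)$ with minimum distance $d$. Moreover, stabiliser codes over fields of even order are equivalent if and only if their quantum sets of symplectic polar spaces are projectively equivalent.
   Context: **Codes.** Let $n,h\ge 1$ be integers and $q=2^h$. Let $\{|x\rangle : x\in\mathbb{F}_q\}$ be an orthonormal basis of $\mathbb{C}^q$ and let $\mathrm{tr}:\mathbb{F}_q\to\mathbb{F}_2$ be the trace map. For $a,b\in\mathbb{F}_q$ let $X(a)|x\rangle=|x+a\rangle$ and $Z(b)|x\rangle=(-1)^{\mathrm{tr}(bx)}|x\rangle$. The Pauli group $\mathcal{P}_n$ on $\mathcal{H}=(\mathbb{C}^q)^{\otimes n}$ consists of the operators $cX(a_1)Z(b_1)\otimes\cdots\otimes X(a_n)Z(b_n)$ with $a_j,b_j\in\mathbb{F}_q$ and $c\in\{\pm1,\pm i\}$; the weight of such an operator is the number of $j$ with $(a_j,b_j)\ne(0,0)$. A stabiliser code is a nonzero subspace $\mathcal{Q}=\{|x\rangle\in\mathcal{H} : E|x\rangle=|x\rangle\text{ for all }E\in\mathcal{S}\}$ for some subgroup $\mathcal{S}$ of $\mathcal{P}_n$, where $\mathcal{S}$ is assumed to be the full group $\{E\in\mathcal{P}_n: E|x\rangle=|x\rangle\text{ for all }|x\rangle\in\mathcal{Q}\}$, called the stabiliser of $\mathcal{Q}$. Let $\mathcal{N}(\mathcal{S})=\{E\in\mathcal{P}_n:E\mathcal{S}E^\dagger=\mathcal{S}\}$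 and $[\mathcal{S}]=\{cE: c\in\{\pm1,\pm i\},E\in\mathcal{S}\}$. Put $k=\log_q\dim\mathcal{Q}$ (so $|\mathcal{S}|=2^{h(n-k)}$; $hk$ is an integer but $k$ need not be). The minimum distance $d$ of $\mathcal{Q}$ is the minimum nonzero weight of the elements of $\mathcal{S}$ if $|\mathcal{S}|=q^n$ (i.e. $k=0$), and the minimum nonzero weight of the elements of $\mathcal{N}(\mathcal{S})\setminus[\mathcal{S}]$ otherwise; then $\mathcal{Q}$ is called an $[\![n,k,d]\!]_q$ code. Two stabiliser codes are equivalent if their stabilisers can be obtained from one another by a sequence of the following operations: a permutation of the positions of the tensor product; multiplying elements by $\pm1$ while preserving the group structure; conjugation $\mathcal{S}\mapsto U\mathcal{S}U^\dagger$ by a local Clifford operator $U$, i.e. an $n$-fold tensor product of unitary operators on $\mathbb{C}^q$ each normalising $\mathcal{P}_1$. **Stabiliser matrix.** Let $\tau(cX(a_1)Z(b_1)\otimes\cdots\otimes X(a_n)Z(b_n))=(a_1,\dots,a_n,b_1,\dots,b_n)$. A stabiliser matrix of the code is an $h(n-k)\times 2n$ matrix whose rows are $\tau(E_1),\dots,\tau(E_{h(n-k)})$ for a generating set $E_1,\dots,E_{h(n-k)}$ of $\mathcal{S}$. Stabiliser codes with the same stabiliser matrix (which differ only in phase factors) are treated as the same code. **Symplectic polar spaces.** A symplectic form on an $\mathbb{F}_2$-vector space $V$ is a bilinear form $f:V\times V\to\mathbb{F}_2$ with $f(v,v)=0$ for all $v\in V$; it is degenerate if $f(v,\cdot)\equiv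 0$ for some $v\neq 0$. A subspace is totally isotropic if $f$ vanishes identically on it. A symplectic polar space of rank $h$ is the set of totally isotropic subspaces of a nondegenerate symplectic form $f$ on $\mathbb{F}_2^{2h}$; the associated symplectic polarity on $\mathrm{PG}(2h-1,2)$ is $\pi\mapsto\pi^\perp=\{v\in\mathbb{F}_2^{2h}: f(v,w)=0\text{ for all }w\in\pi\}$. **Quantum sets.** A quantum set of $n$ symplectic polar spaces of rank $h$ in $\mathrm{PG}(r-1,2)$ is a set $X$ of $n$ projective $(2h-1)$-spaces spanning $\mathrm{PG}(r-1,2)$, each equipped with a symplectic polarity $\perp$, with the following property: every codimension two subspace of $\mathrm{PG}(r-1,2)$ intersects an even number of the elements of $X$ in a subspace $\pi$ for which $\pi^\perp$ (taken with respect to the polarity of that element) is totally isotropic. Here $r=h(n-k)$. If $k=0$, the minimum distance of $X$ is the minimum size of a set of dependent points in distinct $(2h-1)$-spaces of $X$. If $k>0$, it is the minimum size of a set of dependent points on distinct $(2h-1)$-spaces of $X$ such that there is no hyperplane containing these points and all $(2h-1)$-spaces of $X$ that do not contain one of these points. Two quantum sets are projectively equivalent if a projective transformation maps the spaces of one to those of the other, together with their polarities. **Correspondence.** Fix a basis $e_1,\dots,e_h$ of $\mathbb{F}_{2^h}$ over $\mathbb{F}_2$ with $\mathrm{tr}(e_ie_j)=\delta_{ij}$ (a trace-orthogonal basis). Replace each column of a stabiliser matrix by $h$ binary columns, namely its coordinates with respect to this basis, obtaining an $h(n-k)\times 2hn$ binary matrix $G'$. For $j=1,\dots,hn$ let $m_j$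 be the line of $\mathrm{PG}(h(n-k)-1,2)$ spanned by the $j$-th and the $(hn+j)$-th column of $G'$. For $i=1,\dots,n$ the $i$-th space $\pi_i$ of the quantum set is the span of the $h$ lines $m_{(i-1)h+1},\dots,m_{ih}$, equipped with the unique symplectic polarity for which the perpendicular space of each of these $h$ lines is the span of the other $h-1$ lines.
   Formalization: Bijection is between equivalence classes; "totally isotropic" in the parity condition becomes "not totally isotropic"; codes with weight-one stabiliser elements are excluded; for k>0 the hyperplane must contain the perpendicular spaces of the points; quantum sets are families with multiplicity. *)

theory Defs
  imports
    "HOL-Analysis.Analysis"
    "HOL-Algebra.Generated_Groups"
    "HOL-Library.Z2"
    "HOL-Library.Discrete_Functions"
begin

(* 'q is the field with q = 2^h elements, 'n indexes the n tensor positions, 'r the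
   coordinates of the space F_2^r underlying PG(r-1,2).  A basis of the Hilbert space
   (C^q)^{\<otimes>n} is indexed by 'q ^ 'n, so operators are matrices indexed by 'q ^ 'n. *)

type_synonym 'q site_op = "((complex, 'q) vec, 'q) vec"
type_synonym ('q, 'n) state = "(complex, ('q, 'n) vec) vec"
type_synonym ('q, 'n) op = "((complex, ('q, 'n) vec) vec, ('q, 'n) vec) vec"

definition is_minimum :: "nat \<Rightarrow> nat set \<Rightarrow> bool" where
  "is_minimum d W \<longleftrightarrow> d \<in> W \<and> (\<forall>w\<in>W. d \<le> w)"

section \<open>Pauli operators\<close>

(* The absolute trace x + x^2 + ... + x^(2^(h-1)), where h = floor_log (2^h); the sum always
   lies in the prime field {0, 1}, which is identified with bit. *)
definition tr :: "'q :: {field, finite} \<Rightarrow> bit" where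
  "tr x = (if (\<Sum>i<floor_log CARD('q). x ^ (2 ^ i)) = 0 then 0 else 1)"

definition shift_op :: "'q :: {field, finite} \<Rightarrow> 'q site_op" where
  "shift_op a = (\<chi> y x. if y = x + a then 1 else 0)"

definition phase_op :: "'q :: {field, finite} \<Rightarrow> 'q site_op" where
  "phase_op b = (\<chi> y x. if y = x then (if tr (b * x) = 0 then 1 else - 1) else 0)"

definition scale_op :: "complex \<Rightarrow> complex ^ 'm ^ 'm \<Rightarrow> complex ^ 'm ^ 'm" where
  "scale_op c A = (\<chi> i j. c * A $ i $ j)"

definition adj :: "complex ^ 'm ^ 'm \<Rightarrow> complex ^ 'm ^ 'm" where
  "adj A = (\<chi> i j. cnj (A $ j $ i))"

definition tensor_op ::
  "('n :: finite \<Rightarrow> 'q site_op) \<Rightarrow> ('q :: finite, 'n) op" where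
  "tensor_op U = (\<chi> y x. \<Prod>j\<in>UNIV. U j $ (y $ j) $ (x $ j))"

definition phases :: "complex set" where
  "phases = {1, - 1, \<i>, - \<i>}"

definition pauli_op :: "complex \<Rightarrow> 'q ^ 'n \<Rightarrow> 'q ^ 'n \<Rightarrow>
    ('q :: {field, finite}, 'n :: finite) op" where
  "pauli_op c a b = scale_op c (tensor_op (\<lambda>j. shift_op (a $ j) ** phase_op (b $ j)))"

definition paulis :: "('q :: {field, finite}, 'n :: finite) op set" where
  "paulis = {pauli_op c a b | c a b. c \<in> phases}"

definition pauli_group ::
  "('q :: {field, finite}, 'n :: finite) op monoid" where
  "pauli_group = \<lparr>carrier = paulis, mult = (**), one = mat 1\<rparr>"

(* The Pauli group on a single tensor factor. *)
definition paulis1 :: "('q :: {field, finite}) site_op set" where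
  "paulis1 = {scale_op c (shift_op a ** phase_op b) | c a b. c \<in> phases}"

(* The 2n coordinates (a_1,...,a_n,b_1,...,b_n) are indexed by 'n + 'n.  They are uniquely
   determined, since distinct operators X(a)Z(b) are linearly independent. *)
definition tau ::
  "('q :: {field, finite}, 'n :: finite) op \<Rightarrow> 'q ^ ('n + 'n)" where
  "tau E = (THE v. \<exists>c\<in>phases. E = pauli_op c (\<chi> j. v $ Inl j) (\<chi> j. v $ Inr j))"

definition weight ::
  "('q :: {field, finite}, 'n :: finite) op \<Rightarrow> nat" where
  "weight E = card {j. tau E $ Inl j \<noteq> 0 \<or> tau E $ Inr j \<noteq> 0}"

section \<open>Stabiliser codes\<close>

definition stabiliser_of :: "('q :: {field, finite}, 'n :: finite) state set \<Rightarrow>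
    ('q, 'n) op set" where
  "stabiliser_of Q = {E \<in> paulis. \<forall>x\<in>Q. E *v x = x}"

definition stabiliser_code :: "('q :: {field, finite}, 'n :: finite) state set \<Rightarrow> bool" where
  "stabiliser_code Q \<longleftrightarrow> Q \<noteq> {0} \<and>
     (\<exists>S. subgroup S pauli_group \<and> Q = {x. \<forall>E\<in>S. E *v x = x})"

definition pauli_normaliser :: "('q :: {field, finite}, 'n :: finite) op set \<Rightarrow>
    ('q, 'n) op set" where
  "pauli_normaliser S = {E \<in> paulis. (\<lambda>A. E ** A ** adj E) ` S = S}"

definition phase_closure :: "('q :: {field, finite}, 'n :: finite) op set \<Rightarrow>
    ('q, 'n) op set" where
  "phase_closure S = {scale_op c E | c E. c \<in> phases \<and> E \<in> S}"

definition code_k :: "('q :: {field, finite}, 'n :: finite) state set \<Rightarrow> real" where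
  "code_k Q = log (real CARD('q)) (real (vec.dim Q))"

definition code_min_distance ::
  "('q :: {field, finite}, 'n :: finite) state set \<Rightarrow> nat \<Rightarrow> bool" where
  "code_min_distance Q d \<longleftrightarrow>
     (let S = stabiliser_of Q;
          D = (if card S = CARD('q) ^ CARD('n) then S
               else pauli_normaliser S - phase_closure S)
      in is_minimum d {weight E | E. E \<in> D \<and> weight E \<noteq> 0})"

(* Q is an [[n,k,d]]_q stabiliser code, with n = CARD('n) and q = CARD('q). *)
definition stabiliser_code_params ::
  "('q :: {field, finite}, 'n :: finite) state set \<Rightarrow> real \<Rightarrow> nat \<Rightarrow> bool" where
  "stabiliser_code_params Q k d \<longleftrightarrow>
     stabiliser_code Q \<and> code_k Q = k \<and> code_min_distance Q d"

section \<open>Equivalence of stabiliser codes\<close>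

definition permute_op :: "('n \<Rightarrow> 'n) \<Rightarrow>
    ('q :: finite, 'n :: finite) op \<Rightarrow> ('q, 'n) op" where
  "permute_op \<sigma> E = (\<chi> y x. E $ (\<chi> j. y $ \<sigma> j) $ (\<chi> j. x $ \<sigma> j))"

definition local_clifford :: "('n :: finite \<Rightarrow> ('q :: {field, finite}) site_op) \<Rightarrow> bool" where
  "local_clifford U \<longleftrightarrow> (\<forall>j. U j ** adj (U j) = mat 1 \<and> adj (U j) ** U j = mat 1 \<and>
     (\<lambda>A. U j ** A ** adj (U j)) ` paulis1 = paulis1)"

inductive code_step :: "('q :: {field, finite}, 'n :: finite) op set \<Rightarrow>
    ('q, 'n) op set \<Rightarrow> bool" where
  permutation: "bij \<sigma> \<Longrightarrow> code_step S (permute_op \<sigma> ` S)"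
| sign_change:
    "(\<And>E. E \<in> S \<Longrightarrow> s E \<in> {1, - 1}) \<Longrightarrow>
     (\<And>E F. E \<in> S \<Longrightarrow> F \<in> S \<Longrightarrow> s (E ** F) = s E * s F) \<Longrightarrow>
     code_step S ((\<lambda>E. scale_op (s E) E) ` S)"
| clifford: "local_clifford U \<Longrightarrow>
     code_step S ((\<lambda>E. tensor_op U ** E ** adj (tensor_op U)) ` S)"

definition code_equiv :: "('q :: {field, finite}, 'n :: finite) state set \<Rightarrow>
    ('q, 'n) state set \<Rightarrow> bool" where
  "code_equiv Q Q' \<longleftrightarrow> code_step\<^sup>*\<^sup>* (stabiliser_of Q) (stabiliser_of Q')"

section \<open>Symplectic polarities and quantum sets\<close>

(* The space PG(r-1,2) is bit ^ 'r; a projective m-space is a subspace of dimension m + 1. *)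

definition nondegenerate_symplectic_form ::
  "(bit ^ 'r) set \<Rightarrow> (bit ^ 'r \<Rightarrow> bit ^ 'r \<Rightarrow> bit) \<Rightarrow> bool" where
  "nondegenerate_symplectic_form V f \<longleftrightarrow>
     (\<forall>u\<in>V. \<forall>v\<in>V. \<forall>w\<in>V. f (u + v) w = f u w + f v w \<and> f w (u + v) = f w u + f w v) \<and>
     (\<forall>c. \<forall>u\<in>V. \<forall>w\<in>V. f (c *s u) w = c * f u w \<and> f w (c *s u) = c * f w u) \<and>
     (\<forall>v\<in>V. f v v = 0) \<and>
     (\<forall>v\<in>V. (\<forall>w\<in>V. f v w = 0) \<longrightarrow> v = 0)"

type_synonym 'r polarity = "(bit ^ 'r) set \<Rightarrow> (bit ^ 'r) set"

(* A polarity on V acts on the subspaces of V only; restrict makes its values elsewhere irrelevant,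
   so that equal polarities are equal functions. *)
definition symplectic_polarity :: "(bit ^ 'r) set \<Rightarrow> 'r polarity \<Rightarrow> bool" where
  "symplectic_polarity V p \<longleftrightarrow>
     (\<exists>f. nondegenerate_symplectic_form V f \<and>
          p = restrict (\<lambda>W. {v \<in> V. \<forall>w\<in>W. f v w = 0}) {W. vec.subspace W \<and> W \<subseteq> V})"

(* The polarity determines the form over F_2, and the form vanishes on W iff W is contained in
   its perpendicular space. *)
definition totally_isotropic :: "'r polarity \<Rightarrow> (bit ^ 'r) set \<Rightarrow> bool" where
  "totally_isotropic p W \<longleftrightarrow> W \<subseteq> p W"

(* A "set" of n polar spaces is a family indexed by 'n: the n spaces carry multiplicities (all
   four lines coming from the [[4,2,2]]_2 code are equal), and their order is forgotten by
   projective equivalence. *)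
type_synonym ('n, 'r) polar_family = "'n \<Rightarrow> (bit ^ 'r) set \<times> 'r polarity"

(* With W the intersection of the hyperplanes given by two rows u, v of a stabiliser matrix, the
   space (W \<inter> V_i)^\<perp> is spanned by the i-th components of u and v; it is totally isotropic iff
   these components commute.  Commutation of u and v therefore means that the number of i for
   which it is NOT totally isotropic is even.  For rank 1 this is the requirement that every
   codimension two subspace is skew to an even number of the lines.  (Counting the totally
   isotropic ones instead differs by n in parity, and would exclude the [[5,1,3]]_2 code.) *)
definition quantum_set :: "nat \<Rightarrow> ('n :: finite, 'r :: finite) polar_family \<Rightarrow> bool" where
  "quantum_set h X \<longleftrightarrow>
     (\<forall>i. vec.subspace (fst (X i)) \<and> vec.dim (fst (X i)) = 2 * h \<and>
          symplectic_polarity (fst (X i)) (snd (X i))) \<and>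
     vec.span (\<Union>i. fst (X i)) = UNIV \<and>
     (\<forall>W. vec.subspace W \<and> vec.dim W + 2 = CARD('r) \<longrightarrow>
        even (card {i. \<not> totally_isotropic (snd (X i)) (snd (X i) (W \<inter> fst (X i)))}))"

(* I is the set of the spaces used and p i the chosen point on the space i. *)
definition dependent_points ::
  "('n :: finite, 'r :: finite) polar_family \<Rightarrow> 'n set \<Rightarrow> ('n \<Rightarrow> bit ^ 'r) \<Rightarrow> bool" where
  "dependent_points X I p \<longleftrightarrow>
     (\<forall>i\<in>I. p i \<in> fst (X i) \<and> p i \<noteq> 0) \<and>
     (\<exists>c :: 'n \<Rightarrow> bit. (\<Sum>i\<in>I. c i *s p i) = 0 \<and> (\<exists>i\<in>I. c i \<noteq> 0))"

(* The hyperplane has to contain the perpendicular space of each chosen point p i in its own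
   polar space (which contains p i) and all the other spaces.  For rank 1 the perpendicular space
   of a point is the point itself.  For larger rank, asking only that the hyperplane contain the
   points would not give the distance of the code: a stabiliser element F could rule out a minimum
   weight element E of the normaliser merely because F commutes with E in every position. *)
definition covering_hyperplane ::
  "('n :: finite, 'r :: finite) polar_family \<Rightarrow> 'n set \<Rightarrow> ('n \<Rightarrow> bit ^ 'r) \<Rightarrow> (bit ^ 'r) set \<Rightarrow> bool"
  where
  "covering_hyperplane X I p H \<longleftrightarrow>
     vec.subspace H \<and> vec.dim H + 1 = CARD('r) \<and>
     (\<forall>i\<in>I. snd (X i) (vec.span {p i}) \<subseteq> H) \<and>
     (\<forall>i. i \<notin> I \<longrightarrow> fst (X i) \<subseteq> H)"

(* As r = h(n-k), the case k = 0 is r = hn. *)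
definition quantum_set_min_distance ::
  "nat \<Rightarrow> ('n :: finite, 'r :: finite) polar_family \<Rightarrow> nat \<Rightarrow> bool" where
  "quantum_set_min_distance h X d \<longleftrightarrow>
     is_minimum d {card I | I p. dependent_points X I p \<and>
        (CARD('r) = h * CARD('n) \<or> \<not> (\<exists>H. covering_hyperplane X I p H))}"

(* The two families may live in different spaces a priori. *)
definition proj_equiv :: "('n :: finite, 'r :: finite) polar_family \<Rightarrow>
    ('n, 's :: finite) polar_family \<Rightarrow> bool" where
  "proj_equiv X Y \<longleftrightarrow>
     (\<exists>(g :: bit ^ 'r \<Rightarrow> bit ^ 's) (\<sigma> :: 'n \<Rightarrow> 'n).
        Vector_Spaces.linear (*s) (*s) g \<and> bij g \<and> bij \<sigma> \<and>
        (\<forall>i. fst (Y (\<sigma> i)) = g ` fst (X i) \<and>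
             (\<forall>W. vec.subspace W \<and> W \<subseteq> fst (X i) \<longrightarrow>
                snd (Y (\<sigma> i)) (g ` W) = g ` snd (X i) W)))"

section \<open>The correspondence\<close>

definition f2_comb :: "nat \<Rightarrow> (nat \<Rightarrow> 'q :: {field, finite}) \<Rightarrow> (nat \<Rightarrow> bit) \<Rightarrow> 'q" where
  "f2_comb h e c = (\<Sum>l<h. if c l = 1 then e l else 0)"

(* Coordinate vectors of length h are functions supported on {..<h}. *)
definition trace_orthogonal_basis :: "nat \<Rightarrow> (nat \<Rightarrow> 'q :: {field, finite}) \<Rightarrow> bool" where
  "trace_orthogonal_basis h e \<longleftrightarrow>
     (\<forall>x. \<exists>!c. (\<forall>l\<ge>h. c l = 0) \<and> x = f2_comb h e c) \<and>
     (\<forall>i<h. \<forall>j<h. tr (e i * e j) = (if i = j then 1 else 0))"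

definition coord :: "nat \<Rightarrow> (nat \<Rightarrow> 'q :: {field, finite}) \<Rightarrow> nat \<Rightarrow> 'q \<Rightarrow> bit" where
  "coord h e l x = (THE c. (\<forall>l\<ge>h. c l = 0) \<and> x = f2_comb h e c) l"

definition stabiliser_matrix :: "nat \<Rightarrow> ('q :: {field, finite}, 'n :: finite) state set \<Rightarrow>
    'q ^ ('n + 'n) ^ 'r :: finite \<Rightarrow> bool" where
  "stabiliser_matrix h Q M \<longleftrightarrow>
     real CARD('r) = real h * (real CARD('n) - code_k Q) \<and>
     (\<exists>E :: 'r \<Rightarrow> ('q, 'n) op.
        range E \<subseteq> paulis \<and> generate pauli_group (range E) = stabiliser_of Q \<and>
        M = (\<chi> \<rho>. tau (E \<rho>)))"

(* The pair (i,l) with l < h stands for the index j = (i-1)h + l + 1 in {1..hn}, so that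
   expanded_column h e M (Inl i) l and expanded_column h e M (Inr i) l are the columns number
   j and hn + j of the expanded binary matrix. *)
definition expanded_column :: "nat \<Rightarrow> (nat \<Rightarrow> 'q :: {field, finite}) \<Rightarrow>
    'q ^ ('n :: finite + 'n) ^ 'r :: finite \<Rightarrow> 'n + 'n \<Rightarrow> nat \<Rightarrow> bit ^ 'r" where
  "expanded_column h e M s l = (\<chi> \<rho>. coord h e l (M $ \<rho> $ s))"

definition matrix_line :: "nat \<Rightarrow> (nat \<Rightarrow> 'q :: {field, finite}) \<Rightarrow>
    'q ^ ('n :: finite + 'n) ^ 'r :: finite \<Rightarrow> 'n \<Rightarrow> nat \<Rightarrow> (bit ^ 'r) set" where
  "matrix_line h e M i l =
     vec.span {expanded_column h e M (Inl i) l, expanded_column h e M (Inr i) l}"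

definition corresponds :: "nat \<Rightarrow> (nat \<Rightarrow> 'q :: {field, finite}) \<Rightarrow>
    ('q, 'n :: finite) state set \<Rightarrow> ('n, 'r :: finite) polar_family \<Rightarrow> bool" where
  "corresponds h e Q X \<longleftrightarrow>
     (\<exists>M :: 'q ^ ('n + 'n) ^ 'r. stabiliser_matrix h Q M \<and>
        (\<forall>i. fst (X i) = vec.span (\<Union>l<h. matrix_line h e M i l) \<and>
             symplectic_polarity (fst (X i)) (snd (X i)) \<and>
             (\<forall>l<h. snd (X i) (matrix_line h e M i l) =
                    vec.span (\<Union>l'\<in>{..<h} - {l}. matrix_line h e M i l'))))"

section \<open>The two sides of the bijection\<close>

(* A code with d \<ge> 2 and k > 0 may have stabiliser elements of weight one (for instance the
   [[5,2,2]]_2 code |0> \<otimes> [[4,2,2]]_2).  The space of such a position has projective dimension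
   less than 2h-1 and carries no polarity of the required kind, so that no quantum set corresponds
   to the code; these codes are left out.  For k = 0 and d \<ge> 2 there are none. *)
definition codes :: "real \<Rightarrow> nat \<Rightarrow> ('q :: {field, finite}, 'n :: finite) state set set" where
  "codes k d = {Q. stabiliser_code_params Q k d \<and> (\<forall>E\<in>stabiliser_of Q. weight E \<noteq> 1)}"

definition quantum_sets :: "nat \<Rightarrow> nat \<Rightarrow> ('n :: finite, 'r :: finite) polar_family set" where
  "quantum_sets h d = {X. quantum_set h X \<and> quantum_set_min_distance h X d}"

definition code_rel :: "real \<Rightarrow> nat \<Rightarrow> (('q :: {field, finite}, 'n :: finite) state set \<times>
    ('q, 'n) state set) set" where
  "code_rel k d = {(Q, Q'). Q \<in> codes k d \<and> Q' \<in> codes k d \<and> code_equiv Q Q'}"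

definition proj_rel :: "nat \<Rightarrow> nat \<Rightarrow>
    (('n :: finite, 'r :: finite) polar_family \<times> ('n, 'r) polar_family) set" where
  "proj_rel h d = {(X, Y). X \<in> quantum_sets h d \<and> Y \<in> quantum_sets h d \<and> proj_equiv X Y}"

end

(* Up to phases, a Pauli operator is a vector of labels (a_j, b_j) in F_q x F_q, and a stabiliser
   group S is an additive code C of such vectors that is isotropic for the trace-symplectic form sp;
   dim Q = q^n / |S|, and the normaliser of S consists of the operators with label in the dual code.

   A minimal generating set of S is a linear bijection comb M from F_2^r to C.  Its transpose at
   position i, site_map M i : F_q x F_q -> F_2^r, has the coordinates w |-> sp1 w (M rho i), and the
   i-th polar space is the image of the symplectic space F_q x F_q under this map.  Thus dot products with points of the
   i-th space are symplectic products with the i-th components of code words.  Each condition on a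
   quantum set translates: spanning is independence of the generators, the parity condition on
   codimension two subspaces is isotropy of C, a dependency among points is an element of the dual
   code, and a covering hyperplane is a nonzero element of C.

   Transposing once more, a projective equivalence is the same as a permutation of the positions
   together with a symplectic map at each position carrying one code to the other.  Clifford
   operators induce such maps, and all of them arise because symplectic groups over F_2
   are generated by transvections. *)
theory Submission
  imports Defs
begin

(* As simp rules these would turn addition and multiplication in F_2 into XOR and AND. *)
declare add_bit_eq_xor [simp del] mult_bit_eq_and [simp del]

text \<open>The obstacle on the side of codes is the phases. They can be discarded in both
  directions: a stabiliser group has at most one operator for each label, and every isotropic code
  of labels lifts to a stabiliser group because i is an admissible phase. Two lifts of one code
  differ by a sign character, which is itself a permitted operation.

  Over F_2 a symplectic form is determined by the relation of orthogonality, since a value other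
  than 0 is 1. Hence an additive map that respects polarities is automatically an isometry.

  Duals are computed by counting with additive characters, so that the linear algebra works in
  finite additive groups such as F_q x F_q, whose type carries no scalar multiplication by
  \<open>bit\<close>. The trace-orthogonal basis enters as a symplectic basis of F_q x F_q; the site
  maps send its hyperbolic pairs to spanning pairs of the lines in the correspondence.

  Distances are the delicate point: the sizes of dependent point sets and the weights of dual words
  may form different sets, and only their minima are shown to agree.\<close>

lemma UNIV_bit: "(UNIV :: bit set) = {0, 1}"
  by (auto intro: bit.exhaust)

instance bit :: finite
  by standard (simp add: UNIV_bit)

lemma card_bit [simp]: "CARD(bit) = 2"
  by (simp add: UNIV_bit)

lemma bit_add_self [simp]: "(b :: bit) + b = 0"
  by (cases b) auto

lemma bit_add_eq_0_iff: "(a :: bit) + b = 0 \<longleftrightarrow> a = b"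
  by (cases a; cases b) auto

lemma bit_eqI: "((a :: bit) = 0 \<longleftrightarrow> b = 0) \<Longrightarrow> a = b"
  by (cases a; cases b) auto

section \<open>Signs and additive characters with values 1 and -1\<close>

definition bit_sign :: "bit \<Rightarrow> 'a :: comm_ring_1" where
  "bit_sign b = (if b = 0 then 1 else - 1)"

lemma bit_sign_simps [simp]: "bit_sign 0 = 1" "bit_sign 1 = - 1"
  by (auto simp: bit_sign_def)

lemma bit_sign_add: "bit_sign (a + b) = bit_sign a * bit_sign b"
  by (cases a; cases b) auto

lemma bit_sign_sum: "bit_sign (sum f A) = (\<Prod>x\<in>A. bit_sign (f x))"
  by (induction A rule: infinite_finite_induct) (auto simp: bit_sign_add)

lemma bit_sign_square [simp]: "bit_sign a * bit_sign a = 1"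
  by (cases a) auto

text \<open>In the groups used below every element is its own negative, so these sets are exactly
  the F_2-subspaces, also in types without scalar multiplication by \<open>bit\<close>.\<close>

definition add_closed :: "'a :: ab_group_add set \<Rightarrow> bool" where
  "add_closed C \<longleftrightarrow> 0 \<in> C \<and> (\<forall>x\<in>C. \<forall>y\<in>C. x + y \<in> C)"

lemma add_closed_sum: "add_closed C \<Longrightarrow> (\<And>i. i \<in> I \<Longrightarrow> f i \<in> C) \<Longrightarrow> sum f I \<in> C"
  by (induction I rule: infinite_finite_induct) (auto simp: add_closed_def)

lemma add_closed_image:
  "add_closed C \<Longrightarrow> (\<And>x y. f (x + y) = f x + f y) \<Longrightarrow> add_closed (f ` C)"
  unfolding add_closed_def
  by (auto simp: image_iff) (metis add_cancel_left_left, metis)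

text \<open>Translation by \<open>z\<close> permutes \<open>C\<close> and reverses every sign, so
  the sum equals its own negative.\<close>

lemma sum_bit_sign_eq_0:
  fixes f :: "'a :: ab_group_add \<Rightarrow> bit"
  assumes C: "add_closed C" and two: "\<And>x :: 'a. x + x = 0"
    and f: "\<And>x y. f (x + y) = f x + f y" and z: "z \<in> C" "f z = 1"
  shows "(\<Sum>x\<in>C. bit_sign (f x)) = (0 :: int)"
proof -
  have "(\<Sum>x\<in>C. bit_sign (f x)) = (\<Sum>x\<in>C. bit_sign (f (x + z)) :: int)"
    by (rule sum.reindex_bij_witness[of _ "\<lambda>x. x + z" "\<lambda>x. x + z"])
       (use C z two in \<open>auto simp: add_closed_def add.assoc\<close>)
  also have "\<dots> = - (\<Sum>x\<in>C. bit_sign (f x))"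
    by (simp add: f z bit_sign_add sum_negf)
  finally show ?thesis by simp
qed

definition perp :: "('a \<Rightarrow> 'a \<Rightarrow> bit) \<Rightarrow> 'a set \<Rightarrow> 'a set" where
  "perp \<beta> C = {y. \<forall>x\<in>C. \<beta> x y = 0}"

section \<open>Pairings over the field with two elements\<close>

text \<open>Symmetry is asked for instead of the alternating law, so that the dot product and the
  symplectic forms share one theory of duals. Exponent two is a consequence: \<open>x + x\<close> is
  orthogonal to everything.\<close>

locale nondegenerate_pairing =
  fixes \<beta> :: "'a :: {ab_group_add, finite} \<Rightarrow> 'a \<Rightarrow> bit"
  assumes add_left: "\<beta> (x + y) z = \<beta> x z + \<beta> y z"
    and sym: "\<beta> x y = \<beta> y x"
    and nondeg: "(\<And>y. \<beta> x y = 0) \<Longrightarrow> x = 0"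
begin

lemma add_right: "\<beta> z (x + y) = \<beta> z x + \<beta> z y"
  by (metis add_left sym)

lemma zero_left [simp]: "\<beta> 0 x = 0"
  using add_left[of 0 0 x] by (cases "\<beta> 0 x") auto

lemma zero_right [simp]: "\<beta> x 0 = 0"
  by (metis sym zero_left)

lemma add_self: "x + x = (0 :: 'a)"
  by (rule nondeg) (simp add: add_left)

lemma neg_eq: "- x = (x :: 'a)"
  by (metis add_self minus_unique)

lemma diff_eq: "x - y = (x :: 'a) + y"
  by (metis diff_conv_add_uminus neg_eq)

lemma add_eq_0_iff_eq: "(x :: 'a) + y = 0 \<longleftrightarrow> x = y"
  by (metis diff_eq eq_iff_diff_eq_0)

lemma eqI: "(\<And>z. \<beta> z x = \<beta> z y) \<Longrightarrow> x = y"
  by (metis add_eq_0_iff_eq add_left bit_add_self nondeg sym)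

lemma sum_right: "\<beta> z (sum f A) = (\<Sum>x\<in>A. \<beta> z (f x))"
  by (induction A rule: infinite_finite_induct) (auto simp: add_right)

lemma perpI: "(\<And>x. x \<in> C \<Longrightarrow> \<beta> x y = 0) \<Longrightarrow> y \<in> perp \<beta> C"
  by (auto simp: perp_def)

lemma perpD: "y \<in> perp \<beta> C \<Longrightarrow> x \<in> C \<Longrightarrow> \<beta> x y = 0"
  by (auto simp: perp_def)

lemma add_closed_perp [simp]: "add_closed (perp \<beta> C)"
  by (auto simp: add_closed_def perp_def add_right)

lemma perp_antimono: "A \<subseteq> B \<Longrightarrow> perp \<beta> B \<subseteq> perp \<beta> A"
  by (auto simp: perp_def)

text \<open>Double counting of the sign of \<open>\<beta> x y\<close> over \<open>C\<close> times
  the whole group. Summed over \<open>y\<close>, only \<open>x = 0\<close> survives; summed over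
  \<open>x\<close>, only the \<open>y\<close> in the dual do.\<close>

lemma card_mult_card_perp:
  assumes "add_closed C"
  shows "card C * card (perp \<beta> C) = CARD('a)"
proof -
  have 1: "(\<Sum>y\<in>UNIV. bit_sign (\<beta> x y)) = (if x = 0 then int CARD('a) else 0)" for x
  proof (cases "x = 0")
    case False
    then obtain y where "\<beta> x y = 1" using nondeg by (metis bit_not_zero_iff)
    then show ?thesis using False
      sum_bit_sign_eq_0[of UNIV "\<beta> x" y] by (auto simp: add_self add_right add_closed_def)
  qed simp
  have 2: "(\<Sum>x\<in>C. bit_sign (\<beta> x y)) = (if y \<in> perp \<beta> C then int (card C) else 0)" for y
  proof (cases "y \<in> perp \<beta> C")
    case False
    then obtain x where "x \<in> C" "\<beta> x y = 1" by (auto simp: perp_def)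
    then show ?thesis using False assms
      sum_bit_sign_eq_0[of C "\<lambda>x. \<beta> x y" x] by (auto simp: add_self add_left)
  qed (simp add: perpD)
  have "int (card C * card (perp \<beta> C)) = (\<Sum>y\<in>UNIV. \<Sum>x\<in>C. bit_sign (\<beta> x y))"
    by (simp add: 2 sum.If_cases)
  also have "\<dots> = (\<Sum>x\<in>C. \<Sum>y\<in>UNIV. bit_sign (\<beta> x y))" by (rule sum.swap)
  also have "\<dots> = int CARD('a)"
    using assms by (simp add: 1 add_closed_def)
  finally show ?thesis by linarith
qed

text \<open>\<open>C\<close> lies in its double dual, and the counting formula applied to
  \<open>C\<close> and to its dual shows that the two have the same size.\<close>

lemma perp_perp:
  assumes "add_closed C"
  shows "perp \<beta> (perp \<beta> C) = C"
proof -
  have "C \<subseteq> perp \<beta> (perp \<beta> C)" by (auto simp: perp_def sym)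
  moreover have "card C = card (perp \<beta> (perp \<beta> C))"
    using card_mult_card_perp[OF assms] card_mult_card_perp[OF add_closed_perp[of C]]
    by (metis card_gt_0_iff empty_iff finite add_closed_def add_closed_perp mult.commute
        mult_right_cancel order_less_irrefl)
  ultimately show ?thesis by (metis card_subset_eq finite)
qed

lemma perp_separates:
  assumes "add_closed C" "v \<notin> C"
  obtains w where "w \<in> perp \<beta> C" "\<beta> w v = 1"
proof -
  have "v \<notin> perp \<beta> (perp \<beta> C)" using assms by (simp add: perp_perp)
  then show ?thesis using that by (auto simp: perp_def)
qed

text \<open>For nonzero \<open>f\<close> the representing vector spans the dual of the kernel, which
  has index two. All transposes of additive maps used later come from this statement.\<close>

lemma additive_functional_ex1:
  assumes f: "\<And>x y. f (x + y) = (f x + f y :: bit)"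
  shows "\<exists>!m. \<forall>x. f x = \<beta> x m"
proof -
  have "\<exists>m. \<forall>x. f x = \<beta> x m"
  proof (cases "\<forall>x. f x = 0")
    case False
    have f0: "f 0 = 0" using f[of 0 0] by (cases "f 0") auto
    then have K: "add_closed {x. f x = 0}" by (auto simp: add_closed_def f)
    obtain v where v: "f v = 1" using False by auto
    obtain w where w: "w \<in> perp \<beta> {x. f x = 0}" "\<beta> w v = 1"
      using perp_separates[OF K, of v] v by auto
    have "f x = \<beta> x w" for x
    proof (cases "f x = 0")
      case True
      then show ?thesis using w perpD by force
    next
      case False
      \<comment> \<open>\<open>f\<close> takes the value 1 at both \<open>x\<close> and
        \<open>v\<close>, so their sum lies in the kernel.\<close>
      then have "\<beta> (x + v) w = 0" using w(1) v by (intro perpD[of w "{x. f x = 0}"]) (auto simp: f)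
      then show ?thesis using False w(2) by (simp add: add_left bit_add_eq_0_iff sym[of v] sym[of x])
    qed
    then show ?thesis by blast
  qed (auto intro: exI[of _ 0])
  then show ?thesis by (metis eqI)
qed

lemma add_closed_pair: "add_closed {0, u, v, u + v :: 'a}"
  by (auto simp: add_closed_def add_self add.assoc add.left_commute)

lemma add_closed_single: "add_closed {0, u :: 'a}"
  by (auto simp: add_closed_def add_self)

lemma perp_perp_single: "perp \<beta> (perp \<beta> {u}) = {0, u}"
proof -
  have "perp \<beta> {u} = perp \<beta> {0, u}" by (auto simp: perp_def)
  then show ?thesis by (simp add: perp_perp add_closed_single)
qed

lemma perp_perp_pair: "perp \<beta> (perp \<beta> {u, v}) = {0, u, v, u + v}"
proof -
  have "perp \<beta> {u, v} = perp \<beta> {0, u, v, u + v}" by (auto simp: perp_def add_left)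
  then show ?thesis by (simp only: perp_perp add_closed_pair)
qed

end

text \<open>The pair \<open>(a, b)\<close> labels the operator \<open>X(a)Z(b)\<close>; the product is \<open>0\<close> iff the operators commute.\<close>

definition sp1 :: "'q :: {field, finite} \<times> 'q \<Rightarrow> 'q \<times> 'q \<Rightarrow> bit" where
  "sp1 w w' = tr (fst w * snd w' + snd w * fst w')"

definition sp :: "('q :: {field, finite} \<times> 'q) ^ 'n :: finite \<Rightarrow> ('q \<times> 'q) ^ 'n \<Rightarrow> bit" where
  "sp v w = (\<Sum>j\<in>UNIV. sp1 (v $ j) (w $ j))"

definition bdot :: "bit ^ 'r :: finite \<Rightarrow> bit ^ 'r \<Rightarrow> bit" where
  "bdot u v = (\<Sum>i\<in>UNIV. u $ i * v $ i)"

interpretation bdot: nondegenerate_pairing "bdot :: bit ^ 'r :: finite \<Rightarrow> bit ^ 'r \<Rightarrow> bit"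
proof
  fix x y z :: "bit ^ 'r"
  show "bdot (x + y) z = bdot x z + bdot y z"
    by (simp add: bdot_def distrib_right sum.distrib)
  show "bdot x y = bdot y x" by (simp add: bdot_def mult.commute)
  assume *: "\<And>y. bdot x y = 0"
  have "x $ i = bdot x (axis i 1)" for i
    by (simp add: bdot_def axis_def if_distrib cong: if_cong)
  then show "x = 0" by (simp add: vec_eq_iff *)
qed

section \<open>The trace form\<close>

text \<open>Multiplication by a nonzero \<open>x\<close> permutes the nonzero elements; comparing
  the products over all of them gives \<open>x ^ (q - 1) = 1\<close>.\<close>

lemma finite_field_pow_card:
  fixes x :: "'q :: {field, finite}"
  shows "x ^ CARD('q) = x"
proof (cases "x = 0")
  case False
  have "(\<Prod>y\<in>UNIV-{0}. x * y) = (\<Prod>y\<in>UNIV-{0}. y)"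
    by (rule prod.reindex_bij_witness[of _ "\<lambda>y. y / x" "\<lambda>y. x * y"]) (use False in auto)
  then have "x ^ card (UNIV - {0 :: 'q}) = 1"
    by (simp add: prod.distrib)
  moreover have "CARD('q) = Suc (card (UNIV - {0 :: 'q}))"
    by (subst card.remove[of _ 0]) auto
  ultimately show ?thesis by (simp only: power_Suc mult_1_right)
qed (simp add: zero_less_card_finite)

text \<open>Adding 1 permutes the field, so the total of all elements does not change when
  \<open>q\<close> ones are added to it. For \<open>q\<close> a power of two this yields
  characteristic two.\<close>

lemma of_nat_card_eq_0: "of_nat CARD('q) = (0 :: 'q :: {field, finite})"
proof -
  have "(\<Sum>x\<in>(UNIV :: 'q set). x) = (\<Sum>x\<in>UNIV. x + 1)"
    by (rule sum.reindex_bij_witness[of _ "\<lambda>x. x + 1" "\<lambda>x. x - 1"]) auto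
  then show ?thesis by (simp add: sum.distrib)
qed

text \<open>F_2-scaling in an arbitrary abelian group. Additivity in the scalar holds where
  \<open>x + x = 0\<close>.\<close>

definition bit_smult :: "bit \<Rightarrow> 'a :: ab_group_add \<Rightarrow> 'a" where
  "bit_smult b x = (if b = 1 then x else 0)"

locale trace_basis =
  fixes e :: "nat \<Rightarrow> 'q :: {field, finite}" and h :: nat
  assumes card_q: "CARD('q) = 2 ^ h" and basis: "trace_orthogonal_basis h e"
begin

lemma two_eq_0: "(2 :: 'q) = 0"
  using of_nat_card_eq_0[where 'q = 'q] by (simp add: card_q)

lemma char2: "(x :: 'q) + x = 0"
  by (metis mult_2 mult_zero_left two_eq_0)

lemma neg2: "- (x :: 'q) = x"
  by (metis char2 minus_unique)

lemma add_eq_0_iff2: "(x :: 'q) + y = 0 \<longleftrightarrow> x = y"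
  by (metis neg2 add_eq_0_iff)

lemma square_add: "((x :: 'q) + y) ^ 2 = x ^ 2 + y ^ 2"
  by (simp add: power2_sum two_eq_0)

lemma frobenius_add: "((x :: 'q) + y) ^ (2 ^ i) = x ^ (2 ^ i) + y ^ (2 ^ i)"
proof (induction i)
  case (Suc i)
  have *: "z ^ 2 ^ Suc i = (z ^ 2 ^ i)\<^sup>2" for z :: 'q
    by (metis power_Suc2 power_mult)
  show ?case unfolding * Suc by (rule square_add)
qed simp

lemma square_sum: "(sum f A :: 'q) ^ 2 = (\<Sum>x\<in>A. f x ^ 2)"
  by (induction A rule: infinite_finite_induct) (auto simp: square_add)

text \<open>Squaring shifts the summands cyclically because \<open>x ^ (2 ^ h) = x\<close>; so the
  sum is idempotent and lies in {0, 1}. Hence the case distinction in \<open>tr\<close> loses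
  nothing, and \<open>tr\<close> inherits additivity from the Frobenius powers.\<close>

lemma trace_sum: "(\<Sum>i<h. (x :: 'q) ^ (2 ^ i)) = (if tr x = 0 then 0 else 1)"
proof -
  let ?s = "\<Sum>i<h. x ^ (2 ^ i)"
  have "?s ^ 2 = (\<Sum>i<h. x ^ (2 ^ Suc i))"
    unfolding square_sum by (rule sum.cong) (simp_all add: mult.commute flip: power_mult)
  also have "\<dots> + x = (\<Sum>i<Suc h. x ^ (2 ^ i))"
    by (subst sum.lessThan_Suc_shift) simp
  also have "\<dots> = ?s + x"
    using finite_field_pow_card[of x] by (simp add: card_q)
  finally have "?s ^ 2 = ?s" by simp
  then have "?s = 0 \<or> ?s = 1" by (simp add: power2_eq_square)
  then show ?thesis by (auto simp: tr_def card_q)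
qed

lemma tr_add: "tr ((x :: 'q) + y) = tr x + tr y"
proof -
  have "(if tr (x + y) = 0 then 0 else 1 :: 'q) = (if tr x = 0 then 0 else 1) + (if tr y = 0 then 0 else 1)"
    unfolding trace_sum[symmetric] by (simp add: frobenius_add sum.distrib)
  then show ?thesis by (cases "tr x"; cases "tr y"; cases "tr (x + y)") (auto simp: char2)
qed

lemma tr_0 [simp]: "tr (0 :: 'q) = 0"
  using tr_add[of 0 0] by (cases "tr (0::'q)") auto

lemma tr_sum: "tr (sum f A :: 'q) = (\<Sum>x\<in>A. tr (f x))"
  by (induction A rule: infinite_finite_induct) (auto simp: tr_add)

lemma coord_comb:
  "l \<ge> h \<Longrightarrow> coord h e l x = 0" "x = f2_comb h e (\<lambda>l. coord h e l x)"
proof -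
  have "\<exists>!c. (\<forall>l\<ge>h. c l = 0) \<and> x = f2_comb h e c"
    using basis by (auto simp: trace_orthogonal_basis_def)
  from theI'[OF this]
  show "l \<ge> h \<Longrightarrow> coord h e l x = 0" "x = f2_comb h e (\<lambda>l. coord h e l x)"
    by (auto simp: coord_def)
qed

lemma coord_expand: "x = (\<Sum>l<h. bit_smult (coord h e l x) (e l))"
  using coord_comb(2)[of x] by (simp add: f2_comb_def bit_smult_def)

lemma tr_basis: "l < h \<Longrightarrow> m < h \<Longrightarrow> tr (e l * e m) = (if l = m then 1 else 0)"
  using basis by (auto simp: trace_orthogonal_basis_def)

lemma tr_mult_bit_smult: "tr (bit_smult b x * y) = b * tr ((x :: 'q) * y)"
  by (cases b) (auto simp: bit_smult_def)

text \<open>A trace-orthogonal basis is its own dual basis for the trace form, so coordinates are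
  traces.\<close>

lemma coord_eq_tr:
  assumes "m < h" shows "coord h e m x = tr (x * e m)"
proof -
  have "tr (x * e m) = tr ((\<Sum>l<h. bit_smult (coord h e l x) (e l)) * e m)"
    using coord_expand[of x] by simp
  also have "\<dots> = (\<Sum>l<h. coord h e l x * tr (e l * e m))"
    by (simp add: sum_distrib_right tr_sum tr_mult_bit_smult)
  also have "\<dots> = (\<Sum>l<h. if l = m then coord h e m x else 0)"
    by (rule sum.cong) (auto simp: tr_basis assms)
  also have "\<dots> = coord h e m x" using assms by simp
  finally show ?thesis by simp
qed

text \<open>In these coordinates the trace form is the standard dot product, which makes
  \<open>sp1\<close> the standard symplectic form on F_2^(2h).\<close>

lemma tr_mult_coord: "tr (x * y) = (\<Sum>l<h. coord h e l x * coord h e l y)"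
proof -
  have "tr (x * y) = tr ((\<Sum>l<h. bit_smult (coord h e l x) (e l)) * y)"
    using coord_expand[of x] by simp
  also have "\<dots> = (\<Sum>l<h. coord h e l x * tr (e l * y))"
    by (simp add: sum_distrib_right tr_sum tr_mult_bit_smult)
  also have "\<dots> = (\<Sum>l<h. coord h e l x * coord h e l y)"
    by (rule sum.cong) (auto simp: coord_eq_tr mult.commute)
  finally show ?thesis .
qed

lemma tr_nondegenerate:
  fixes x :: 'q assumes "\<And>y. tr (x * y) = 0" shows "x = 0"
  using coord_expand[of x] assms by (simp add: coord_eq_tr bit_smult_def)

lemma sp1_pairing: "nondegenerate_pairing (sp1 :: 'q \<times> 'q \<Rightarrow> _)"
proof
  fix x y z :: "'q \<times> 'q"
  show "sp1 (x + y) z = sp1 x z + sp1 y z"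
    by (simp add: sp1_def distrib_right tr_add algebra_simps)
  show "sp1 x y = sp1 y x" by (simp add: sp1_def mult.commute add.commute)
  assume *: "\<And>y. sp1 x y = 0"
  have "fst x = 0" using *[of "(0, _)"] by (intro tr_nondegenerate) (simp add: sp1_def)
  moreover have "snd x = 0" using *[of "(_, 0)"] by (intro tr_nondegenerate) (simp add: sp1_def)
  ultimately show "x = 0" by (simp add: prod_eq_iff)
qed

sublocale sp1: nondegenerate_pairing "sp1 :: 'q \<times> 'q \<Rightarrow> _"
  by (rule sp1_pairing)

lemma sp1_self [simp]: "sp1 (w :: 'q \<times> 'q) w = 0"
  by (simp add: sp1_def mult.commute char2)

lemma sp_axis: "sp v (axis i w) = sp1 (v $ i) (w :: 'q \<times> 'q)"
  by (simp add: sp_def axis_def if_distrib cong: if_cong)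

sublocale sp: nondegenerate_pairing "sp :: ('q \<times> 'q) ^ 'n :: finite \<Rightarrow> _"
proof
  fix x y z :: "('q \<times> 'q) ^ 'n"
  show "sp (x + y) z = sp x z + sp y z"
    by (simp add: sp_def sp1.add_left sum.distrib)
  show "sp x y = sp y x" by (simp add: sp_def sp1.sym)
  assume *: "\<And>y. sp x y = 0"
  have "x $ i = 0" for i by (rule sp1.nondeg) (metis * sp_axis)
  then show "x = 0" by (simp add: vec_eq_iff)
qed

lemma sp_self [simp]: "sp (v :: ('q \<times> 'q) ^ 'n :: finite) v = 0"
  by (simp add: sp_def)

lemma sp1_coord:
  "sp1 w w' = (\<Sum>l<h. coord h e l (fst w) * coord h e l (snd w') + coord h e l (snd w) * coord h e l (fst w'))"
  by (simp add: sp1_def tr_add tr_mult_coord sum.distrib)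

lemma h_pos: "h > 0"
proof (rule ccontr)
  assume "\<not> h > 0"
  then have "CARD('q) = 1" by (simp add: card_q)
  then show False by (metis UNIV_I card_1_singletonE singletonD zero_neq_one)
qed

lemma card_site: "CARD('q \<times> 'q) = 2 ^ (2 * h)"
  by (simp add: card_q mult_2 power_add)

end

section \<open>Pauli operators\<close>

lemma bit_sign_eq_iff: "(bit_sign a :: complex) = bit_sign b \<longleftrightarrow> a = b"
  by (cases a; cases b) auto

lemma adj_mat1 [simp]: "adj (mat 1) = mat 1"
  by (simp add: adj_def vec_eq_iff mat_def)

lemma scale_op_scale_op [simp]: "scale_op c (scale_op d A) = scale_op (c * d) A"
  by (simp add: scale_op_def vec_eq_iff)

lemma scale_op_1 [simp]: "scale_op 1 A = A"
  by (simp add: scale_op_def vec_eq_iff)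

lemma scale_op_mult_left: "scale_op c A ** B = scale_op c (A ** B)"
  by (simp add: scale_op_def matrix_matrix_mult_def vec_eq_iff sum_distrib_left mult.assoc)

lemma scale_op_mult_right: "A ** scale_op c B = scale_op c (A ** B)"
  by (simp add: scale_op_def matrix_matrix_mult_def vec_eq_iff sum_distrib_left mult_ac)

lemma adj_scale_op: "adj (scale_op c A) = scale_op (cnj c) (adj A)"
  by (simp add: scale_op_def adj_def vec_eq_iff)

lemma scale_op_vector_mult: "scale_op c A *v x = c *s (A *v x)"
  by (simp add: scale_op_def matrix_vector_mult_def vec_eq_iff sum_distrib_left mult.assoc)

text \<open>Distributivity, read on vectors: it lets matrix products of tensor products factorise
  site by site.\<close>

lemma sum_prod_vec:
  fixes f :: "'n :: finite \<Rightarrow> 'a :: finite \<Rightarrow> 'c :: comm_semiring_1"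
  shows "(\<Sum>z\<in>(UNIV :: ('a ^ 'n) set). \<Prod>j\<in>UNIV. f j (z $ j)) = (\<Prod>j\<in>UNIV. \<Sum>y\<in>UNIV. f j y)"
proof -
  have "(\<Prod>j\<in>UNIV. \<Sum>y\<in>UNIV. f j y) = (\<Sum>g\<in>UNIV. \<Prod>j\<in>UNIV. f j (g j))"
    using prod_sum_PiE[of "UNIV :: 'n set" "\<lambda>_. UNIV" f] by simp
  also have "\<dots> = (\<Sum>z\<in>(UNIV :: ('a ^ 'n) set). \<Prod>j\<in>UNIV. f j (z $ j))"
    by (rule sum.reindex_bij_witness[of _ vec_nth vec_lambda]) auto
  finally show ?thesis by simp
qed

lemma tensor_op_mult: "tensor_op U ** tensor_op V = tensor_op (\<lambda>j. U j ** V j)"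
proof -
  have "(tensor_op U ** tensor_op V) $ y $ x = tensor_op (\<lambda>j. U j ** V j) $ y $ x" for x y
    using sum_prod_vec[of "\<lambda>j k. U j $ (y $ j) $ k * V j $ k $ (x $ j)"]
    by (simp add: tensor_op_def matrix_matrix_mult_def prod.distrib)
  then show ?thesis by (simp add: vec_eq_iff)
qed

lemma adj_tensor_op: "adj (tensor_op U) = tensor_op (\<lambda>j. adj (U j))"
  by (simp add: tensor_op_def adj_def vec_eq_iff cnj_prod)

lemma tensor_op_scale: "tensor_op (\<lambda>j. scale_op (c j) (A j)) = scale_op (\<Prod>j\<in>UNIV. c j) (tensor_op A)"
  by (simp add: tensor_op_def scale_op_def vec_eq_iff prod.distrib)

lemma prod_if_all: "finite A \<Longrightarrow> (\<Prod>x\<in>A. if P x then f x else 0) = (if \<forall>x\<in>A. P x then prod f A else (0 :: 'a :: comm_semiring_1))"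
  by (induction A rule: finite_induct) auto

lemma phases_closed: "c \<in> phases \<Longrightarrow> d \<in> phases \<Longrightarrow> c * d \<in> phases"
  by (auto simp: phases_def)

lemma phases_bit_sign [simp]: "bit_sign b \<in> phases"
  by (cases b) (auto simp: phases_def)

lemma phases_cnj: "c \<in> phases \<Longrightarrow> cnj c \<in> phases"
  by (auto simp: phases_def)

lemma phases_mult_cnj: "c \<in> phases \<Longrightarrow> c * cnj c = 1"
  by (auto simp: phases_def)

lemma phases_nonzero: "c \<in> phases \<Longrightarrow> c \<noteq> 0"
  by (auto simp: phases_def)

lemma one_in_phases [simp]: "1 \<in> phases" by (simp add: phases_def)

lemma phases_prod: "(\<And>j. j \<in> A \<Longrightarrow> c j \<in> phases) \<Longrightarrow> prod c A \<in> phases"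
  by (induction A rule: infinite_finite_induct) (auto simp: phases_closed)

definition site_pauli :: "complex \<Rightarrow> 'q :: {field, finite} \<times> 'q \<Rightarrow> 'q site_op" where
  "site_pauli c w = scale_op c (shift_op (fst w) ** phase_op (snd w))"

lemma site_pauli_entry:
  "site_pauli c w $ y $ x = (if y = x + fst w then c * bit_sign (tr (snd w * x)) else 0)"
proof -
  have "(\<Sum>k\<in>UNIV. (if y = k + fst w then 1 else 0) * (if k = x then bit_sign (tr (snd w * x)) else 0))
      = (\<Sum>k\<in>UNIV. if k = x then (if y = x + fst w then bit_sign (tr (snd w * x)) else 0) else (0 :: complex))"
    by (rule sum.cong) auto
  moreover have "phase_op (snd w) $ k $ x = (if k = x then bit_sign (tr (snd w * x)) else 0)" for k
    by (simp add: phase_op_def bit_sign_def)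
  ultimately show ?thesis
    by (simp add: site_pauli_def scale_op_def shift_op_def matrix_matrix_mult_def)
qed

lemma paulis1_eq: "paulis1 = {site_pauli c w | c w. c \<in> phases}"
  by (force simp: paulis1_def site_pauli_def)

definition pauli :: "complex \<Rightarrow> ('q :: {field, finite} \<times> 'q) ^ 'n :: finite \<Rightarrow> ('q, 'n) op" where
  "pauli c v = pauli_op c (\<chi> j. fst (v $ j)) (\<chi> j. snd (v $ j))"

lemma pauli_op_eq: "pauli_op c a b = pauli c (\<chi> j. (a $ j, b $ j))"
  by (simp add: pauli_def)

lemma paulis_eq: "paulis = {pauli c v | c v. c \<in> phases}"
  unfolding paulis_def by (metis pauli_op_eq pauli_def)

lemma tensor_site_pauli: "tensor_op (\<lambda>j. site_pauli (c j) (v $ j)) = pauli (\<Prod>j\<in>UNIV. c j) v"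
  by (simp add: site_pauli_def tensor_op_scale pauli_def pauli_op_def)

lemma pauli_eq_tensor: "pauli c v = scale_op c (tensor_op (\<lambda>j. site_pauli 1 (v $ j)))"
  by (simp add: site_pauli_def pauli_def pauli_op_def)

text \<open>Exponent of the sign that arises when the Z-part of \<open>v\<close> is moved past the
  X-part of \<open>w\<close>. It is not symmetric; its symmetrisation is \<open>sp\<close>, and
  \<open>xz v v\<close> decides whether the operator with label \<open>v\<close> and phase 1 squares
  to 1 or to -1.\<close>

definition xz :: "('q :: {field, finite} \<times> 'q) ^ 'n :: finite \<Rightarrow> ('q \<times> 'q) ^ 'n \<Rightarrow> bit" where
  "xz v w = (\<Sum>j\<in>UNIV. tr (snd (v $ j) * fst (w $ j)))"

lemma pauli_entry:
  "pauli c v $ y $ x =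
    (if \<forall>j. y $ j = x $ j + fst (v $ j) then c * bit_sign (\<Sum>j\<in>UNIV. tr (snd (v $ j) * x $ j)) else 0)"
  by (simp add: pauli_eq_tensor scale_op_def tensor_op_def site_pauli_entry prod_if_all bit_sign_sum)

lemma scale_op_pauli [simp]: "scale_op d (pauli c v) = pauli (d * c) v"
  by (simp add: pauli_def pauli_op_def)

lemma scale_op_site_pauli [simp]: "scale_op d (site_pauli c v) = site_pauli (d * c) v"
  by (simp add: site_pauli_def)

text \<open>\<open>tau\<close> regrouped by position, so that the local form \<open>sp1\<close> and
  local maps apply to its components.\<close>

definition label :: "('q :: {field, finite}, 'n :: finite) op \<Rightarrow> ('q \<times> 'q) ^ 'n" where
  "label E = (\<chi> j. (tau E $ Inl j, tau E $ Inr j))"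

definition wt :: "('q :: zero \<times> 'q) ^ 'n :: finite \<Rightarrow> nat" where
  "wt v = card {j. v $ j \<noteq> 0}"

context trace_basis
begin

lemma sp_eq_xz: "sp (v :: ('q \<times> 'q) ^ 'n :: finite) w = xz v w + xz w v"
  by (simp add: sp_def sp1_def xz_def tr_add sum.distrib mult.commute add.commute)

lemma site_pauli_mult:
  "site_pauli c w ** site_pauli c' (w' :: 'q \<times> 'q) = site_pauli (c * c' * bit_sign (tr (snd w * fst w'))) (w + w')"
proof -
  have "(\<Sum>k\<in>UNIV. (if y = k + fst w then c * bit_sign (tr (snd w * k)) else 0) *
          (if k = x + fst w' then c' * bit_sign (tr (snd w' * x)) else 0)) =
        (\<Sum>k\<in>UNIV. if k = x + fst w' then (if y = x + (fst w + fst w') then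
          c * c' * bit_sign (tr (snd w * fst w')) * bit_sign (tr ((snd w + snd w') * x)) else 0) else (0 :: complex))"
    for x y
    by (rule sum.cong) (auto simp: distrib_left distrib_right tr_add bit_sign_add add_ac)
  then show ?thesis
    by (simp add: vec_eq_iff matrix_matrix_mult_def site_pauli_entry)
qed

lemma site_pauli_one: "mat 1 = site_pauli 1 (0 :: 'q \<times> 'q)"
  by (simp add: vec_eq_iff site_pauli_entry mat_def)

lemma site_pauli_adj: "adj (site_pauli c (w :: 'q \<times> 'q)) = site_pauli (cnj c * bit_sign (tr (snd w * fst w))) w"
proof -
  have "adj (site_pauli c w) $ y $ x = site_pauli (cnj c * bit_sign (tr (snd w * fst w))) w $ y $ x" for y x
  proof (cases "y = x + fst w")
    case True
    have "x + fst w + fst w = x" by (simp add: add.assoc char2)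
    then show ?thesis unfolding True
      by (cases "tr (snd w * fst w)"; cases "tr (snd w * x)")
         (simp_all add: site_pauli_entry adj_def distrib_left tr_add)
  next
    case False
    then have "x \<noteq> y + fst w" by (auto simp: add.assoc char2)
    with False show ?thesis by (simp add: site_pauli_entry adj_def)
  qed
  then show ?thesis by (simp add: vec_eq_iff)
qed

text \<open>Column 0 exhibits the shift \<open>fst w\<close> and the scalar \<open>c\<close>. The
  signs in the other columns give the character \<open>tr (snd w * x)\<close>, and thereby
  \<open>snd w\<close>, by nondegeneracy of the trace form.\<close>

lemma site_pauli_inject:
  assumes "c \<noteq> 0"
  shows "site_pauli c (w :: 'q \<times> 'q) = site_pauli c' w' \<longleftrightarrow> c = c' \<and> w = w'"
proof
  assume eq: "site_pauli c w = site_pauli c' w'"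
  have *: "(if y = x + fst w then c * bit_sign (tr (snd w * x)) else 0) =
           (if y = x + fst w' then c' * bit_sign (tr (snd w' * x)) else 0)" for x y
    using eq by (metis site_pauli_entry)
  have f: "fst w = fst w'" using *[of "fst w" 0] assms by (auto split: if_splits)
  have c: "c = c'" using *[of "fst w" 0] f by auto
  have "tr ((snd w + snd w') * x) = 0" for x
  proof -
    have "bit_sign (tr (snd w * x)) = (bit_sign (tr (snd w' * x)) :: complex)"
      using *[of "x + fst w" x] assms unfolding f c by simp
    then show ?thesis by (simp add: bit_sign_eq_iff distrib_right tr_add)
  qed
  then have "snd w = snd w'" by (metis tr_nondegenerate add_eq_0_iff2)
  then show "c = c' \<and> w = w'" using f c by (simp add: prod_eq_iff)
qed auto

lemma xz_add_left: "xz (u + v) (w :: ('q \<times> 'q) ^ 'n :: finite) = xz u w + xz v w"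
  by (simp add: xz_def distrib_right tr_add sum.distrib)

lemma xz_0 [simp]: "xz (0 :: ('q \<times> 'q) ^ 'n :: finite) w = 0" "xz w (0 :: ('q \<times> 'q) ^ 'n :: finite) = 0"
  by (simp_all add: xz_def)

lemma pauli_mult:
  "pauli c v ** pauli c' (v' :: ('q \<times> 'q) ^ 'n :: finite) = pauli (c * c' * bit_sign (xz v v')) (v + v')"
proof -
  have "pauli c v ** pauli c' v' = scale_op (c * c')
      (tensor_op (\<lambda>j. site_pauli (bit_sign (tr (snd (v $ j) * fst (v' $ j)))) ((v + v') $ j)))"
    by (simp add: pauli_eq_tensor scale_op_mult_left scale_op_mult_right tensor_op_mult site_pauli_mult mult.commute)
  also have "\<dots> = pauli (c * c' * bit_sign (xz v v')) (v + v')"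
    unfolding tensor_site_pauli by (simp add: xz_def bit_sign_sum)
  finally show ?thesis .
qed

lemma pauli_one: "mat 1 = pauli 1 (0 :: ('q \<times> 'q) ^ 'n :: finite)"
  by (auto simp: vec_eq_iff pauli_entry mat_def)

lemma pauli_adj:
  "adj (pauli c (v :: ('q \<times> 'q) ^ 'n :: finite)) = pauli (cnj c * bit_sign (xz v v)) v"
proof -
  have "adj (pauli c v) = scale_op (cnj c)
      (tensor_op (\<lambda>j. site_pauli (bit_sign (tr (snd (v $ j) * fst (v $ j)))) (v $ j)))"
    by (simp add: pauli_eq_tensor adj_scale_op adj_tensor_op site_pauli_adj)
  also have "\<dots> = pauli (cnj c * bit_sign (xz v v)) v"
    unfolding tensor_site_pauli by (simp add: xz_def bit_sign_sum)
  finally show ?thesis .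
qed

lemma pauli_inject:
  assumes "c \<noteq> 0"
  shows "pauli c (v :: ('q \<times> 'q) ^ 'n :: finite) = pauli c' v' \<longleftrightarrow> c = c' \<and> v = v'"
proof
  assume eq: "pauli c v = pauli c' v'"
  have *: "(if \<forall>j. y $ j = x $ j + fst (v $ j) then c * bit_sign (\<Sum>j\<in>UNIV. tr (snd (v $ j) * x $ j)) else 0) =
           (if \<forall>j. y $ j = x $ j + fst (v' $ j) then c' * bit_sign (\<Sum>j\<in>UNIV. tr (snd (v' $ j) * x $ j)) else 0)" for x y
    using arg_cong[OF eq, of "\<lambda>A. A $ y $ x"] unfolding pauli_entry .
  have f: "\<And>j. fst (v $ j) = fst (v' $ j)" using *[of "\<chi> j. fst (v $ j)" 0] assms by (auto split: if_splits)
  have c: "c = c'" using *[of "\<chi> j. fst (v $ j)" 0] f by auto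
  have "tr ((snd (v $ i) + snd (v' $ i)) * x) = 0" for x i
  proof -
    \<comment> \<open>The basis state \<open>axis i x\<close> differs from 0 only at position
      \<open>i\<close>, so its sign isolates the component of the label there.\<close>
    have "(\<Sum>j\<in>UNIV. tr (snd (u $ j) * axis i x $ j)) = tr (snd (u $ i) * x)" for u :: "('q \<times> 'q) ^ 'n"
    proof -
      have "(\<Sum>j\<in>UNIV. tr (snd (u $ j) * axis i x $ j)) = (\<Sum>j\<in>UNIV. if j = i then tr (snd (u $ i) * x) else 0)"
        by (rule sum.cong) (auto simp: axis_def)
      then show ?thesis by simp
    qed
    then have "bit_sign (tr (snd (v $ i) * x)) = (bit_sign (tr (snd (v' $ i) * x)) :: complex)"
      using *[of "axis i x + (\<chi> j. fst (v $ j))" "axis i x"] assms by (simp add: f c)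
    then show ?thesis by (simp add: bit_sign_eq_iff distrib_right tr_add)
  qed
  then have "snd (v $ i) = snd (v' $ i)" for i by (metis tr_nondegenerate add_eq_0_iff2)
  then show "c = c' \<and> v = v'" using f c by (simp add: prod_eq_iff vec_eq_iff)
qed auto

lemma tau_pauli:
  assumes "c \<in> phases"
  shows "tau (pauli c (v :: ('q \<times> 'q) ^ 'n :: finite)) = (\<chi> s. case s of Inl j \<Rightarrow> fst (v $ j) | Inr j \<Rightarrow> snd (v $ j))"
  unfolding tau_def
proof (rule the_equality)
  let ?t = "(\<chi> s. case s of Inl j \<Rightarrow> fst (v $ j) | Inr j \<Rightarrow> snd (v $ j)) :: 'q ^ ('n + 'n)"
  show "\<exists>d\<in>phases. pauli c v = pauli_op d (\<chi> j. ?t $ Inl j) (\<chi> j. ?t $ Inr j)"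
    using assms by (auto simp: pauli_def)
  fix t :: "'q ^ ('n + 'n)"
  assume "\<exists>d\<in>phases. pauli c v = pauli_op d (\<chi> j. t $ Inl j) (\<chi> j. t $ Inr j)"
  then have "v = (\<chi> j. (t $ Inl j, t $ Inr j))"
    using pauli_inject[OF phases_nonzero[OF assms]] by (auto simp: pauli_op_eq)
  then show "t = ?t" by (auto simp: vec_eq_iff split: sum.split)
qed

lemma label_pauli [simp]: "c \<in> phases \<Longrightarrow> label (pauli c v) = (v :: ('q \<times> 'q) ^ 'n :: finite)"
  by (simp add: label_def tau_pauli)

lemma weight_eq: "weight E = wt (label (E :: ('q, 'n :: finite) op))"
  by (simp add: weight_def wt_def label_def prod_eq_iff)

lemma pauli_mem: "c \<in> phases \<Longrightarrow> pauli c v \<in> paulis"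
  by (auto simp: paulis_eq)

lemma pauliE:
  assumes "E \<in> paulis" obtains c where "c \<in> phases" "E = pauli c (label (E :: ('q, 'n :: finite) op))"
  using assms by (auto simp: paulis_eq)

lemma paulis_mult: "E \<in> paulis \<Longrightarrow> F \<in> paulis \<Longrightarrow> E ** F \<in> (paulis :: ('q, 'n :: finite) op set)"
  by (auto simp: paulis_eq pauli_mult) (metis phases_closed phases_bit_sign)

lemma label_mult:
  "E \<in> paulis \<Longrightarrow> F \<in> paulis \<Longrightarrow> label (E ** F) = label E + label (F :: ('q, 'n :: finite) op)"
  by (auto simp: paulis_eq pauli_mult phases_closed)

text \<open>\<open>adj\<close> inverts a Pauli operator, so conjugation leaves just a commutation
  sign: the phase \<open>c\<close> cancels against its conjugate, and the three signs from the two
  products and the adjoint combine to that of \<open>sp v w\<close>.\<close>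

lemma pauli_conj:
  assumes "c \<in> phases"
  shows "pauli c v ** pauli d (w :: ('q \<times> 'q) ^ 'n :: finite) ** adj (pauli c v) = pauli (bit_sign (sp v w) * d) w"
proof -
  have s: "bit_sign (xz v w) * (bit_sign (xz v v) * bit_sign (xz (v + w) v)) = (bit_sign (sp v w) :: complex)"
    by (cases "xz v w"; cases "xz v v"; cases "xz w v") (simp_all add: xz_add_left sp_eq_xz)
  have v: "v + w + v = w" unfolding add.commute[of v w] add.assoc sp.add_self by simp
  have "c * d * bit_sign (xz v w) * (cnj c * bit_sign (xz v v)) * bit_sign (xz (v + w) v) =
      (c * cnj c) * (bit_sign (xz v w) * (bit_sign (xz v v) * bit_sign (xz (v + w) v))) * d"
    by (simp only: ac_simps)
  also have "\<dots> = bit_sign (sp v w) * d" using phases_mult_cnj[OF assms] s by simp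
  finally show ?thesis unfolding pauli_adj pauli_mult v by (rule arg_cong)
qed

lemma pauli_commute:
  "pauli c v ** pauli d (w :: ('q \<times> 'q) ^ 'n :: finite) = scale_op (bit_sign (sp v w)) (pauli d w ** pauli c v)"
  by (simp add: pauli_mult sp_eq_xz bit_sign_add ac_simps)

end

section \<open>Stabiliser groups\<close>

text \<open>The last condition says that the identity is the only scalar in \<open>S\<close>; equivalently, the fixed
  space is nonzero.  It makes all elements involutions, so closure under inverses is automatic.\<close>

definition fixed_space :: "('q :: {field, finite}, 'n :: finite) op set \<Rightarrow> ('q, 'n) state set" where
  "fixed_space S = {x. \<forall>E\<in>S. E *v x = x}"

definition stab_group :: "('q :: {field, finite}, 'n :: finite) op set \<Rightarrow> bool" where
  "stab_group S \<longleftrightarrow> S \<subseteq> paulis \<and> mat 1 \<in> S \<and> (\<forall>E\<in>S. \<forall>F\<in>S. E ** F \<in> S) \<and>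
     (\<forall>c. pauli c 0 \<in> S \<longrightarrow> c = 1)"

lemma subspace_fixed_space: "vec.subspace (fixed_space S)"
  by (auto simp: vec.subspace_def fixed_space_def matrix_vector_right_distrib vec.scale matrix_vector_mult_scaleR
      vector_scalar_commute)

lemma dim_UNIV_state: "vec.dim (UNIV :: ('q :: finite, 'n :: finite) state set) = CARD('q) ^ CARD('n)"
  unfolding vec.dim_UNIV card_cart_basis by simp

lemma finite_paulis: "finite (paulis :: ('q :: {field, finite}, 'n :: finite) op set)"
proof -
  have "paulis = (\<lambda>(c, v). pauli c v) ` (phases \<times> (UNIV :: (('q \<times> 'q) ^ 'n) set))"
    by (auto simp: paulis_eq image_iff)
  moreover have "finite phases" by (simp add: phases_def)
  ultimately show ?thesis by (metis finite_SigmaI finite_imageI finite)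
qed

context trace_basis
begin

lemma paulis_commute:
  assumes E: "E \<in> paulis" and F: "F \<in> (paulis :: ('q, 'n :: finite) op set)"
  shows "E ** F = scale_op (bit_sign (sp (label E) (label F))) (F ** E)"
proof -
  obtain c where c: "E = pauli c (label E)" using pauliE[OF E] by blast
  obtain d where d: "F = pauli d (label F)" using pauliE[OF F] by blast
  show ?thesis using pauli_commute[of c "label E" d "label F"] unfolding c[symmetric] d[symmetric] .
qed

lemma group_pauli_group: "group (pauli_group :: ('q, 'n :: finite) op monoid)"
proof (rule groupI)
  fix x :: "('q, 'n) op" assume "x \<in> carrier pauli_group"
  then obtain c where c: "c \<in> phases" "x = pauli c (label x)"
    by (auto simp: pauli_group_def elim: pauliE)
  have "adj x ** x = mat 1"
  proof -
    have "cnj c * c * (bit_sign (xz (label x) (label x)) * bit_sign (xz (label x) (label x))) = 1"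
      using phases_mult_cnj[OF c(1)] by (simp add: mult.commute)
    then show ?thesis
      by (subst (1 2) c(2)) (simp add: pauli_adj pauli_mult sp.add_self pauli_one mult_ac)
  qed
  moreover have "adj x \<in> paulis"
    by (subst c(2)) (auto simp: pauli_adj intro!: pauli_mem phases_closed phases_cnj c(1))
  ultimately show "\<exists>y\<in>carrier pauli_group. y \<otimes>\<^bsub>pauli_group\<^esub> x = \<one>\<^bsub>pauli_group\<^esub>"
    by (auto simp: pauli_group_def)
next
  have "(mat 1 :: ('q, 'n) op) \<in> paulis" unfolding pauli_one by (rule pauli_mem) simp
  then show "\<one>\<^bsub>pauli_group\<^esub> \<in> carrier (pauli_group :: ('q, 'n) op monoid)" by (simp add: pauli_group_def)
qed (auto simp: pauli_group_def paulis_mult matrix_mul_assoc)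

lemma stab_groupD:
  assumes "stab_group (S :: ('q, 'n :: finite) op set)"
  shows "S \<subseteq> paulis" "mat 1 \<in> S" "E \<in> S \<Longrightarrow> F \<in> S \<Longrightarrow> E ** F \<in> S" "pauli c 0 \<in> S \<Longrightarrow> c = 1"
    "finite S"
  using assms by (auto simp: stab_group_def intro: finite_subset[OF _ finite_paulis])

lemma stab_group_square:
  assumes S: "stab_group (S :: ('q, 'n :: finite) op set)" and E: "E \<in> S"
  shows "E ** E = mat 1"
proof -
  obtain c v where "E = pauli c v" using S E by (metis stab_groupD(1) pauliE subsetD)
  then have *: "E ** E = pauli (c * c * bit_sign (xz v v)) 0" by (simp add: pauli_mult sp.add_self)
  then have "c * c * bit_sign (xz v v) = 1" using S E by (metis stab_groupD(3,4))
  with * show ?thesis by (simp add: pauli_one)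
qed

text \<open>The product of two elements with the same label is a scalar in \<open>S\<close>, hence
  1, and the elements of \<open>S\<close> are involutions.\<close>

lemma stab_group_label_inj:
  assumes S: "stab_group (S :: ('q, 'n :: finite) op set)"
  shows "inj_on label S"
proof (rule inj_onI)
  fix E F assume E: "E \<in> S" and F: "F \<in> S" and l: "label E = label F"
  obtain c where "E = pauli c (label E)" using S E by (metis stab_groupD(1) pauliE subsetD)
  moreover obtain d where "F = pauli d (label E)" using S F l by (metis stab_groupD(1) pauliE subsetD)
  ultimately have *: "E ** F = pauli (c * d * bit_sign (xz (label E) (label E))) 0"
    by (metis pauli_mult sp.add_self)
  then have "c * d * bit_sign (xz (label E) (label E)) = 1" using S E F by (metis stab_groupD(3,4))
  with * have "E ** F = mat 1" by (simp add: pauli_one)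
  then show "E = F"
    by (metis stab_group_square[OF S F] matrix_mul_assoc matrix_mul_lid matrix_mul_rid)
qed

lemma stab_group_isotropic:
  assumes S: "stab_group (S :: ('q, 'n :: finite) op set)" and E: "E \<in> S" and F: "F \<in> S"
  shows "sp (label E) (label F) = 0"
proof -
  \<comment> \<open>A group consisting of involutions is commutative; two anticommuting elements
    would therefore put the scalar -1 into \<open>S\<close>.\<close>
  have "(E ** F) ** (E ** F) = mat 1" using S E F by (metis stab_groupD(3) stab_group_square)
  moreover have "(E ** F) ** (F ** E) = mat 1"
    by (metis matrix_mul_assoc matrix_mul_lid stab_group_square[OF S E] stab_group_square[OF S F])
  ultimately have "E ** F = F ** E"
    by (metis matrix_mul_assoc matrix_mul_lid)
  moreover have "E ** F = scale_op (bit_sign (sp (label E) (label F))) (F ** E)"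
    using S E F by (intro paulis_commute) (auto dest: stab_groupD(1))
  ultimately have "mat 1 = scale_op (bit_sign (sp (label E) (label F))) (mat 1 :: ('q, 'n) op)"
    by (metis \<open>(E ** F) ** (E ** F) = mat 1\<close> scale_op_mult_left)
  then have "pauli (bit_sign (sp (label E) (label F))) 0 \<in> S"
    using stab_groupD(2)[OF S] by (simp add: pauli_one)
  then have "(bit_sign (sp (label E) (label F)) :: complex) = 1" using S by (metis stab_groupD(4))
  then show ?thesis by (cases "sp (label E) (label F)") auto
qed

lemma stab_group_commute:
  assumes S: "stab_group (S :: ('q, 'n :: finite) op set)" and E: "E \<in> S" and F: "F \<in> S"
  shows "E ** F = F ** E"
proof -
  have "E ** F = scale_op (bit_sign (sp (label E) (label F))) (F ** E)"
    using S E F by (intro paulis_commute) (auto dest: stab_groupD(1))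
  then show ?thesis by (simp add: stab_group_isotropic[OF assms])
qed

lemma label_one [simp]: "label (mat 1 :: ('q, 'n :: finite) op) = 0"
  by (simp add: pauli_one)

lemma add_closed_label:
  assumes S: "stab_group (S :: ('q, 'n :: finite) op set)"
  shows "add_closed (label ` S)"
  unfolding add_closed_def
proof (intro conjI ballI)
  show "0 \<in> label ` S" using stab_groupD(2)[OF S] by (metis image_eqI label_one)
  fix x y assume "x \<in> label ` S" "y \<in> label ` S"
  then obtain E F where *: "E \<in> S" "F \<in> S" "x = label E" "y = label F" by auto
  then have "x + y = label (E ** F)" using stab_groupD(1)[OF S] by (simp add: label_mult subsetD)
  then show "x + y \<in> label ` S" using * stab_groupD(3)[OF S] by auto
qed

text \<open>With phase 1 the square is the sign of \<open>xz w w\<close>, and the phase i repairs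
  the case -1. So every label is carried by an involution.\<close>

lemma hermitian_phase:
  obtains c where "c \<in> phases" "pauli c (w :: ('q \<times> 'q) ^ 'n :: finite) ** pauli c w = mat 1"
proof -
  show ?thesis
    by (rule that[of "if xz w w = 0 then 1 else \<i>"])
       (auto simp: phases_def pauli_mult pauli_one sp.add_self)
qed

text \<open>Adjoining \<open>E\<close> halves the fixed space: an operator \<open>F\<close> that commutes with \<open>T\<close> and anticommutes
  with \<open>E\<close> swaps the two eigenspaces of \<open>E\<close> on the fixed space of \<open>T\<close>.\<close>

lemma stab_group_extension:
  assumes T: "stab_group (T :: ('q, 'n :: finite) op set)" and E: "E \<in> paulis" and EE: "E ** E = mat 1"
    and ET: "\<And>F. F \<in> T \<Longrightarrow> E ** F = F ** E" and lE: "label E \<notin> label ` T"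
  defines "S' \<equiv> T \<union> (**) E ` T"
  shows "stab_group S'" "card S' = 2 * card T"
    "vec.dim (fixed_space T) = 2 * vec.dim (fixed_space S')"
proof -
  have TP: "T \<subseteq> paulis" by (rule stab_groupD(1)[OF T])
  have closed: "F ** G \<in> S'" if F: "F \<in> S'" and G: "G \<in> S'" for F G
  proof -
    obtain F' where F': "F' \<in> T" "F = F' \<or> F = E ** F'" using F by (auto simp: S'_def)
    obtain G' where G': "G' \<in> T" "G = G' \<or> G = E ** G'" using G by (auto simp: S'_def)
    have comm: "E ** F' = F' ** E" using ET F' by auto
    have "E ** F' ** (E ** G') = E ** (F' ** E) ** G'" by (simp add: matrix_mul_assoc)
    also have "\<dots> = F' ** G'" by (simp add: comm[symmetric] matrix_mul_assoc EE)
    finally have 1: "E ** F' ** (E ** G') = F' ** G'" .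
    have "F' ** (E ** G') = F' ** E ** G'" by (simp add: matrix_mul_assoc)
    also have "\<dots> = E ** (F' ** G')" by (simp add: comm[symmetric] matrix_mul_assoc)
    finally have 2: "F' ** (E ** G') = E ** (F' ** G')" .
    have "F' ** G' \<in> T" using F' G' stab_groupD(3)[OF T] by auto
    then show ?thesis using F'(2) G'(2) 1 2 by (auto simp: S'_def matrix_mul_assoc[symmetric])
  qed
  have one: "c = 1" if "pauli c 0 \<in> S'" for c
  proof -
    have "pauli c 0 \<noteq> E ** F" if F: "F \<in> T" for F
    proof
      assume eq: "pauli c 0 = E ** F"
      then have c: "c \<in> phases"
      proof -
        obtain d u where d: "d \<in> phases" "E ** F = pauli d u"
          using paulis_mult[OF E] F TP by (blast elim: pauliE)
        then show ?thesis using pauli_inject[OF phases_nonzero[OF d(1)], of u c 0] eq by auto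
      qed
      have "label E + label F = 0"
        using label_mult[OF E, of F] F TP c unfolding eq[symmetric] by auto
      then have "label E = label F" by (simp add: sp.add_eq_0_iff_eq)
      then show False using lE F by auto
    qed
    then show ?thesis using that stab_groupD(4)[OF T] by (auto simp: S'_def)
  qed
  have "S' \<subseteq> paulis" using TP E paulis_mult by (auto simp: S'_def)
  then show S': "stab_group S'"
    using closed one stab_groupD(2)[OF T] by (simp add: stab_group_def) (simp add: S'_def)
  have "inj_on ((**) E) T"
    by (rule inj_onI) (metis EE matrix_mul_assoc matrix_mul_lid)
  moreover have "T \<inter> (**) E ` T = {}"
  proof -
    have False if "F \<in> T" "E ** F \<in> T" for F
    proof -
      have "E ** F ** F \<in> T" using that stab_groupD(3)[OF T] by auto
      then show False using lE stab_group_square[OF T that(1)] by (simp flip: matrix_mul_assoc)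
    qed
    then show ?thesis by auto
  qed
  ultimately show "card S' = 2 * card T"
    unfolding S'_def using stab_groupD(5)[OF T] by (subst card_Un_disjoint) (auto simp: card_image)
  \<comment> \<open>The label of \<open>E\<close> lies outside the label code of \<open>T\<close>,
    so duality yields a \<open>w\<close> orthogonal to all labels of \<open>T\<close> but not to
    that of \<open>E\<close>. The phase \<open>c\<close> makes the operator \<open>F\<close> with
    label \<open>w\<close> an involution, hence a bijection between the two eigenspaces.\<close>
  from sp.perp_separates[OF add_closed_label[OF T] lE]
  obtain w where w: "w \<in> perp sp (label ` T)" "sp w (label E) = 1" by blast
  obtain c where c: "c \<in> phases" "pauli c w ** pauli c w = mat 1" by (rule hermitian_phase)
  define F where "F = pauli c w"
  have FG: "F ** G = scale_op (bit_sign (sp w (label G))) (G ** F)" if "G \<in> paulis" for G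
    using paulis_commute[of F G] that c(1) by (auto simp: F_def pauli_mem)
  have FT: "F ** G = G ** F" if "G \<in> T" for G
    using FG[of G] that TP w(1) by (auto simp: perp_def sp.sym[of w])
  have FE: "F ** E = scale_op (- 1) (E ** F)" using FG[OF E] w(2) by simp
  define A where "A = fixed_space T"
  define Ap where "Ap = {x \<in> A. E *v x = x}"
  define Am where "Am = {x \<in> A. E *v x = - x}"
  have subA: "vec.subspace A" by (simp add: A_def subspace_fixed_space)
  have Ap: "Ap = fixed_space S'"
    by (auto simp: Ap_def A_def S'_def fixed_space_def matrix_vector_mul_assoc[symmetric])
       (metis matrix_mul_rid stab_groupD(2)[OF T] image_eqI Un_iff matrix_vector_mul_assoc)
  have subAp: "vec.subspace Ap" by (simp add: Ap subspace_fixed_space)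
  have subAm: "vec.subspace Am"
    using subA by (auto simp: Am_def vec.subspace_def matrix_vector_right_distrib vector_scalar_commute vec.scale_minus_right)
  have EA: "E *v x \<in> A" if "x \<in> A" for x
    using that ET by (auto simp: A_def fixed_space_def matrix_vector_mul_assoc)
       (metis matrix_vector_mul_assoc)
  have FA: "F *v x \<in> A" if "x \<in> A" for x
    using that FT by (auto simp: A_def fixed_space_def matrix_vector_mul_assoc)
       (metis matrix_vector_mul_assoc)
  have EF: "E *v (F *v x) = - (F *v (E *v x))" for x
    by (simp add: matrix_vector_mul_assoc FE scale_op_vector_mult vec.scale_minus_left)
  have FF: "F *v (F *v x) = x" for x
    by (simp add: matrix_vector_mul_assoc F_def c(2))
  have "(\<lambda>x. F *v x) ` Ap \<subseteq> Am" "(\<lambda>x. F *v x) ` Am \<subseteq> Ap"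
    by (auto simp: Ap_def Am_def FA EF vec.neg)
  then have FAp: "(\<lambda>x. F *v x) ` Ap = Am" and FAm: "(\<lambda>x. F *v x) ` Am = Ap"
    by (auto simp: image_subset_iff) (metis FF image_eqI)+
  have dims: "vec.dim Am = vec.dim Ap"
    using vec.dim_image_le[OF matrix_vector_mul_linear_gen, of F Ap] vec.dim_image_le[OF matrix_vector_mul_linear_gen, of F Am]
    by (simp add: FAp FAm)
  have "A = {x + y | x y. x \<in> Ap \<and> y \<in> Am}"
  proof (intro equalityI subsetI)
    fix x assume x: "x \<in> A"
    \<comment> \<open>\<open>(1 + E) / 2\<close> and \<open>(1 - E) / 2\<close> project onto the two
      eigenspaces, since \<open>E\<close> squares to 1.\<close>
    have "x = (1/2) *s (x + E *v x) + (1/2) *s (x - E *v x)"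
      by (simp add: vec_eq_iff field_simps)
    moreover have "(1/2) *s (x + E *v x) \<in> Ap"
      using x EA[OF x] subA
      by (auto simp: Ap_def vec.subspace_def vector_scalar_commute matrix_vector_right_distrib matrix_vector_mul_assoc EE add.commute)
    moreover have "(1/2) *s (x - E *v x) \<in> Am"
    proof -
      have "(1/2) *s (x - E *v x) \<in> A"
        by (rule vec.subspace_scale[OF subA vec.subspace_diff[OF subA x EA[OF x]]])
      moreover have "E *v ((1/2) *s (x - E *v x)) = (1/2) *s (E *v x - x)"
        by (simp add: vector_scalar_commute matrix_vector_mult_diff_distrib matrix_vector_mul_assoc EE)
      moreover have "(1/2) *s (E *v x - x) = - ((1/2) *s (x - E *v x))"
        by (simp add: vec_eq_iff algebra_simps)
      ultimately show ?thesis unfolding Am_def mem_Collect_eq by presburger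
    qed
    ultimately show "x \<in> {x + y | x y. x \<in> Ap \<and> y \<in> Am}" by blast
  qed (use subA in \<open>auto simp: Ap_def Am_def vec.subspace_def\<close>)
  moreover have "Ap \<inter> Am = {0}"
  proof -
    have "x = 0" if "x \<in> Ap" "x \<in> Am" for x
    proof -
      have "x = - x" using that by (simp add: Ap_def Am_def)
      then show ?thesis by (simp add: vec_eq_iff)
    qed
    then show ?thesis using subAp subAm vec.subspace_0 by auto
  qed
  ultimately have "vec.dim A = vec.dim Ap + vec.dim Am"
    using vec.dim_sums_Int[OF subAp subAm] by simp
  then show "vec.dim (fixed_space T) = 2 * vec.dim (fixed_space S')"
    by (simp add: dims Ap A_def)
qed

section \<open>Orders of stabiliser groups and dimensions of their fixed spaces\<close>

lemma mat_1_in_paulis: "(mat 1 :: ('q, 'n :: finite) op) \<in> paulis"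
  unfolding pauli_one by (rule pauli_mem) simp

lemma stab_group_trivial: "stab_group {mat 1 :: ('q, 'n :: finite) op}"
proof -
  note mat_1_in_paulis
  moreover have "c = 1" if "pauli c 0 = (mat 1 :: ('q, 'n) op)" for c
    using that pauli_inject[of 1 "0 :: ('q \<times> 'q) ^ 'n" c 0] unfolding pauli_one by auto
  ultimately show ?thesis by (auto simp: stab_group_def)
qed

text \<open>By \<open>stab_group_extension\<close> the fixed space is halved whenever the group
  doubles, so the product is constant along a chain of groups that starts at the trivial group,
  which fixes the whole space.\<close>

lemma card_mult_dim_fixed_space:
  assumes "stab_group (S :: ('q, 'n :: finite) op set)"
  shows "card S * vec.dim (fixed_space S) = CARD('q) ^ CARD('n)"
  using assms
proof (induction "card S" arbitrary: S rule: less_induct)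
  case less
  note S = less.prems
  show ?case
  proof (cases "S = {mat 1}")
    case True
    then have "fixed_space S = UNIV" by (auto simp: fixed_space_def)
    with True show ?thesis by (simp add: dim_UNIV_state del: vec.dim_UNIV)
  next
    case False
    \<comment> \<open>\<open>T\<close> will be a proper subgroup of largest order: adjoining any
      \<open>E\<close> outside it gives a group of twice the order inside \<open>S\<close>, which
      can no longer be proper.\<close>
    define \<T> where "\<T> = {T. stab_group T \<and> T \<subset> S}"
    have "finite \<T>" by (rule finite_subset[of _ "Pow S"]) (auto simp: \<T>_def stab_groupD(5)[OF S])
    moreover have "{mat 1} \<in> \<T>"
      using False stab_groupD(2)[OF S] by (auto simp: \<T>_def stab_group_trivial)
    ultimately have "finite (card ` \<T>)" "card ` \<T> \<noteq> {}" by auto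
    then obtain T where T: "T \<in> \<T>" "card T = Max (card ` \<T>)" by (metis Max_in imageE)
    then have max: "card T' \<le> card T" if "T' \<in> \<T>" for T' using that \<open>finite \<T>\<close> by simp
    have T': "stab_group T" "T \<subseteq> S" using T by (auto simp: \<T>_def)
    obtain E where E: "E \<in> S" "E \<notin> T" using T by (auto simp: \<T>_def)
    have lE: "label E \<notin> label ` T"
      using E T'(2) inj_onD[OF stab_group_label_inj[OF S], of E] by auto
    have sub: "T \<union> (**) E ` T \<subseteq> S"
      using T'(2) E stab_groupD(3)[OF S] by auto
    have ET: "E ** F = F ** E" if "F \<in> T" for F using stab_group_commute[OF S E(1)] that T'(2) by auto
    have "E \<in> paulis" using E(1) stab_groupD(1)[OF S] by auto
    note ext = stab_group_extension[OF T'(1) this stab_group_square[OF S E(1)] ET lE]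
    have "card T > 0" using stab_groupD(2,5)[OF T'(1)] by (auto simp: card_gt_0_iff)
    then have eq: "T \<union> (**) E ` T = S"
      using max[of "T \<union> (**) E ` T"] ext(1,2) sub by (auto simp: \<T>_def)
    have "card T < card S" using ext(2) \<open>card T > 0\<close> by (simp add: eq)
    then have "card T * vec.dim (fixed_space T) = CARD('q) ^ CARD('n)"
      using less.hyps T' by auto
    then show ?thesis using ext(2,3) by (simp add: eq)
  qed
qed

lemma stab_group_stabiliser_of:
  assumes "x \<in> Q" "x \<noteq> 0"
  shows "stab_group (stabiliser_of (Q :: ('q, 'n :: finite) state set))"
  unfolding stab_group_def
proof (intro conjI allI impI ballI)
  fix c assume "pauli c 0 \<in> stabiliser_of Q"
  then have "pauli c 0 *v x = x" using assms by (auto simp: stabiliser_of_def)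
  moreover have "pauli c 0 = scale_op c (mat 1 :: ('q, 'n) op)" by (simp add: pauli_one)
  ultimately have "c *s x = x" by (simp add: scale_op_vector_mult)
  then show "c = 1" using assms(2) by (auto simp: vec_eq_iff)
qed (auto simp: stabiliser_of_def paulis_mult matrix_vector_mul_assoc[symmetric] mat_1_in_paulis)

text \<open>A nonzero vector of \<open>Q\<close> excludes all scalars but 1 from the stabiliser. The
  second part is the closure property of a Galois connection: the full stabiliser contains the given
  group, so it fixes no more.\<close>

lemma stabiliser_code_stab_group:
  assumes "stabiliser_code (Q :: ('q, 'n :: finite) state set)"
  shows "stab_group (stabiliser_of Q)" "fixed_space (stabiliser_of Q) = Q"
proof -
  obtain S where S: "subgroup S pauli_group" "Q = fixed_space S" and Q: "Q \<noteq> {0}"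
    using assms by (auto simp: stabiliser_code_def fixed_space_def)
  have "0 \<in> Q" using subspace_fixed_space vec.subspace_0 S by metis
  then obtain x where "x \<in> Q" "x \<noteq> 0" using Q by auto
  then show "stab_group (stabiliser_of Q)" by (rule stab_group_stabiliser_of)
  have "S \<subseteq> paulis" using subgroup.subset[OF S(1)] by (simp add: pauli_group_def)
  then have "S \<subseteq> stabiliser_of Q" by (auto simp: stabiliser_of_def S(2) fixed_space_def)
  then have "fixed_space (stabiliser_of Q) \<subseteq> fixed_space S" by (auto simp: fixed_space_def)
  moreover have "Q \<subseteq> fixed_space (stabiliser_of Q)" by (auto simp: stabiliser_of_def fixed_space_def)
  ultimately show "fixed_space (stabiliser_of Q) = Q" using S(2) by auto
qed

lemma stab_group_subgroup:
  assumes S: "stab_group (S :: ('q, 'n :: finite) op set)"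
  shows "subgroup S pauli_group"
proof (rule group.subgroupI[OF group_pauli_group])
  fix E assume E: "E \<in> S"
  have "inv\<^bsub>pauli_group\<^esub> E = E"
    using group.inv_equality[OF group_pauli_group, of E E] stab_group_square[OF S E] E stab_groupD(1)[OF S]
    by (auto simp: pauli_group_def)
  then show "inv\<^bsub>pauli_group\<^esub> E \<in> S" using E by simp
qed (use stab_groupD[OF S] in \<open>auto simp: pauli_group_def\<close>)

text \<open>\<open>S\<close> is contained in the stabiliser of its fixed space, and both have the
  same fixed space; by the dimension formula they have the same order.\<close>

lemma fixed_space_stab_group:
  assumes S: "stab_group (S :: ('q, 'n :: finite) op set)"
  shows "stabiliser_code (fixed_space S)" "stabiliser_of (fixed_space S) = S"
proof -
  have pos: "card S * vec.dim (fixed_space S) > 0"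
    unfolding card_mult_dim_fixed_space[OF S] by simp
  have "fixed_space S \<noteq> {0}"
  proof
    assume "fixed_space S = {0}"
    then show False using pos unfolding \<open>fixed_space S = {0}\<close> vec.dim_singleton by simp
  qed
  then show c: "stabiliser_code (fixed_space S)"
    using stab_group_subgroup[OF S] by (auto simp: stabiliser_code_def fixed_space_def)
  have "S \<subseteq> stabiliser_of (fixed_space S)"
    using stab_groupD(1)[OF S] by (auto simp: stabiliser_of_def fixed_space_def)
  moreover have "card (stabiliser_of (fixed_space S)) = card S"
  proof -
    have "card (stabiliser_of (fixed_space S)) * vec.dim (fixed_space S) = card S * vec.dim (fixed_space S)"
      using card_mult_dim_fixed_space[OF stabiliser_code_stab_group(1)[OF c]]
      unfolding stabiliser_code_stab_group(2)[OF c] card_mult_dim_fixed_space[OF S] .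
    then show ?thesis using pos by (simp del: vec.dim_eq_0)
  qed
  ultimately show "stabiliser_of (fixed_space S) = S"
    using stab_groupD(5)[OF stabiliser_code_stab_group(1)[OF c]] by (intro card_subset_eq[symmetric]) auto
qed

text \<open>A partial lift of largest order is complete: were a label \<open>v\<close> in
  \<open>C\<close> missing, an involution with label \<open>v\<close> would commute with the lift by
  isotropy and could be adjoined.\<close>

lemma ex_stab_group:
  assumes C: "add_closed C" and iso: "\<And>u v. u \<in> C \<Longrightarrow> v \<in> C \<Longrightarrow> sp u v = 0"
  shows "\<exists>S :: ('q, 'n :: finite) op set. stab_group S \<and> label ` S = C"
proof -
  define \<T> where "\<T> = {T :: ('q, 'n) op set. stab_group T \<and> label ` T \<subseteq> C}"
  have "finite \<T>"
    by (rule finite_subset[of _ "Pow paulis"]) (auto simp: \<T>_def finite_paulis dest: stab_groupD(1))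
  moreover have "{mat 1} \<in> \<T>" using C by (auto simp: \<T>_def stab_group_trivial add_closed_def)
  ultimately have "finite (card ` \<T>)" "card ` \<T> \<noteq> {}" by auto
  then obtain T where T: "T \<in> \<T>" "card T = Max (card ` \<T>)" by (metis Max_in imageE)
  then have max: "card T' \<le> card T" if "T' \<in> \<T>" for T' using that \<open>finite \<T>\<close> by simp
  have T': "stab_group T" "label ` T \<subseteq> C" using T by (auto simp: \<T>_def)
  have "label ` T = C"
  proof (rule ccontr)
    assume "label ` T \<noteq> C"
    then obtain v where v: "v \<in> C" "v \<notin> label ` T" using T' by auto
    obtain c where c: "c \<in> phases" "pauli c v ** pauli c v = mat 1" by (rule hermitian_phase)
    have P: "pauli c v \<in> paulis" using c by (simp add: pauli_mem)
    have comm: "pauli c v ** F = F ** pauli c v" if "F \<in> T" for F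
    proof -
      have "sp v (label F) = 0" using that T'(2) v(1) by (intro iso) auto
      then show ?thesis
        using paulis_commute[OF P, of F] that stab_groupD(1)[OF T'(1)] c(1) by auto
    qed
    have l: "label (pauli c v) \<notin> label ` T" using v c by simp
    note ext = stab_group_extension[OF T'(1) P c(2) comm l]
    have "label (pauli c v ** F) \<in> C" if "F \<in> T" for F
    proof -
      have "label (pauli c v ** F) = v + label F"
        using label_mult[OF P, of F] that stab_groupD(1)[OF T'(1)] c(1) by auto
      then show ?thesis using that T'(2) v(1) C by (auto simp: add_closed_def)
    qed
    then have "T \<union> (**) (pauli c v) ` T \<in> \<T>" using ext(1) T' by (auto simp: \<T>_def)
    moreover have "card T > 0" using stab_groupD(2,5)[OF T'(1)] by (auto simp: card_gt_0_iff)
    ultimately show False using max[of "T \<union> (**) (pauli c v) ` T"] ext(2) by simp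
  qed
  then show ?thesis using T' by blast
qed

end

section \<open>Polar spaces from symplectic coordinates\<close>

lemma bit_smult_simps [simp]: "bit_smult 0 x = 0" "bit_smult 1 x = x" "bit_smult b 0 = 0"
  by (auto simp: bit_smult_def)

lemma additive_zero:
  fixes f :: "'a :: ab_group_add \<Rightarrow> 'b :: ab_group_add"
  assumes "\<And>x y. f (x + y) = f x + f y" shows "f 0 = 0"
  using assms[of 0 0] by simp

lemma additive_sum:
  fixes f :: "'a :: ab_group_add \<Rightarrow> 'b :: ab_group_add"
  assumes "\<And>x y. f (x + y) = f x + f y" shows "f (sum g A) = (\<Sum>x\<in>A. f (g x))"
  by (induction A rule: infinite_finite_induct) (auto simp: assms additive_zero[of f, OF assms])

lemma additive_bit_smult:
  fixes f :: "'a :: ab_group_add \<Rightarrow> 'b :: ab_group_add"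
  assumes "\<And>x y. f (x + y) = f x + f y" shows "f (bit_smult b x) = bit_smult b (f x)"
  by (cases b) (auto simp: additive_zero[of f, OF assms])

lemma additive_inj_iff:
  fixes f :: "'a :: ab_group_add \<Rightarrow> 'b :: ab_group_add"
  assumes "\<And>x y. f (x + y) = f x + f y" shows "inj f \<longleftrightarrow> (\<forall>x. f x = 0 \<longrightarrow> x = 0)"
proof -
  have d: "f (x - y) = f x - f y" for x y
    by (metis assms add_diff_cancel_right' diff_add_cancel)
  show ?thesis
    by (metis d additive_zero[of f, OF assms] injD injI eq_iff_diff_eq_0)
qed

lemma bit_smult_eq_scale: "bit_smult b x = b *s (x :: bit ^ 'r :: finite)"
  by (cases b) auto

lemma subspace_bit_iff: "vec.subspace (W :: (bit ^ 'r :: finite) set) \<longleftrightarrow> add_closed W"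
proof -
  have "c *s x \<in> W" if "0 \<in> W" "x \<in> W" for c x using that by (cases c) auto
  then show ?thesis by (auto simp: vec.subspace_def add_closed_def)
qed

lemma card_span_independent:
  assumes "finite B" "vec.independent (B :: (bit ^ 'r :: finite) set)"
  shows "card (vec.span B) = 2 ^ card B"
  using assms
proof (induction B rule: finite_induct)
  case (insert b B)
  then have b: "b \<notin> vec.span B" "vec.independent B" by (auto simp: vec.independent_insert)
  have eq: "vec.span (insert b B) = vec.span B \<union> (+) b ` vec.span B"
  proof (intro equalityI subsetI)
    fix x assume "x \<in> vec.span (insert b B)"
    then obtain k where k: "x - k *s b \<in> vec.span B" by (auto simp: vec.span_insert)
    show "x \<in> vec.span B \<union> (+) b ` vec.span B"
    proof (cases "k = 0")
      case True
      then show ?thesis using k by simp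
    next
      case False
      then have "x - b \<in> vec.span B" using k by simp
      then have "b + (x - b) \<in> (+) b ` vec.span B" by (rule imageI)
      moreover have "b + (x - b) = x" by (simp only: add.commute[of b] diff_add_cancel)
      ultimately show ?thesis by (simp only: UnI2)
    qed
  next
    fix x assume "x \<in> vec.span B \<union> (+) b ` vec.span B"
    moreover have "vec.span B \<subseteq> vec.span (insert b B)" by (rule vec.span_mono) auto
    moreover have "b \<in> vec.span (insert b B)" by (rule vec.span_base) simp
    ultimately show "x \<in> vec.span (insert b B)" by (auto intro: vec.span_add)
  qed
  have "x \<notin> (+) b ` vec.span B" if "x \<in> vec.span B" for x
  proof
    assume "x \<in> (+) b ` vec.span B"
    then obtain y where y: "y \<in> vec.span B" "x = b + y" by auto
    then have "x - y = b" by (simp only: add_diff_cancel_right')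
    then show False using vec.span_diff[OF that y(1)] b(1) by simp
  qed
  then have "card (vec.span (insert b B)) = card (vec.span B) + card ((+) b ` vec.span B)"
    unfolding eq by (intro card_Un_disjoint) auto
  also have "card ((+) b ` vec.span B) = card (vec.span B)" by (intro card_image) auto
  finally show ?case using insert b by simp
qed simp

text \<open>Turns dimensions into cardinalities, the form in which
  \<open>card_mult_card_perp\<close> provides duality.\<close>

lemma card_subspace_bit:
  assumes "vec.subspace (W :: (bit ^ 'r :: finite) set)"
  shows "card W = 2 ^ vec.dim W"
proof -
  obtain B where B: "B \<subseteq> W" "vec.independent B" "W \<subseteq> vec.span B" "card B = vec.dim W"
    using vec.basis_exists[of W] by metis
  have "vec.span B = W" using B assms by (metis subset_antisym vec.span_minimal)
  then show ?thesis using card_span_independent[of B] B by simp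
qed

text \<open>A combination of the rows of \<open>M\<close>. If the rows are labels of generators,
  this is the label of the product of the generators selected by \<open>u\<close>.\<close>

definition comb :: "('r :: finite \<Rightarrow> 'a :: ab_group_add) \<Rightarrow> bit ^ 'r \<Rightarrow> 'a" where
  "comb M u = (\<Sum>\<rho>\<in>UNIV. bit_smult (u $ \<rho>) (M \<rho>))"

lemma bit_smult_add_left: "(x :: 'a :: ab_group_add) + x = 0 \<Longrightarrow> bit_smult (a + b) x = bit_smult a x + bit_smult b x"
  by (cases a; cases b) auto

lemma comb_add:
  assumes "\<And>x :: 'a :: ab_group_add. x + x = 0"
  shows "comb (M :: 'r :: finite \<Rightarrow> 'a) (u + v) = comb M u + comb M v"
  by (simp add: comb_def bit_smult_add_left assms sum.distrib)

lemma additive_comb: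
  fixes f :: "'a :: ab_group_add \<Rightarrow> 'b :: ab_group_add"
  assumes "\<And>x y. f (x + y) = f x + f y" shows "f (comb M u) = comb (\<lambda>\<rho>. f (M \<rho>)) u"
  by (simp add: comb_def additive_sum[of f, OF assms] additive_bit_smult[of f, OF assms])

lemma comb_axis: "comb M (axis \<rho> 1) = M \<rho>"
proof -
  have "comb M (axis \<rho> 1) = (\<Sum>\<sigma>\<in>UNIV. if \<sigma> = \<rho> then M \<rho> else 0)"
    unfolding comb_def by (rule sum.cong) (auto simp: axis_def)
  then show ?thesis by simp
qed

lemma comb_fun_upd:
  assumes "u $ \<rho> = 0" shows "comb (M(\<rho> := v)) u = comb M u"
  unfolding comb_def by (rule sum.cong) (use assms in auto)

text \<open>A basis of \<open>C\<close> indexed by a prescribed type, built one index at a time: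
  \<open>R\<close> holds the indices treated so far, and independence is demanded of coefficient
  vectors supported on \<open>R\<close>.\<close>

lemma ex_comb_bij:
  fixes C :: "'a :: {ab_group_add, finite} set"
  assumes two: "\<And>x :: 'a. x + x = 0" and C: "add_closed C" and card: "card C = 2 ^ CARD('r :: finite)"
  shows "\<exists>M :: 'r \<Rightarrow> 'a. bij_betw (comb M) UNIV C"
proof -
  have combC: "comb M u \<in> C" if "\<And>\<rho>. M \<rho> \<in> C" for M :: "'r \<Rightarrow> 'a" and u
    unfolding comb_def using that C by (intro add_closed_sum) (auto simp: bit_smult_def add_closed_def)
  have "\<exists>M. (\<forall>\<rho>. M \<rho> \<in> C) \<and> (\<forall>u. (\<forall>\<rho>. \<rho> \<notin> R \<longrightarrow> u $ \<rho> = 0) \<and> comb M u = 0 \<longrightarrow> u = 0)" for R :: "'r set"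
    using finite[of R]
  proof (induction R rule: finite_induct)
    case empty
    show ?case using C by (intro exI[of _ "\<lambda>_. 0"]) (auto simp: add_closed_def vec_eq_iff)
  next
    case (insert \<rho> R)
    then obtain M where M: "\<And>\<rho>. M \<rho> \<in> C" "\<And>u. (\<forall>\<rho>. \<rho> \<notin> R \<longrightarrow> u $ \<rho> = 0) \<Longrightarrow> comb M u = 0 \<Longrightarrow> u = 0"
      by blast
    \<comment> \<open>Vectors supported on \<open>R\<close> number fewer than \<open>card C\<close>,
      because \<open>axis \<rho> 1\<close> is not one of them; so their combinations miss some
      element of \<open>C\<close>, and this element becomes row \<open>\<rho>\<close>.\<close>
    define U where "U = {u :: bit ^ 'r. \<forall>\<rho>. \<rho> \<notin> R \<longrightarrow> u $ \<rho> = 0}"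
    have "axis \<rho> 1 \<notin> U" using insert by (auto simp: U_def)
    then have "card U < CARD(bit ^ 'r)" by (intro psubset_card_mono) auto
    then have "card (comb M ` U) < card C"
      using card_image_le[of U "comb M"] by (simp add: card)
    moreover have "comb M ` U \<subseteq> C" using combC M(1) by auto
    ultimately obtain v where v: "v \<in> C" "v \<notin> comb M ` U" by (metis less_irrefl subset_antisym subsetI)
    show ?case
    proof (intro exI[of _ "M(\<rho> := v)"] conjI allI impI)
      show "(M(\<rho> := v)) \<sigma> \<in> C" for \<sigma> using M v by auto
      fix u assume u: "(\<forall>\<sigma>. \<sigma> \<notin> insert \<rho> R \<longrightarrow> u $ \<sigma> = 0) \<and> comb (M(\<rho> := v)) u = 0"
      show "u = 0"
      proof (cases "u $ \<rho> = 0")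
        case True
        then have "\<forall>\<sigma>. \<sigma> \<notin> R \<longrightarrow> u $ \<sigma> = 0" using u by (metis insertE)
        then show ?thesis using u M(2)[of u] True by (simp add: comb_fun_upd)
      next
        case False
        define u' where "u' = u + axis \<rho> 1"
        have 0: "u' $ \<rho> = 0" using False by (simp add: u'_def)
        have "u' \<in> U" using u 0 by (auto simp: U_def u'_def axis_def)
        have "u = u' + axis \<rho> 1" by (simp add: u'_def vec_eq_iff add.assoc)
        then have "comb (M(\<rho> := v)) u = comb M u' + v"
          by (simp add: comb_add two comb_axis comb_fun_upd 0)
        then have "comb M u' = v" using u two by (metis add_right_cancel)
        then show ?thesis using v(2) \<open>u' \<in> U\<close> by auto
      qed
    qed
  qed
  from this[of UNIV] obtain M where M: "\<And>\<rho>. M \<rho> \<in> C" "\<And>u. comb M u = 0 \<Longrightarrow> u = (0 :: bit ^ 'r)"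
    by auto
  have inj: "inj (comb M)"
    using additive_inj_iff[of "comb M"] M(2) by (auto simp: comb_add two)
  moreover have "range (comb M) = C"
    using combC M(1) inj by (intro card_subset_eq) (auto simp: card_image card)
  ultimately show ?thesis by (auto simp: bij_betw_def)
qed

definition site_map :: "('r :: finite \<Rightarrow> ('q :: {field, finite} \<times> 'q) ^ 'n :: finite) \<Rightarrow> 'n \<Rightarrow> 'q \<times> 'q \<Rightarrow> bit ^ 'r" where
  "site_map M i w = (\<chi> \<rho>. sp1 w (M \<rho> $ i))"

text \<open>The polarity of \<open>sp1\<close> transported along \<open>\<phi>\<close>.
  Orthogonality is tested on the preimage of \<open>W\<close>, so no inverse of
  \<open>\<phi>\<close> occurs in the definition.\<close>

definition site_polar :: "('q :: {field, finite} \<times> 'q \<Rightarrow> bit ^ 'r :: finite) \<Rightarrow> (bit ^ 'r) set \<times> 'r polarity" where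
  "site_polar \<phi> = (range \<phi>, restrict (\<lambda>W. \<phi> ` {w. \<forall>w'. \<phi> w' \<in> W \<longrightarrow> sp1 w w' = 0}) {W. vec.subspace W \<and> W \<subseteq> range \<phi>})"

context trace_basis
begin

lemma comb_add_label: "comb (M :: 'r :: finite \<Rightarrow> ('q \<times> 'q) ^ 'n :: finite) (u + v) = comb M u + comb M v"
  by (rule comb_add) (rule sp.add_self)

lemma comb_0 [simp]: "comb (M :: 'r :: finite \<Rightarrow> 'a :: ab_group_add) 0 = 0"
  by (simp add: comb_def)

lemma site_map_add: "site_map M i (w + w') = site_map M i w + site_map M i (w' :: 'q \<times> 'q)"
  by (simp add: site_map_def vec_eq_iff sp1.add_left)

lemma site_map_0 [simp]: "site_map M i (0 :: 'q \<times> 'q) = 0"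
  by (simp add: site_map_def vec_eq_iff)

lemma bdot_site_map: "bdot u (site_map M i w) = sp1 w (comb M u $ i :: 'q \<times> 'q)"
proof -
  have "comb M u $ i = comb (\<lambda>\<rho>. M \<rho> $ i) u" by (rule additive_comb) simp
  moreover have "sp1 w (comb (\<lambda>\<rho>. M \<rho> $ i) u) = comb (\<lambda>\<rho>. sp1 w (M \<rho> $ i)) u"
    by (rule additive_comb) (simp add: sp1.add_right)
  moreover have "bit_smult b c = b * c" for b c :: bit by (cases b) auto
  ultimately show ?thesis by (simp add: bdot_def site_map_def comb_def)
qed

text \<open>Each coordinate of \<open>\<phi> i\<close> is an additive functional, hence the product
  with a fixed element; these elements are the entries of \<open>M\<close>. So symplectic
  coordinates on the spaces of a quantum set always come from a matrix of labels.\<close>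

lemma additive_eq_site_map:
  fixes \<phi> :: "'n :: finite \<Rightarrow> 'q \<times> 'q \<Rightarrow> bit ^ 'r :: finite"
  assumes "\<And>i x y. \<phi> i (x + y) = \<phi> i x + \<phi> i y"
  shows "\<exists>M. \<phi> = site_map M"
proof -
  have "\<exists>m. \<forall>x. \<phi> i x $ \<rho> = sp1 x m" for i \<rho>
    using sp1.additive_functional_ex1[of "\<lambda>x. \<phi> i x $ \<rho>"] assms by auto
  then obtain m where m: "\<And>i \<rho> x. \<phi> i x $ \<rho> = sp1 x (m i \<rho>)" by metis
  have "\<phi> = site_map (\<lambda>\<rho>. \<chi> i. m i \<rho>)"
    by (auto simp: fun_eq_iff site_map_def vec_eq_iff m)
  then show ?thesis by blast
qed

lemma sum_pair_eq: "(\<Sum>l\<in>A. (f l, g l)) = (sum f A, sum g A)"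
  by (induction A rule: infinite_finite_induct) (auto simp: zero_prod_def)

lemma site_expand:
  "w = (\<Sum>l<h. bit_smult (coord h e l (fst w)) (e l, 0)) + (\<Sum>l<h. bit_smult (coord h e l (snd w)) (0, e l))"
proof -
  have "bit_smult b (x, 0 :: 'q) = (bit_smult b x, 0)" "bit_smult b (0 :: 'q, x) = (0, bit_smult b x)" for b and x :: 'q
    by (cases b; simp add: zero_prod_def)+
  then show ?thesis
    using coord_expand[of "fst w"] coord_expand[of "snd w"] by (simp add: sum_pair_eq)
qed

lemma additive_ext:
  fixes f g :: "'q \<times> 'q \<Rightarrow> 'a :: ab_group_add"
  assumes f: "\<And>x y. f (x + y) = f x + f y" and g: "\<And>x y. g (x + y) = g x + g y"
    and eq: "\<And>l. l < h \<Longrightarrow> f (e l, 0) = g (e l, 0)" "\<And>l. l < h \<Longrightarrow> f (0, e l) = g (0, e l)"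
  shows "f = g"
proof
  fix w
  show "f w = g w"
    apply (subst (1 2) site_expand[of w])
    by (simp add: f g additive_sum[of f, OF f] additive_sum[of g, OF g] additive_bit_smult[of f, OF f] additive_bit_smult[of g, OF g] eq)
qed

lemma coord_0 [simp]: "coord h e l (0 :: 'q) = 0"
  by (cases "l < h") (auto simp: coord_eq_tr coord_comb(1) not_less)

lemma coord_basis: "m < h \<Longrightarrow> coord h e l (e m) = (if l = m then 1 else 0)"
  by (cases "l < h") (auto simp: coord_eq_tr coord_comb(1) not_less tr_basis)

lemma sp1_basis:
  assumes "l < h"
  shows "sp1 w (0, e l) = coord h e l (fst w)" "sp1 w (e l, 0) = coord h e l (snd w)"
  using assms by (simp_all add: sp1_def coord_eq_tr)

lemma sp1_basis_pairs:
  assumes "l < h" "m < h"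
  shows "sp1 (e m, 0) (0, e l) = (if l = m then 1 else 0)" "sp1 (e m, 0) (e l, 0) = 0"
    "sp1 (0, e m) (0, e l) = 0" "sp1 (0, e m) (e l, 0) = (if l = m then 1 else 0)"
  using assms by (auto simp: sp1_basis coord_basis)

end

section \<open>The correspondence\<close>

definition polar_system :: "('r :: finite \<Rightarrow> ('q :: {field, finite} \<times> 'q) ^ 'n :: finite) \<Rightarrow> ('n, 'r) polar_family" where
  "polar_system M = (\<lambda>i. site_polar (site_map M i))"

definition matrix_labels :: "'q ^ ('n :: finite + 'n) ^ 'r :: finite \<Rightarrow> 'r \<Rightarrow> ('q \<times> 'q) ^ 'n" where
  "matrix_labels M = (\<lambda>\<rho>. \<chi> j. (M $ \<rho> $ Inl j, M $ \<rho> $ Inr j))"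

lemma fst_site_polar [simp]: "fst (site_polar \<phi>) = range \<phi>"
  by (simp add: site_polar_def)

lemma snd_site_polar:
  "vec.subspace W \<Longrightarrow> W \<subseteq> range \<phi> \<Longrightarrow> snd (site_polar \<phi>) W = \<phi> ` {w. \<forall>w'. \<phi> w' \<in> W \<longrightarrow> sp1 w w' = 0}"
  by (simp add: site_polar_def)

context trace_basis
begin

lemma subspace_additive_image:
  fixes \<phi> :: "'q \<times> 'q \<Rightarrow> bit ^ 'r :: finite"
  assumes "\<And>x y. \<phi> (x + y) = \<phi> x + \<phi> y" "add_closed W"
  shows "vec.subspace (\<phi> ` W)"
  using assms by (simp add: subspace_bit_iff add_closed_image)

lemma snd_site_polar_image:
  fixes \<phi> :: "'q \<times> 'q \<Rightarrow> bit ^ 'r :: finite"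
  assumes add: "\<And>x y. \<phi> (x + y) = \<phi> x + \<phi> y" and inj: "inj \<phi>" and W: "add_closed W"
  shows "snd (site_polar \<phi>) (\<phi> ` W) = \<phi> ` perp sp1 W"
proof -
  have "{w. \<forall>w'. \<phi> w' \<in> \<phi> ` W \<longrightarrow> sp1 w w' = 0} = perp sp1 W"
    using inj by (auto simp: perp_def inj_image_mem_iff sp1.sym)
  moreover have "snd (site_polar \<phi>) (\<phi> ` W) = \<phi> ` {w. \<forall>w'. \<phi> w' \<in> \<phi> ` W \<longrightarrow> sp1 w w' = 0}"
    by (intro snd_site_polar subspace_additive_image add W) auto
  ultimately show ?thesis by simp
qed

lemma dim_range_additive:
  fixes \<phi> :: "'q \<times> 'q \<Rightarrow> bit ^ 'r :: finite"
  assumes add: "\<And>x y. \<phi> (x + y) = \<phi> x + \<phi> y" and inj: "inj \<phi>"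
  shows "vec.dim (range \<phi>) = 2 * h"
proof -
  have "vec.subspace (range \<phi>)"
    by (intro subspace_additive_image add) (auto simp: add_closed_def)
  from card_subspace_bit[OF this] have "CARD('q \<times> 'q) = 2 ^ vec.dim (range \<phi>)"
    using card_image[OF inj] by simp
  then show ?thesis unfolding card_site by simp
qed

lemma snd_site_polar_form:
  fixes \<phi> :: "'q \<times> 'q \<Rightarrow> bit ^ 'r :: finite"
  assumes f: "\<And>x y. f (\<phi> x) (\<phi> y) = sp1 x y"
  shows "snd (site_polar \<phi>) =
    restrict (\<lambda>W. {v \<in> range \<phi>. \<forall>w\<in>W. f v w = 0}) {W. vec.subspace W \<and> W \<subseteq> range \<phi>}"
proof -
  have "{v \<in> range \<phi>. \<forall>w\<in>W. f v w = 0} = \<phi> ` {w. \<forall>w'. \<phi> w' \<in> W \<longrightarrow> sp1 w w' = 0}"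
    if "W \<subseteq> range \<phi>" for W
  proof -
    have "(\<forall>w\<in>W. f (\<phi> x) w = 0) \<longleftrightarrow> (\<forall>w'. \<phi> w' \<in> W \<longrightarrow> sp1 x w' = 0)" for x
      using that f by (metis imageE subsetD)
    then show ?thesis by auto
  qed
  then show ?thesis unfolding site_polar_def by (auto simp: fun_eq_iff restrict_def)
qed

lemma symplectic_site_polar:
  fixes \<phi> :: "'q \<times> 'q \<Rightarrow> bit ^ 'r :: finite"
  assumes add: "\<And>x y. \<phi> (x + y) = \<phi> x + \<phi> y" and inj: "inj \<phi>"
  shows "symplectic_polarity (range \<phi>) (snd (site_polar \<phi>))"
proof -
  define f where "f x y = sp1 (inv_into UNIV \<phi> x) (inv_into UNIV \<phi> y)" for x y
  have f: "f (\<phi> x) (\<phi> y) = sp1 x y" for x y by (simp add: f_def inj)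
  have 0: "\<phi> 0 = 0" by (rule additive_zero[OF add])
  have f': "f (\<phi> x + \<phi> y) (\<phi> z) = f (\<phi> x) (\<phi> z) + f (\<phi> y) (\<phi> z)"
           "f (\<phi> z) (\<phi> x + \<phi> y) = f (\<phi> z) (\<phi> x) + f (\<phi> z) (\<phi> y)" for x y z
    by (simp_all only: add[symmetric] f sp1.add_left sp1.add_right)
  have f0: "f 0 (\<phi> x) = 0" "f (\<phi> x) 0 = 0" for x
    by (simp_all only: 0[symmetric] f sp1.zero_left sp1.zero_right)
  have "nondegenerate_symplectic_form (range \<phi>) f"
    unfolding nondegenerate_symplectic_form_def
  proof (intro conjI ballI allI impI)
    fix c and u w assume "u \<in> range \<phi>" "w \<in> range \<phi>"
    then show "f (c *s u) w = c * f u w" "f w (c *s u) = c * f w u"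
      by (cases c; auto simp: f0)+
  next
    fix v assume v: "v \<in> range \<phi>" and *: "\<forall>w\<in>range \<phi>. f v w = 0"
    obtain x where x: "v = \<phi> x" using v by auto
    have "x = 0" by (rule sp1.nondeg) (use * in \<open>auto simp: x f\<close>)
    then show "v = 0" by (simp add: x 0)
  qed (auto simp: f f')
  then show ?thesis
    unfolding symplectic_polarity_def using snd_site_polar_form[of f \<phi>, OF f] by blast
qed

text \<open>The sum of the hyperbolic planes spanned by \<open>(e l, 0)\<close> and
  \<open>(0, e l)\<close> for the \<open>l < h\<close> in \<open>L\<close>.\<close>

definition coord_support :: "nat set \<Rightarrow> ('q \<times> 'q) set" where
  "coord_support L = {w. \<forall>l. l \<notin> L \<longrightarrow> coord h e l (fst w) = 0 \<and> coord h e l (snd w) = 0}"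

lemma coord_add: "coord h e l (x + y :: 'q) = coord h e l x + coord h e l y"
  by (cases "l < h") (auto simp: coord_eq_tr coord_comb(1) not_less distrib_right tr_add)

lemma add_closed_coord_support: "add_closed (coord_support L)"
  by (auto simp: add_closed_def coord_support_def coord_add)

lemma coord_support_basis: "l \<in> L \<Longrightarrow> l < h \<Longrightarrow> (0, e l) \<in> coord_support L" "l \<in> L \<Longrightarrow> l < h \<Longrightarrow> (e l, 0) \<in> coord_support L"
  by (auto simp: coord_support_def coord_basis)

lemma coord_support_full: "coord_support {..<h} = UNIV"
  by (auto simp: coord_support_def coord_comb(1))

lemma perp_coord_support_single:
  assumes "l < h" shows "perp sp1 (coord_support {l}) = coord_support ({..<h} - {l})"
proof (intro equalityI subsetI)
  fix w assume w: "w \<in> perp sp1 (coord_support {l})"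
  have "sp1 w (0, e l) = 0" "sp1 w (e l, 0) = 0"
    using w assms coord_support_basis[of l "{l}"] by (auto simp: perp_def sp1.sym[of w])
  then show "w \<in> coord_support ({..<h} - {l})"
    using assms by (auto simp: coord_support_def sp1_basis coord_comb(1))
next
  fix w assume w: "w \<in> coord_support ({..<h} - {l})"
  show "w \<in> perp sp1 (coord_support {l})"
    unfolding perp_def sp1_coord
    using w by (auto simp: coord_support_def intro!: sum.neutral) (metis mult_zero_left mult_zero_right add_0_left)
qed

text \<open>The product with \<open>(0, e l)\<close> under \<open>sp1\<close> reads a coordinate of
  the X-part, so columns of either kind are images of basis vectors of the opposite kind.\<close>

lemma expanded_column_eq:
  assumes "l < h"
  shows "expanded_column h e M (Inl i) l = site_map (matrix_labels M) i (0, e l)"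
    "expanded_column h e M (Inr i) l = site_map (matrix_labels M) i (e l, 0)"
  using assms
  by (simp_all add: vec_eq_iff expanded_column_def site_map_def matrix_labels_def sp1_def coord_eq_tr mult.commute)

lemma span_matrix_lines:
  fixes M :: "'q ^ ('n :: finite + 'n) ^ 'r :: finite"
  assumes L: "L \<subseteq> {..<h}"
  shows "vec.span (\<Union>l\<in>L. matrix_line h e M i l) = site_map (matrix_labels M) i ` coord_support L"
    (is "?A = ?\<phi> ` _")
proof (rule subset_antisym)
  have sub: "vec.subspace (?\<phi> ` coord_support L)"
    by (intro subspace_additive_image add_closed_coord_support) (simp add: site_map_add)
  have "matrix_line h e M i l \<subseteq> ?\<phi> ` coord_support L" if "l \<in> L" for l
    unfolding matrix_line_def using that L
    by (intro vec.span_minimal sub) (auto simp: expanded_column_eq coord_support_basis)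
  then show "?A \<subseteq> ?\<phi> ` coord_support L"
    by (intro vec.span_minimal sub) auto
  show "?\<phi> ` coord_support L \<subseteq> ?A"
  proof (rule image_subsetI)
    fix w assume w: "w \<in> coord_support L"
    have A: "add_closed ?A" using vec.subspace_span[of "\<Union>l\<in>L. matrix_line h e M i l"] by (simp only: subspace_bit_iff)
    have in_A: "?\<phi> (0, e l) \<in> ?A" "?\<phi> (e l, 0) \<in> ?A" if "l \<in> L" for l
    proof -
      have "?\<phi> (0, e l) \<in> matrix_line h e M i l" "?\<phi> (e l, 0) \<in> matrix_line h e M i l"
        using that L by (auto simp: matrix_line_def expanded_column_eq intro!: vec.span_base)
      then show "?\<phi> (0, e l) \<in> ?A" "?\<phi> (e l, 0) \<in> ?A" using that by (auto intro!: vec.span_base)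
    qed
    have "?\<phi> w = (\<Sum>l<h. bit_smult (coord h e l (fst w)) (?\<phi> (e l, 0))) + (\<Sum>l<h. bit_smult (coord h e l (snd w)) (?\<phi> (0, e l)))"
      by (subst site_expand[of w])
         (simp only: site_map_add additive_sum[of ?\<phi>, OF site_map_add] additive_bit_smult[of ?\<phi>, OF site_map_add])
    moreover have "bit_smult (coord h e l (fst w)) (?\<phi> (e l, 0)) \<in> ?A" "bit_smult (coord h e l (snd w)) (?\<phi> (0, e l)) \<in> ?A" for l
      using w in_A[of l] A by (cases "l \<in> L"; auto simp: coord_support_def add_closed_def bit_smult_def)+
    ultimately show "?\<phi> w \<in> ?A"
      by (auto intro!: vec.span_add vec.span_sum)
  qed
qed

lemma matrix_line_eq:
  assumes "l < h"
  shows "matrix_line h e (M :: 'q ^ ('n :: finite + 'n) ^ 'r :: finite) i l = site_map (matrix_labels M) i ` coord_support {l}"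
  using span_matrix_lines[of "{l}" M i] assms by (simp add: matrix_line_def vec.span_span)

text \<open>Pull the unknown form back along \<open>\<phi>\<close> to \<open>g\<close>. The
  prescribed perpendicular spaces make distinct coordinate planes orthogonal, and on a plane an
  alternating form over F_2 is either zero or the standard one. So \<open>g\<close> agrees with
  \<open>sp1\<close> on a basis.\<close>

lemma polarity_unique:
  fixes \<phi> :: "'q \<times> 'q \<Rightarrow> bit ^ 'r :: finite"
  assumes add: "\<And>x y. \<phi> (x + y) = \<phi> x + \<phi> y" and inj: "inj \<phi>"
    and p: "symplectic_polarity (range \<phi>) p"
    and lines: "\<And>l. l < h \<Longrightarrow> p (\<phi> ` coord_support {l}) = \<phi> ` coord_support ({..<h} - {l})"
  shows "p = snd (site_polar \<phi>)"
proof -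
  obtain f where f: "nondegenerate_symplectic_form (range \<phi>) f"
    and pf: "p = restrict (\<lambda>W. {v \<in> range \<phi>. \<forall>w\<in>W. f v w = 0}) {W. vec.subspace W \<and> W \<subseteq> range \<phi>}"
    using p by (auto simp: symplectic_polarity_def)
  define g where "g x y = f (\<phi> x) (\<phi> y)" for x y
  have f_add: "\<forall>u\<in>range \<phi>. \<forall>v\<in>range \<phi>. \<forall>w\<in>range \<phi>. f (u + v) w = f u w + f v w \<and> f w (u + v) = f w u + f w v"
    and f_alt: "\<forall>v\<in>range \<phi>. f v v = 0"
    using f unfolding nondegenerate_symplectic_form_def by blast+
  have gl: "g (x + y) z = g x z + g y z" and gr: "g z (x + y) = g z x + g z y" and gs: "g x x = 0" for x y z
    unfolding g_def add using f_add f_alt by blast+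
  have gsym: "g x y = g y x" for x y
  proof -
    have "g x y + g y x = g (x + y) (x + y)" unfolding gl gr by (simp add: gs)
    then have "g x y + g y x = 0" unfolding gs .
    then show ?thesis by (simp only: bit_add_eq_0_iff)
  qed
  have key: "(\<forall>y\<in>coord_support {l}. g x y = 0) \<longleftrightarrow> x \<in> coord_support ({..<h} - {l})" if "l < h" for l x
  proof -
    have "p (\<phi> ` coord_support {l}) = {v \<in> range \<phi>. \<forall>w\<in>\<phi> ` coord_support {l}. f v w = 0}"
      unfolding pf by (simp add: subspace_additive_image add add_closed_coord_support image_mono)
    then have "\<phi> x \<in> \<phi> ` coord_support ({..<h} - {l}) \<longleftrightarrow> (\<forall>w\<in>\<phi> ` coord_support {l}. f (\<phi> x) w = 0)"
      using lines[OF that] by auto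
    then show ?thesis using inj by (auto simp: g_def inj_image_mem_iff)
  qed
  have cross: "g x y = 0" if "l < h" "x \<in> coord_support ({..<h} - {l})" "y \<in> coord_support {l}" for x y l
    using key[OF that(1), of x] that(2,3) by blast
  \<comment> \<open>If the form vanished on the plane, \<open>(e l, 0)\<close> would be
    perpendicular to the plane that contains it; but the perpendicular space is the sum of the other
    planes, where it does not lie.\<close>
  have pair: "g (e l, 0) (0, e l) = 1" if l: "l < h" for l
  proof (rule ccontr)
    assume "g (e l, 0) (0, e l) \<noteq> 1"
    then have 0: "g (e l, 0) (0, e l) = 0" by simp
    have "g (e l, 0) y = 0" if y: "y \<in> coord_support {l}" for y
    proof -
      define a b where "a = coord h e l (fst y)" and "b = coord h e l (snd y)"
      have "(\<Sum>m<h. bit_smult (coord h e m (fst y)) (e m, 0)) = (\<Sum>m<h. if m = l then bit_smult a (e l, 0 :: 'q) else 0)"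
        using y by (intro sum.cong) (auto simp: coord_support_def a_def)
      moreover have "(\<Sum>m<h. bit_smult (coord h e m (snd y)) (0, e m)) = (\<Sum>m<h. if m = l then bit_smult b (0 :: 'q, e l) else 0)"
        using y by (intro sum.cong) (auto simp: coord_support_def b_def)
      ultimately have "y = bit_smult a (e l, 0) + bit_smult b (0, e l)"
        using site_expand[of y] l by simp
      moreover have "g (e l, 0) (bit_smult a (e l, 0)) = 0" "g (e l, 0) (bit_smult b (0, e l)) = 0"
        using additive_bit_smult[of "g (e l, 0)", OF gr] gs 0 by simp_all
      ultimately show ?thesis by (simp add: gr)
    qed
    then have "(e l, 0) \<in> coord_support ({..<h} - {l})" using key[OF l] by blast
    then show False using l by (auto simp: coord_support_def coord_basis)
  qed
  have off: "g (e m, 0) (0, e l) = 0" "g (e m, 0) (e l, 0) = 0" "g (0, e m) (0, e l) = 0" "g (0, e m) (e l, 0) = 0"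
    if "l < h" "m < h" "l \<noteq> m" for l m
    using that by (auto intro!: cross[of l] coord_support_basis)
  have g_vals: "g (e m, 0) (0, e l) = (if l = m then 1 else 0)" "g (e m, 0) (e l, 0) = 0"
    "g (0, e m) (0, e l) = 0" "g (0, e m) (e l, 0) = (if l = m then 1 else 0)" if "l < h" "m < h" for l m
    using that off[of l m] pair[of l] gs gsym[of "(0, e l)" "(e l, 0)"] by (cases "l = m"; simp)+
  have gA: "(\<lambda>x. g x (0, e l)) = (\<lambda>x. sp1 x (0, e l))" if "l < h" for l
    by (rule additive_ext) (use that in \<open>simp_all add: gl sp1.add_left sp1_basis_pairs g_vals\<close>)
  have gB: "(\<lambda>x. g x (e l, 0)) = (\<lambda>x. sp1 x (e l, 0))" if "l < h" for l
    by (rule additive_ext) (use that in \<open>simp_all add: gl sp1.add_left sp1_basis_pairs g_vals\<close>)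
  have "g x = sp1 x" for x
    by (intro additive_ext gr sp1.add_right fun_cong[OF gA] fun_cong[OF gB])
  then have gsp: "f (\<phi> x) (\<phi> y) = sp1 x y" for x y unfolding g_def by metis
  show ?thesis unfolding pf by (rule snd_site_polar_form[symmetric]) (rule gsp)
qed

text \<open>The labels of a generated group are the combinations of the labels of its generators. As
  the stabiliser has order \<open>2 ^ CARD('r)\<close>, a family of \<open>CARD('r)\<close> elements
  generates it exactly when their labels form a basis.\<close>

lemma stabiliser_matrix_iff:
  fixes Q :: "('q, 'n :: finite) state set" and M :: "'q ^ ('n + 'n) ^ 'r :: finite"
  assumes S: "stab_group (stabiliser_of Q)" and card: "card (stabiliser_of Q) = 2 ^ CARD('r)"
    and r: "real CARD('r) = real h * (real CARD('n) - code_k Q)"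
  shows "stabiliser_matrix h Q M \<longleftrightarrow> bij_betw (comb (matrix_labels M)) UNIV (label ` stabiliser_of Q)"
proof
  let ?S = "stabiliser_of Q"
  have cardC: "card (label ` ?S) = 2 ^ CARD('r)"
    using card_image[OF stab_group_label_inj[OF S]] card by simp
  assume "stabiliser_matrix h Q M"
  then obtain E :: "'r \<Rightarrow> ('q, 'n) op" where E: "range E \<subseteq> paulis" "generate pauli_group (range E) = ?S"
    and M: "M = (\<chi> \<rho>. tau (E \<rho>))"
    by (auto simp: stabiliser_matrix_def)
  have lab: "matrix_labels M = (\<lambda>\<rho>. label (E \<rho>))" by (simp add: M matrix_labels_def label_def)
  have ES: "E \<rho> \<in> ?S" for \<rho> unfolding E(2)[symmetric] by (rule generate.incl) simp
  have "range (comb (matrix_labels M)) = label ` ?S"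
  proof (intro subset_antisym)
    show "range (comb (matrix_labels M)) \<subseteq> label ` ?S"
      unfolding comb_def lab using ES add_closed_label[OF S]
      by (auto simp: bit_smult_def add_closed_def intro!: add_closed_sum[OF add_closed_label[OF S]])
    have gen: "label (E \<rho>) \<in> range (comb (matrix_labels M))" for \<rho>
      using comb_axis[of "matrix_labels M" \<rho>] by (metis lab rangeI)
    have "label F \<in> range (comb (matrix_labels M))" if "F \<in> generate pauli_group (range E)" for F
      using that
    proof (induction F rule: generate.induct)
      case one
      then show ?case by (auto simp: pauli_group_def image_iff intro!: exI[of _ 0])
    next
      case (incl F)
      then show ?case using gen by auto
    next
      case (inv F)
      then have FS: "F \<in> ?S" using ES by auto
      have "inv\<^bsub>pauli_group\<^esub> F = F"
        using group.inv_equality[OF group_pauli_group, of F F] stab_group_square[OF S FS] FS stab_groupD(1)[OF S]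
        by (auto simp: pauli_group_def)
      then show ?case using inv gen by auto
    next
      case (eng F G)
      have "F \<in> paulis" "G \<in> paulis" using eng E(2) stab_groupD(1)[OF S] by auto
      then have "label (F \<otimes>\<^bsub>pauli_group\<^esub> G) = label F + label G" by (simp add: pauli_group_def label_mult)
      moreover obtain u v where "label F = comb (matrix_labels M) u" "label G = comb (matrix_labels M) v" using eng by auto
      ultimately show ?case by (metis comb_add_label rangeI)
    qed
    then show "label ` ?S \<subseteq> range (comb (matrix_labels M))" unfolding E(2) by auto
  qed
  moreover have "inj (comb (matrix_labels M))"
    by (rule eq_card_imp_inj_on) (simp_all add: calculation cardC)
  ultimately show "bij_betw (comb (matrix_labels M)) UNIV (label ` ?S)" by (simp add: bij_betw_def)
next
  let ?S = "stabiliser_of Q"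
  assume bij: "bij_betw (comb (matrix_labels M)) UNIV (label ` ?S)"
  \<comment> \<open>Labels determine stabiliser elements, so each row has exactly one lift to the
    stabiliser, phase included.\<close>
  define E where "E \<rho> = inv_into ?S label (matrix_labels M \<rho>)" for \<rho>
  have mem: "matrix_labels M \<rho> \<in> label ` ?S" for \<rho>
    using bij comb_axis[of "matrix_labels M" \<rho>] unfolding bij_betw_def by (metis rangeI)
  have ES: "E \<rho> \<in> ?S" and lE: "label (E \<rho>) = matrix_labels M \<rho>" for \<rho>
    unfolding E_def using mem[of \<rho>] by (auto simp: inv_into_into f_inv_into_f)
  have sub: "generate pauli_group (range E) \<subseteq> ?S"
    using ES by (intro group.generate_subgroup_incl[OF group_pauli_group]) (auto simp: stab_group_subgroup[OF S])
  have closed: "add_closed (label ` generate pauli_group (range E))"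
    unfolding add_closed_def
  proof (intro conjI ballI)
    have "mat 1 \<in> generate pauli_group (range E)" using generate.one[of pauli_group "range E"] by (simp add: pauli_group_def)
    then show "0 \<in> label ` generate pauli_group (range E)" by (metis image_eqI label_one)
    fix x y assume "x \<in> label ` generate pauli_group (range E)" "y \<in> label ` generate pauli_group (range E)"
    then obtain F G where FG: "F \<in> generate pauli_group (range E)" "G \<in> generate pauli_group (range E)" "x = label F" "y = label G"
      by auto
    have "F ** G \<in> generate pauli_group (range E)" using generate.eng[OF FG(1,2)] by (simp add: pauli_group_def)
    moreover have "label (F ** G) = x + y"
      using FG sub stab_groupD(1)[OF S] by (subst label_mult) auto
    ultimately show "x + y \<in> label ` generate pauli_group (range E)" by (metis image_eqI)
  qed
  have "?S \<subseteq> generate pauli_group (range E)"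
  proof
    fix F assume F: "F \<in> ?S"
    then obtain u where u: "label F = comb (matrix_labels M) u" using bij by (auto simp: bij_betw_def)
    have "matrix_labels M \<rho> \<in> label ` generate pauli_group (range E)" for \<rho>
      unfolding lE[symmetric] by (intro imageI generate.incl) simp
    then have "comb (matrix_labels M) u \<in> label ` generate pauli_group (range E)"
      unfolding comb_def using closed by (intro add_closed_sum) (auto simp: bit_smult_def add_closed_def)
    then obtain G where G: "G \<in> generate pauli_group (range E)" "label G = label F" using u by auto
    then have "G = F" using inj_onD[OF stab_group_label_inj[OF S] G(2)] sub F by auto
    then show "F \<in> generate pauli_group (range E)" using G by simp
  qed
  moreover have "M = (\<chi> \<rho>. tau (E \<rho>))"
  proof -
    have "M $ \<rho> $ s = tau (E \<rho>) $ s" for \<rho> s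
      using arg_cong[OF lE[of \<rho>], of "\<lambda>v. v $ (case s of Inl j \<Rightarrow> j | Inr j \<Rightarrow> j)"]
      by (cases s) (auto simp: label_def matrix_labels_def)
    then show ?thesis by (simp add: vec_eq_iff)
  qed
  ultimately show "stabiliser_matrix h Q M"
    unfolding stabiliser_matrix_def using r sub ES stab_groupD(1)[OF S] by (intro conjI exI[of _ E]) auto
qed

text \<open>The lines determine the polarities by \<open>polarity_unique\<close>, so the freedom
  that remains in the correspondence is the basis \<open>M\<close> of the label code. Injectivity of
  the site maps makes each space a copy of F_q x F_q, to which the symplectic form can be
  transported.\<close>

lemma corresponds_iff:
  fixes Q :: "('q, 'n :: finite) state set" and X :: "('n, 'r :: finite) polar_family"
  assumes S: "stab_group (stabiliser_of Q)" and card: "card (stabiliser_of Q) = 2 ^ CARD('r)"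
    and r: "real CARD('r) = real h * (real CARD('n) - code_k Q)"
    and inj: "\<And>(M :: 'r \<Rightarrow> ('q \<times> 'q) ^ 'n) i. bij_betw (comb M) UNIV (label ` stabiliser_of Q) \<Longrightarrow> inj (site_map M i)"
  shows "corresponds h e Q X \<longleftrightarrow> (\<exists>M. bij_betw (comb M) UNIV (label ` stabiliser_of Q) \<and> X = polar_system M)"
proof
  assume "corresponds h e Q X"
  then obtain M :: "'q ^ ('n + 'n) ^ 'r" where M: "stabiliser_matrix h Q M"
    and MX: "\<forall>i. fst (X i) = vec.span (\<Union>l<h. matrix_line h e M i l) \<and>
             symplectic_polarity (fst (X i)) (snd (X i)) \<and>
             (\<forall>l<h. snd (X i) (matrix_line h e M i l) = vec.span (\<Union>l'\<in>{..<h} - {l}. matrix_line h e M i l'))"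
    unfolding corresponds_def by blast
  have X: "\<And>i. fst (X i) = vec.span (\<Union>l<h. matrix_line h e M i l)"
           "\<And>i. symplectic_polarity (fst (X i)) (snd (X i))"
           "\<And>i l. l < h \<Longrightarrow> snd (X i) (matrix_line h e M i l) = vec.span (\<Union>l'\<in>{..<h} - {l}. matrix_line h e M i l')"
    using MX by blast+
  let ?M = "matrix_labels M"
  have bij: "bij_betw (comb ?M) UNIV (label ` stabiliser_of Q)"
    using M by (simp add: stabiliser_matrix_iff[OF S card r])
  have fX: "fst (X i) = range (site_map ?M i)" for i
    using span_matrix_lines[of "{..<h}" M i] by (simp add: X(1) coord_support_full)
  have "snd (X i) = snd (site_polar (site_map ?M i))" for i
  proof (rule polarity_unique)
    show "symplectic_polarity (range (site_map ?M i)) (snd (X i))" using X(2)[of i] by (simp add: fX)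
    show "snd (X i) (site_map ?M i ` coord_support {l}) = site_map ?M i ` coord_support ({..<h} - {l})" if "l < h" for l
      using X(3)[OF that, of i] span_matrix_lines[of "{..<h} - {l}" M i] by (simp add: matrix_line_eq[OF that])
  qed (auto simp: site_map_add inj[OF bij])
  then have "X = polar_system ?M"
    by (auto simp: fun_eq_iff polar_system_def prod_eq_iff fX)
  then show "\<exists>M. bij_betw (comb M) UNIV (label ` stabiliser_of Q) \<and> X = polar_system M" using bij by blast
next
  assume "\<exists>M. bij_betw (comb M) UNIV (label ` stabiliser_of Q) \<and> X = polar_system M"
  then obtain M' where M': "bij_betw (comb M') UNIV (label ` stabiliser_of Q)" "X = polar_system M'" by blast
  define M :: "'q ^ ('n + 'n) ^ 'r" where "M = (\<chi> \<rho> s. case s of Inl j \<Rightarrow> fst (M' \<rho> $ j) | Inr j \<Rightarrow> snd (M' \<rho> $ j))"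
  have MM: "matrix_labels M = M'" by (simp add: fun_eq_iff matrix_labels_def M_def vec_eq_iff)
  have "stabiliser_matrix h Q M" using M' by (simp add: stabiliser_matrix_iff[OF S card r] MM)
  moreover have "fst (X i) = vec.span (\<Union>l<h. matrix_line h e M i l)" for i
    using span_matrix_lines[of "{..<h}" M i] by (simp add: M'(2) polar_system_def MM coord_support_full)
  moreover have "symplectic_polarity (fst (X i)) (snd (X i))" for i
    using symplectic_site_polar[of "site_map M' i"] inj[OF M'(1)] by (simp add: M'(2) polar_system_def site_map_add)
  moreover have "snd (X i) (matrix_line h e M i l) = vec.span (\<Union>l'\<in>{..<h} - {l}. matrix_line h e M i l')" if "l < h" for i l
    using snd_site_polar_image[of "site_map M' i" "coord_support {l}"] inj[OF M'(1)] span_matrix_lines[of "{..<h} - {l}" M i]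
    by (simp add: M'(2) polar_system_def matrix_line_eq[OF that] MM site_map_add add_closed_coord_support perp_coord_support_single[OF that])
  ultimately show "corresponds h e Q X" unfolding corresponds_def by blast
qed

end

section \<open>Quantum sets\<close>

lemma sum_bit_eq_0_iff:
  "finite A \<Longrightarrow> (\<Sum>i\<in>A. f i :: bit) = 0 \<longleftrightarrow> even (card {i\<in>A. f i \<noteq> 0})"
proof (induction A rule: finite_induct)
  case (insert a A)
  have "{i \<in> insert a A. f i \<noteq> 0} = (if f a = 0 then {i\<in>A. f i \<noteq> 0} else insert a {i\<in>A. f i \<noteq> 0})" by auto
  moreover have "card (insert a {i\<in>A. f i \<noteq> 0}) = Suc (card {i\<in>A. f i \<noteq> 0})"
    using insert by (subst card_insert_disjoint) auto
  ultimately show ?case using insert by (cases "f a"; cases "sum f A") auto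
qed simp

text \<open>Compares sets that may differ: every element of \<open>B\<close> lies above one of
  \<open>A\<close>, and a minimum of \<open>A\<close> is attained in \<open>B\<close>. For the
  converse a minimum of \<open>A\<close> exists by well-ordering and then has to be that of
  \<open>B\<close>.\<close>

lemma is_minimum_cong:
  assumes below: "\<And>b. b \<in> B \<Longrightarrow> \<exists>a\<in>A. a \<le> b" and min: "\<And>d. is_minimum d A \<Longrightarrow> d \<in> B"
  shows "is_minimum d A \<longleftrightarrow> is_minimum d B"
proof -
  have 1: "is_minimum d B" if "is_minimum d A" for d
    using that below min by (auto simp: is_minimum_def) (meson order_trans)
  have "is_minimum d A" if B: "is_minimum d B"
  proof -
    obtain a where "a \<in> A" using B below by (auto simp: is_minimum_def)
    then have *: "is_minimum (LEAST a. a \<in> A) A" by (auto simp: is_minimum_def intro: LeastI Least_le)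
    have "(LEAST a. a \<in> A) = d" using 1[OF *] B by (auto simp: is_minimum_def intro: le_antisym)
    then show ?thesis using * by simp
  qed
  then show ?thesis using 1 by blast
qed

lemma wt_eq_0_iff [simp]: "wt v = 0 \<longleftrightarrow> v = 0"
  by (auto simp: wt_def vec_eq_iff)

lemma wt_le:
  assumes "\<And>i. v $ i \<noteq> 0 \<Longrightarrow> i \<in> I" shows "wt v \<le> card (I :: 'n :: finite set)"
  unfolding wt_def using assms by (intro card_mono) auto

section \<open>Subspaces of codimension one and two through their duals\<close>

lemma card_perp_bdot_mult:
  assumes "vec.subspace (W :: (bit ^ 'r :: finite) set)"
  shows "card (perp bdot W) * 2 ^ vec.dim W = 2 ^ CARD('r)"
  using bdot.card_mult_card_perp[of W] assms card_subspace_bit[OF assms]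
  by (simp add: subspace_bit_iff mult.commute)

lemma subspace_perp_bdot: "vec.subspace (perp bdot (A :: (bit ^ 'r :: finite) set))"
  by (simp add: subspace_bit_iff)

lemma codim_1_iff:
  "vec.subspace (H :: (bit ^ 'r :: finite) set) \<and> vec.dim H + 1 = CARD('r) \<longleftrightarrow> (\<exists>u. u \<noteq> 0 \<and> H = perp bdot {u})"
proof
  assume H: "vec.subspace H \<and> vec.dim H + 1 = CARD('r)"
  have "card (perp bdot H) * 2 ^ vec.dim H = 2 ^ (vec.dim H + 1)"
    using card_perp_bdot_mult[of H] H by simp
  then have "card (perp bdot H) = 2" by simp
  then obtain u where u: "u \<in> perp bdot H" "u \<noteq> 0"
    using card_mono[of "{0}" "perp bdot H"] by fastforce
  then have "{0, u} \<subseteq> perp bdot H" using bdot.add_closed_perp[of H] by (auto simp: add_closed_def)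
  then have "{0, u} = perp bdot H" using \<open>card (perp bdot H) = 2\<close> u by (intro card_subset_eq) auto
  moreover have "perp bdot {u} = perp bdot {0, u}" by (auto simp: perp_def)
  ultimately have "perp bdot {u} = perp bdot (perp bdot H)" by simp
  then show "\<exists>u. u \<noteq> 0 \<and> H = perp bdot {u}" using u H by (auto simp: bdot.perp_perp subspace_bit_iff)
next
  assume "\<exists>u. u \<noteq> 0 \<and> H = perp bdot {u}"
  then obtain u where u: "u \<noteq> 0" "H = perp bdot {u}" by blast
  have sub: "vec.subspace H" by (simp add: u subspace_perp_bdot)
  have "card (perp bdot H) = 2" using u by (simp add: bdot.perp_perp_single)
  then have "2 ^ (vec.dim H + 1) = (2 :: nat) ^ CARD('r)"
    using card_perp_bdot_mult[OF sub] by simp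
  then have "vec.dim H + 1 = CARD('r)" by (rule power_inject_exp[THEN iffD1, rotated]) simp
  then show "vec.subspace H \<and> vec.dim H + 1 = CARD('r)" using sub by blast
qed

text \<open>The dual of \<open>W\<close> has four elements, hence is
  \<open>{0, u, v, u + v}\<close>; over F_2 independence of \<open>u\<close> and \<open>v\<close>
  just says that they are nonzero and distinct.\<close>

lemma codim_2_iff:
  "vec.subspace (W :: (bit ^ 'r :: finite) set) \<and> vec.dim W + 2 = CARD('r) \<longleftrightarrow>
    (\<exists>u v. u \<noteq> 0 \<and> v \<noteq> 0 \<and> u \<noteq> v \<and> W = perp bdot {u, v})"
proof
  assume W: "vec.subspace W \<and> vec.dim W + 2 = CARD('r)"
  have "card (perp bdot W) * 2 ^ vec.dim W = 2 ^ (vec.dim W + 2)"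
    using card_perp_bdot_mult[of W] W by simp
  then have c: "card (perp bdot W) = 4" by (simp add: power_add)
  have "\<not> perp bdot W \<subseteq> {0}" using card_mono[of "{0}" "perp bdot W"] c by auto
  then obtain u where u: "u \<in> perp bdot W" "u \<noteq> 0" by auto
  have "\<not> perp bdot W \<subseteq> {0, u}" using card_mono[of "{0, u}" "perp bdot W"] c u by auto
  then obtain v where v: "v \<in> perp bdot W" "v \<noteq> 0" "v \<noteq> u" by auto
  have sub: "{0, u, v, u + v} \<subseteq> perp bdot W" using u v bdot.add_closed_perp[of W] by (auto simp: add_closed_def)
  have "card {0, u, v, u + v} = 4" using u v bdot.add_eq_0_iff_eq[of u v] by auto
  then have "{0, u, v, u + v} = perp bdot W" using c sub by (intro card_subset_eq) auto
  then have "perp bdot (perp bdot {u, v}) = perp bdot W" by (simp add: bdot.perp_perp_pair)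
  then have "perp bdot {u, v} = W"
    using W bdot.perp_perp[of W] bdot.perp_perp[of "perp bdot {u, v}"] by (simp add: subspace_bit_iff)
  then show "\<exists>u v. u \<noteq> 0 \<and> v \<noteq> 0 \<and> u \<noteq> v \<and> W = perp bdot {u, v}" using u v by blast
next
  assume "\<exists>u v. u \<noteq> 0 \<and> v \<noteq> 0 \<and> u \<noteq> v \<and> W = perp bdot {u, v}"
  then obtain u v where u: "u \<noteq> 0" "v \<noteq> 0" "u \<noteq> v" "W = perp bdot {u, v}" by blast
  have sub: "vec.subspace W" by (simp add: u subspace_perp_bdot)
  have "card (perp bdot W) = card {0, u, v, u + v}" by (simp only: u(4) bdot.perp_perp_pair)
  also have "\<dots> = 4" using u(1-3) bdot.add_eq_0_iff_eq[of u v] by auto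
  finally have "2 ^ (vec.dim W + 2) = (2 :: nat) ^ CARD('r)"
    using card_perp_bdot_mult[OF sub] by (simp add: power_add)
  then have "vec.dim W + 2 = CARD('r)" by (rule power_inject_exp[THEN iffD1, rotated]) simp
  then show "vec.subspace W \<and> vec.dim W + 2 = CARD('r)" using sub by blast
qed

lemma perp_bdot_span: "perp bdot (vec.span A) = perp bdot (A :: (bit ^ 'r :: finite) set)"
proof
  show "perp bdot (vec.span A) \<subseteq> perp bdot A" by (intro bdot.perp_antimono vec.span_superset)
  have "vec.span A \<subseteq> perp bdot (perp bdot A)"
    by (intro vec.span_minimal subspace_perp_bdot) (auto simp: perp_def bdot.sym)
  then show "perp bdot A \<subseteq> perp bdot (vec.span A)"
    by (intro subsetI bdot.perpI) (metis bdot.perpD bdot.sym subsetD)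
qed

lemma span_eq_UNIV_iff: "vec.span A = UNIV \<longleftrightarrow> perp bdot (A :: (bit ^ 'r :: finite) set) = {0}"
proof
  assume "vec.span A = UNIV"
  then have "perp bdot A = perp bdot UNIV" by (metis perp_bdot_span)
  also have "\<dots> = {0}" using bdot.nondeg by (auto simp: perp_def bdot.sym)
  finally show "perp bdot A = {0}" .
next
  assume *: "perp bdot A = {0}"
  have "vec.span A = perp bdot (perp bdot (vec.span A))"
    by (subst bdot.perp_perp) (simp_all flip: subspace_bit_iff)
  also have "\<dots> = perp bdot {0}" by (simp add: perp_bdot_span *)
  finally show "vec.span A = UNIV" by (simp add: perp_def)
qed

text \<open>The Boolean is true for \<open>k = 0\<close>.  In that case the code is self-dual, so its weights can be
  taken in the dual.\<close>

definition label_weights :: "bool \<Rightarrow> (('q :: {field, finite} \<times> 'q) ^ 'n :: finite) set \<Rightarrow> nat set" where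
  "label_weights b C = {wt v | v. v \<in> perp sp C \<and> (if b then v \<noteq> 0 else v \<notin> C)}"

text \<open>The sizes in \<open>quantum_set_min_distance\<close>, written in labels:
  \<open>w\<close> gives the chosen points, \<open>v\<close> a dependency among them and
  \<open>x\<close> a covering hyperplane. \<open>I\<close> may exceed the support of
  \<open>v\<close>, which is why only minima are compared with \<open>label_weights\<close>.\<close>

definition point_sizes :: "bool \<Rightarrow> (('q :: {field, finite} \<times> 'q) ^ 'n :: finite) set \<Rightarrow> nat set" where
  "point_sizes b C = {card I | I w. (\<forall>i\<in>I. w i \<noteq> 0) \<and>
     (\<exists>v\<in>perp sp C. v \<noteq> 0 \<and> (\<forall>i. v $ i = 0 \<or> i \<in> I \<and> v $ i = w i)) \<and>
     (b \<or> \<not> (\<exists>x\<in>C. x \<noteq> 0 \<and> (\<forall>i\<in>I. x $ i = 0 \<or> x $ i = w i) \<and> (\<forall>i. i \<notin> I \<longrightarrow> x $ i = 0)))}"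

section \<open>The conditions on a quantum set in terms of labels\<close>

context trace_basis
begin

text \<open>If coverings count, a dependency \<open>v\<close> inside \<open>C\<close> is excluded
  because it covers itself; so an admissible \<open>I\<close> always contains the support of an
  admissible word. Conversely, if \<open>x\<close> covers a word \<open>v\<close> of least weight,
  then \<open>x + v\<close> is admissible and strictly lighter, since \<open>x\<close> agrees with
  \<open>v\<close> wherever \<open>x\<close> is nonzero.\<close>

lemma is_minimum_point_sizes:
  fixes C :: "(('q \<times> 'q) ^ 'n :: finite) set"
  assumes C: "add_closed C" "C \<subseteq> perp sp C"
  shows "is_minimum d (label_weights b C) \<longleftrightarrow> is_minimum d (point_sizes b C)"
proof (rule is_minimum_cong)
  fix m assume "m \<in> point_sizes b C"
  then obtain I w v where m: "m = card I" and v: "v \<in> perp sp C" "v \<noteq> 0" "\<forall>i. v $ i = 0 \<or> i \<in> I \<and> v $ i = w i"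
    and cov: "b \<or> \<not> (\<exists>x\<in>C. x \<noteq> 0 \<and> (\<forall>i\<in>I. x $ i = 0 \<or> x $ i = w i) \<and> (\<forall>i. i \<notin> I \<longrightarrow> x $ i = 0))"
    unfolding point_sizes_def by blast
  have "wt v \<le> m" unfolding m using v(3) by (intro wt_le) auto
  moreover have "if b then v \<noteq> 0 else v \<notin> C" using v cov by (metis (full_types))
  ultimately show "\<exists>a\<in>label_weights b C. a \<le> m" using v(1) unfolding label_weights_def by blast
next
  fix m assume min: "is_minimum m (label_weights b C)"
  then obtain v where v: "m = wt v" "v \<in> perp sp C" "if b then v \<noteq> 0 else v \<notin> C"
    by (auto simp: is_minimum_def label_weights_def)
  have v0: "v \<noteq> 0" using v(3) C(1) by (auto simp: add_closed_def split: if_splits)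
  have "\<not> (\<exists>x\<in>C. x \<noteq> 0 \<and> (\<forall>i\<in>{i. v $ i \<noteq> 0}. x $ i = 0 \<or> x $ i = v $ i) \<and> (\<forall>i. i \<notin> {i. v $ i \<noteq> 0} \<longrightarrow> x $ i = 0))"
    if "\<not> b"
  proof
    assume "\<exists>x\<in>C. x \<noteq> 0 \<and> (\<forall>i\<in>{i. v $ i \<noteq> 0}. x $ i = 0 \<or> x $ i = v $ i) \<and> (\<forall>i. i \<notin> {i. v $ i \<noteq> 0} \<longrightarrow> x $ i = 0)"
    then obtain x where x: "x \<in> C" "x \<noteq> 0" "\<And>i. v $ i \<noteq> 0 \<Longrightarrow> x $ i = 0 \<or> x $ i = v $ i" "\<And>i. v $ i = 0 \<Longrightarrow> x $ i = 0"
      by auto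
    have "x + v \<in> perp sp C" using x(1) C(2) v(2) sp.add_closed_perp[of C] by (auto simp: add_closed_def)
    moreover have "x + v \<notin> C"
    proof
      assume "x + v \<in> C"
      then have "x + (x + v) \<in> C" using x(1) C(1) by (auto simp: add_closed_def)
      then show False using v(3) that by (simp add: add.assoc[symmetric] sp.add_self)
    qed
    ultimately have "wt (x + v) \<in> label_weights b C" using that by (auto simp: label_weights_def)
    then have "m \<le> wt (x + v)" using min by (auto simp: is_minimum_def)
    moreover have "wt (x + v) < wt v"
      unfolding wt_def
    proof (rule psubset_card_mono)
      obtain i where i: "x $ i \<noteq> 0" using x(2) by (auto simp: vec_eq_iff)
      then have "x $ i = v $ i" "v $ i \<noteq> 0" using x(3,4)[of i] by auto
      then have "(x + v) $ i = 0" by (simp add: sp1.add_self)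
      moreover have "{j. (x + v) $ j \<noteq> 0} \<subseteq> {j. v $ j \<noteq> 0}" using x(4) by auto
      ultimately show "{j. (x + v) $ j \<noteq> 0} \<subset> {j. v $ j \<noteq> 0}" using \<open>v $ i \<noteq> 0\<close> by auto
    qed simp
    ultimately show False using v(1) by simp
  qed
  then show "m \<in> point_sizes b C"
    unfolding point_sizes_def v(1) wt_def using v(2) v0
    by (intro CollectI exI[of _ "{i. v $ i \<noteq> 0}"] exI[of _ "\<lambda>i. v $ i"]) auto
qed

text \<open>A nonzero kernel element of the site map is a weight-one label in the dual code: an
  error at one position that commutes with the whole stabiliser.\<close>

lemma inj_site_map_iff:
  "inj (site_map (M :: 'r :: finite \<Rightarrow> ('q \<times> 'q) ^ 'n :: finite) i) \<longleftrightarrow> (\<forall>w. axis i w \<in> perp sp (range (comb M)) \<longrightarrow> w = 0)"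
proof -
  have "site_map M i w = 0 \<longleftrightarrow> axis i w \<in> perp sp (range (comb M))" for w
  proof -
    have "site_map M i w = 0 \<longleftrightarrow> (\<forall>u. bdot u (site_map M i w) = 0)"
      using bdot.nondeg[of "site_map M i w"] by (auto simp: bdot.sym)
    then show ?thesis by (auto simp: perp_def sp_axis bdot_site_map sp1.sym)
  qed
  then show ?thesis by (simp add: additive_inj_iff site_map_add)
qed

lemma sum_site_map_eq_0_iff:
  "(\<Sum>i\<in>UNIV. site_map M i (v $ i)) = 0 \<longleftrightarrow> v \<in> perp sp (range (comb (M :: 'r :: finite \<Rightarrow> ('q \<times> 'q) ^ 'n :: finite)))"
proof -
  have "bdot u (\<Sum>i\<in>UNIV. site_map M i (v $ i)) = sp (comb M u) v" for u
    by (simp add: bdot.sum_right bdot_site_map sp_def sp1.sym)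
  then show ?thesis using bdot.nondeg[of "\<Sum>i\<in>UNIV. site_map M i (v $ i)"]
    by (auto simp: perp_def bdot.sym)
qed

lemma range_site_map_subset_iff:
  "range (site_map M i) \<subseteq> perp bdot {u} \<longleftrightarrow> comb (M :: 'r :: finite \<Rightarrow> ('q \<times> 'q) ^ 'n :: finite) u $ i = 0"
proof -
  have "range (site_map M i) \<subseteq> perp bdot {u} \<longleftrightarrow> (\<forall>w. sp1 w (comb M u $ i) = 0)"
    by (simp only: perp_def image_subset_iff mem_Collect_eq bdot_site_map[symmetric]) simp
  then show ?thesis using sp1.nondeg[of "comb M u $ i"] sp1.sym by (metis sp1.zero_right)
qed

lemma span_site_maps_iff:
  "vec.span (\<Union>i. range (site_map M i)) = UNIV \<longleftrightarrow> inj (comb (M :: 'r :: finite \<Rightarrow> ('q \<times> 'q) ^ 'n :: finite))"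
proof -
  have "u \<in> perp bdot (\<Union>i. range (site_map M i)) \<longleftrightarrow> comb M u = 0" for u
  proof -
    have "u \<in> perp bdot (\<Union>i. range (site_map M i)) \<longleftrightarrow> (\<forall>i. range (site_map M i) \<subseteq> perp bdot {u})"
      by (auto simp: perp_def bdot.sym[of _ u])
    then show ?thesis by (simp add: range_site_map_subset_iff vec_eq_iff)
  qed
  then have "perp bdot (\<Union>i. range (site_map M i)) = {u. comb M u = 0}" by auto
  then show ?thesis
    unfolding span_eq_UNIV_iff by (auto simp: additive_inj_iff comb_add_label)
qed

text \<open>The intersection pulls back to the dual of the two i-th components, so its perpendicular
  space is spanned by these components; for an alternating form it is isotropic iff they are
  orthogonal.\<close>

lemma site_totally_isotropic_iff:
  fixes M :: "'r :: finite \<Rightarrow> ('q \<times> 'q) ^ 'n :: finite"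
  assumes inj: "inj (site_map M i)"
  shows "totally_isotropic (snd (site_polar (site_map M i)))
      (snd (site_polar (site_map M i)) (perp bdot {u, v} \<inter> range (site_map M i))) \<longleftrightarrow>
    sp1 (comb M u $ i) (comb M v $ i) = 0"
proof -
  let ?\<phi> = "site_map M i" and ?a = "comb M u $ i" and ?b = "comb M v $ i"
  have "perp bdot {u, v} \<inter> range ?\<phi> = ?\<phi> ` perp sp1 {?a, ?b}"
    by (auto simp: perp_def bdot_site_map sp1.sym)
  then have 1: "snd (site_polar ?\<phi>) (perp bdot {u, v} \<inter> range ?\<phi>) = ?\<phi> ` {0, ?a, ?b, ?a + ?b}"
    using snd_site_polar_image[of ?\<phi> "perp sp1 {?a, ?b}"] inj by (simp only: site_map_add sp1.add_closed_perp sp1.perp_perp_pair)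
  have "snd (site_polar ?\<phi>) (?\<phi> ` {0, ?a, ?b, ?a + ?b}) = ?\<phi> ` perp sp1 {0, ?a, ?b, ?a + ?b}"
    by (rule snd_site_polar_image) (simp_all only: site_map_add inj sp1.add_closed_pair)
  then have "totally_isotropic (snd (site_polar ?\<phi>)) (?\<phi> ` {0, ?a, ?b, ?a + ?b}) \<longleftrightarrow>
      {0, ?a, ?b, ?a + ?b} \<subseteq> perp sp1 {0, ?a, ?b, ?a + ?b}"
    unfolding totally_isotropic_def by (simp only: inj_image_subset_iff[OF inj])
  also have "\<dots> \<longleftrightarrow> sp1 ?a ?b = 0"
    by (auto simp: perp_def sp1.add_left sp1.add_right sp1.sym[of ?b ?a])
  finally show ?thesis unfolding 1 .
qed

lemma quantum_set_polar_system_iff: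
  fixes M :: "'r :: finite \<Rightarrow> ('q \<times> 'q) ^ 'n :: finite"
  assumes inj: "\<And>i. inj (site_map M i)"
  shows "quantum_set h (polar_system M) \<longleftrightarrow> inj (comb M) \<and> (\<forall>u v. sp (comb M u) (comb M v) = 0)"
proof -
  have 1: "vec.subspace (range (site_map M i))" for i
    by (intro subspace_additive_image site_map_add) (auto simp: add_closed_def)
  have 2: "vec.dim (range (site_map M i)) = 2 * h" for i
    by (intro dim_range_additive site_map_add inj)
  have 3: "symplectic_polarity (range (site_map M i)) (snd (site_polar (site_map M i)))" for i
    by (intro symplectic_site_polar site_map_add inj)
  have even: "even (card {i. \<not> totally_isotropic (snd (site_polar (site_map M i)))
      (snd (site_polar (site_map M i)) (perp bdot {u, v} \<inter> range (site_map M i)))}) \<longleftrightarrow> sp (comb M u) (comb M v) = 0" for u v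
    by (simp only: site_totally_isotropic_iff[OF inj] sp_def sum_bit_eq_0_iff finite UNIV_I simp_thms)
  have "quantum_set h (polar_system M) \<longleftrightarrow> vec.span (\<Union>i. range (site_map M i)) = UNIV \<and>
      (\<forall>W. vec.subspace W \<and> vec.dim W + 2 = CARD('r) \<longrightarrow>
        even (card {i. \<not> totally_isotropic (snd (site_polar (site_map M i)))
          (snd (site_polar (site_map M i)) (W \<inter> range (site_map M i)))}))"
    unfolding quantum_set_def polar_system_def by (simp add: 1 2 3)
  also have "\<dots> \<longleftrightarrow> inj (comb M) \<and> (\<forall>u v. u \<noteq> 0 \<and> v \<noteq> 0 \<and> u \<noteq> v \<longrightarrow> sp (comb M u) (comb M v) = 0)"
    unfolding span_site_maps_iff codim_2_iff using even by blast
  also have "\<dots> \<longleftrightarrow> inj (comb M) \<and> (\<forall>u v. sp (comb M u) (comb M v) = 0)"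
  proof -
    \<comment> \<open>These pairs define no subspace of codimension two, so the quantum set says
      nothing about them; \<open>sp\<close> vanishes there because it is alternating.\<close>
    have "sp (comb M u) (comb M v) = 0" if "u = 0 \<or> v = 0 \<or> u = v" for u v using that by auto
    then show ?thesis by blast
  qed
  finally show ?thesis .
qed

text \<open>A coefficient in F_2 either keeps a point or drops it, so a dependency is a dual word
  whose nonzero components are chosen elements \<open>w i\<close>.\<close>

lemma dependent_points_iff:
  fixes M :: "'r :: finite \<Rightarrow> ('q \<times> 'q) ^ 'n :: finite"
  assumes inj: "\<And>i. inj (site_map M i)" and p: "\<And>i. i \<in> I \<Longrightarrow> p i = site_map M i (w i)"
  shows "dependent_points (polar_system M) I p \<longleftrightarrow> (\<forall>i\<in>I. w i \<noteq> 0) \<and>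
    (\<exists>v\<in>perp sp (range (comb M)). v \<noteq> 0 \<and> (\<forall>i. v $ i = 0 \<or> i \<in> I \<and> v $ i = w i))"
proof -
  have p0: "p i \<noteq> 0 \<longleftrightarrow> w i \<noteq> 0" if "i \<in> I" for i
    using inj[of i] p[OF that] by (metis injD site_map_0)
  have pm: "p i \<in> fst (polar_system M i)" if "i \<in> I" for i using p[OF that] by (simp add: polar_system_def)
  have sum: "(\<Sum>i\<in>I. c i *s p i) = (\<Sum>i\<in>UNIV. site_map M i ((\<chi> i. if i \<in> I then bit_smult (c i) (w i) else 0) $ i))" for c
  proof -
    have "(\<Sum>i\<in>I. c i *s p i) = (\<Sum>i\<in>I. site_map M i (bit_smult (c i) (w i)))"
      by (rule sum.cong) (simp_all add: p additive_bit_smult[of "site_map M _", OF site_map_add] bit_smult_eq_scale)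
    also have "\<dots> = (\<Sum>i\<in>UNIV. if i \<in> I then site_map M i (bit_smult (c i) (w i)) else 0)"
      by (simp add: sum.If_cases)
    also have "\<dots> = (\<Sum>i\<in>UNIV. site_map M i ((\<chi> i. if i \<in> I then bit_smult (c i) (w i) else 0) $ i))"
      by (rule sum.cong) auto
    finally show ?thesis .
  qed
  have "(\<exists>c. (\<Sum>i\<in>I. c i *s p i) = 0 \<and> (\<exists>i\<in>I. c i \<noteq> 0)) \<longleftrightarrow>
     (\<exists>v\<in>perp sp (range (comb M)). v \<noteq> 0 \<and> (\<forall>i. v $ i = 0 \<or> i \<in> I \<and> v $ i = w i))" if w: "\<forall>i\<in>I. w i \<noteq> 0"
  proof
    assume "\<exists>c. (\<Sum>i\<in>I. c i *s p i) = 0 \<and> (\<exists>i\<in>I. c i \<noteq> 0)"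
    then obtain c j where c: "(\<Sum>i\<in>I. c i *s p i) = 0" "j \<in> I" "c j \<noteq> 0" by blast
    define v where "v = (\<chi> i. if i \<in> I then bit_smult (c i) (w i) else 0)"
    have "v \<in> perp sp (range (comb M))" using c(1) unfolding sum sum_site_map_eq_0_iff v_def .
    moreover have "v $ j \<noteq> 0" using c w by (simp add: v_def)
    then have "v \<noteq> 0" by auto
    moreover have "\<forall>i. v $ i = 0 \<or> i \<in> I \<and> v $ i = w i" by (auto simp: v_def bit_smult_def)
    ultimately show "\<exists>v\<in>perp sp (range (comb M)). v \<noteq> 0 \<and> (\<forall>i. v $ i = 0 \<or> i \<in> I \<and> v $ i = w i)" by blast
  next
    assume "\<exists>v\<in>perp sp (range (comb M)). v \<noteq> 0 \<and> (\<forall>i. v $ i = 0 \<or> i \<in> I \<and> v $ i = w i)"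
    then obtain v where v: "v \<in> perp sp (range (comb M))" "v \<noteq> 0" "\<And>i. v $ i = 0 \<or> i \<in> I \<and> v $ i = w i" by blast
    define c where "c i = (if v $ i = 0 then 0 else 1 :: bit)" for i
    have "(if i \<in> I then bit_smult (c i) (w i) else 0) = v $ i" for i
      using v(3)[of i] by (cases "v $ i = 0") (auto simp: c_def)
    then have "(\<chi> i. if i \<in> I then bit_smult (c i) (w i) else 0) = v"
      by (simp add: vec_eq_iff)
    then have "(\<Sum>i\<in>I. c i *s p i) = 0" using v(1) by (simp only: sum sum_site_map_eq_0_iff)
    moreover obtain j where "v $ j \<noteq> 0" using v(2) by (auto simp: vec_eq_iff)
    then have "j \<in> I" "c j \<noteq> 0" using v(3)[of j] by (auto simp: c_def)
    ultimately show "\<exists>c. (\<Sum>i\<in>I. c i *s p i) = 0 \<and> (\<exists>i\<in>I. c i \<noteq> 0)" by blast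
  qed
  then show ?thesis unfolding dependent_points_def using p0 pm by auto
qed

text \<open>Duality turns the inclusion into \<open>{0, a}\<close> inside \<open>{0, w}\<close>.
  Applied to a hyperplane that contains the perpendicular space of a point, it leaves 0 and
  \<open>w\<close> as components of the covering word, whereas containing the point alone would only
  say that \<open>a\<close> and \<open>w\<close> are orthogonal.\<close>

lemma perp_sp1_subset_iff: "perp sp1 {w} \<subseteq> perp sp1 {a :: 'q \<times> 'q} \<longleftrightarrow> a = 0 \<or> a = w"
proof
  assume "perp sp1 {w} \<subseteq> perp sp1 {a}"
  then have "perp sp1 (perp sp1 {a}) \<subseteq> perp sp1 (perp sp1 {w})" by (rule sp1.perp_antimono)
  then show "a = 0 \<or> a = w" by (simp add: sp1.perp_perp_single)
qed (auto simp: perp_def)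

lemma ex_covering_hyperplane_iff:
  fixes M :: "'r :: finite \<Rightarrow> ('q \<times> 'q) ^ 'n :: finite"
  assumes inj: "\<And>i. inj (site_map M i)" and injc: "inj (comb M)" and p: "\<And>i. i \<in> I \<Longrightarrow> p i = site_map M i (w i)"
  shows "(\<exists>H. covering_hyperplane (polar_system M) I p H) \<longleftrightarrow>
    (\<exists>x\<in>range (comb M). x \<noteq> 0 \<and> (\<forall>i\<in>I. x $ i = 0 \<or> x $ i = w i) \<and> (\<forall>i. i \<notin> I \<longrightarrow> x $ i = 0))"
proof -
  have "snd (polar_system M i) (vec.span {p i}) \<subseteq> perp bdot {u} \<longleftrightarrow> comb M u $ i = 0 \<or> comb M u $ i = w i" if "i \<in> I" for i u
  proof -
    have "vec.span {p i} = site_map M i ` {0, w i}"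
    proof -
      have "vec.span {p i} = {0, p i}"
      proof
        show "vec.span {p i} \<subseteq> {0, p i}"
          by (rule vec.span_minimal) (simp_all add: subspace_bit_iff bdot.add_closed_single)
        show "{0, p i} \<subseteq> vec.span {p i}" by (auto intro: vec.span_base vec.span_zero)
      qed
      then show ?thesis using p[OF that] by simp
    qed
    then have "snd (polar_system M i) (vec.span {p i}) = site_map M i ` perp sp1 {0, w i}"
      using snd_site_polar_image[of "site_map M i" "{0, w i}"] inj
      by (simp only: polar_system_def site_map_add sp1.add_closed_single)
    moreover have "perp sp1 {0, w i} = perp sp1 {w i}" by (auto simp: perp_def)
    moreover have "site_map M i ` A \<subseteq> perp bdot {u} \<longleftrightarrow> A \<subseteq> perp sp1 {comb M u $ i}" for A
      by (auto simp: perp_def bdot_site_map sp1.sym)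
    ultimately show ?thesis by (simp only: perp_sp1_subset_iff)
  qed
  note site = this
  have "(\<exists>H. covering_hyperplane (polar_system M) I p H) \<longleftrightarrow>
      (\<exists>u. u \<noteq> 0 \<and> (\<forall>i\<in>I. comb M u $ i = 0 \<or> comb M u $ i = w i) \<and> (\<forall>i. i \<notin> I \<longrightarrow> comb M u $ i = 0))"
  proof -
    have "covering_hyperplane (polar_system M) I p H \<longleftrightarrow>
        (\<exists>u. u \<noteq> 0 \<and> H = perp bdot {u} \<and> (\<forall>i\<in>I. snd (polar_system M i) (vec.span {p i}) \<subseteq> perp bdot {u}) \<and>
          (\<forall>i. i \<notin> I \<longrightarrow> fst (polar_system M i) \<subseteq> perp bdot {u}))" for H
      unfolding covering_hyperplane_def conj_assoc[symmetric] codim_1_iff[unfolded conj_assoc[symmetric]] by blast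
    moreover have "fst (polar_system M i) \<subseteq> perp bdot {u} \<longleftrightarrow> comb M u $ i = 0" for i u
      unfolding polar_system_def fst_site_polar by (rule range_site_map_subset_iff)
    ultimately show ?thesis using site by simp
  qed
  moreover have "comb M u \<noteq> 0 \<longleftrightarrow> u \<noteq> 0" for u
    using injc by (metis comb_0 injD)
  ultimately show ?thesis by auto
qed

lemma quantum_set_min_distance_iff:
  fixes M :: "'r :: finite \<Rightarrow> ('q \<times> 'q) ^ 'n :: finite"
  assumes inj: "\<And>i. inj (site_map M i)" and injc: "inj (comb M)" and iso: "\<And>u v. sp (comb M u) (comb M v) = 0"
  shows "quantum_set_min_distance h (polar_system M) d \<longleftrightarrow>
    is_minimum d (label_weights (CARD('r) = h * CARD('n)) (range (comb M)))"
proof -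
  let ?b = "CARD('r) = h * CARD('n)" and ?C = "range (comb M)"
  have "{card I | I p. dependent_points (polar_system M) I p \<and> (?b \<or> \<not> (\<exists>H. covering_hyperplane (polar_system M) I p H))}
      = point_sizes ?b ?C" (is "?L = _")
  proof (intro subset_antisym subsetI)
    fix m assume "m \<in> ?L"
    then obtain I p where m: "m = card I" and dep: "dependent_points (polar_system M) I p"
      and cov: "?b \<or> \<not> (\<exists>H. covering_hyperplane (polar_system M) I p H)" by blast
    have "\<forall>i\<in>I. \<exists>w. p i = site_map M i w" using dep unfolding dependent_points_def polar_system_def fst_site_polar by blast
    then obtain w where p: "\<And>i. i \<in> I \<Longrightarrow> p i = site_map M i (w i)" by metis
    show "m \<in> point_sizes ?b ?C"
      using dep cov dependent_points_iff[where I = I and p = p and w = w, OF inj p]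
        ex_covering_hyperplane_iff[where I = I and p = p and w = w, OF inj injc p]
      unfolding point_sizes_def m by blast
  next
    fix m assume "m \<in> point_sizes ?b ?C"
    then obtain I w where m: "m = card I" and *: "(\<forall>i\<in>I. w i \<noteq> 0) \<and>
     (\<exists>v\<in>perp sp ?C. v \<noteq> 0 \<and> (\<forall>i. v $ i = 0 \<or> i \<in> I \<and> v $ i = w i)) \<and>
     (?b \<or> \<not> (\<exists>x\<in>?C. x \<noteq> 0 \<and> (\<forall>i\<in>I. x $ i = 0 \<or> x $ i = w i) \<and> (\<forall>i. i \<notin> I \<longrightarrow> x $ i = 0)))"
      unfolding point_sizes_def by blast
    have p: "(\<lambda>i. site_map M i (w i)) i = site_map M i (w i)" for i by simp
    note D = dependent_points_iff[where I = I and p = "\<lambda>i. site_map M i (w i)" and w = w, OF inj p]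
    note H = ex_covering_hyperplane_iff[where I = I and p = "\<lambda>i. site_map M i (w i)" and w = w, OF inj injc p]
    have "dependent_points (polar_system M) I (\<lambda>i. site_map M i (w i)) \<and>
        (?b \<or> \<not> (\<exists>H. covering_hyperplane (polar_system M) I (\<lambda>i. site_map M i (w i)) H))"
      using * D H by blast
    then show "m \<in> ?L" unfolding m by blast
  qed
  moreover have "add_closed ?C" by (rule add_closed_image) (auto simp: add_closed_def comb_add_label)
  moreover have "?C \<subseteq> perp sp ?C" using iso by (auto simp: perp_def)
  ultimately show ?thesis
    unfolding quantum_set_min_distance_def by (simp only: is_minimum_point_sizes)
qed

section \<open>Codes and quantum sets\<close>

lemma paulis_conj:
  assumes E: "E \<in> paulis" and F: "F \<in> (paulis :: ('q, 'n :: finite) op set)"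
  shows "E ** F ** adj E = scale_op (bit_sign (sp (label E) (label F))) F"
proof -
  obtain c where c: "c \<in> phases" "E = pauli c (label E)" using pauliE[OF E] by blast
  obtain d where d: "F = pauli d (label F)" using pauliE[OF F] by blast
  have "pauli c (label E) ** pauli d (label F) ** adj (pauli c (label E)) =
      scale_op (bit_sign (sp (label E) (label F))) (pauli d (label F))"
    by (simp add: pauli_conj[OF c(1)])
  then show ?thesis unfolding c(2)[symmetric] d[symmetric] .
qed

lemma scale_op_cancel:
  assumes F: "F \<in> (paulis :: ('q, 'n :: finite) op set)" and eq: "scale_op (bit_sign b) F = F"
  shows "b = 0"
proof -
  obtain d where d: "d \<in> phases" "F = pauli d (label F)" using pauliE[OF F] by blast
  have "pauli (bit_sign b * d) (label F) = pauli d (label F)"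
    using eq d(2) by (metis scale_op_pauli)
  then have "bit_sign b * d = d"
    using pauli_inject[of d "label F" "bit_sign b * d" "label F"] phases_nonzero[OF d(1)] by simp
  then show ?thesis using phases_nonzero[OF d(1)] by (cases b) auto
qed

text \<open>Conjugation changes an element of \<open>S\<close> at most by a sign, and
  \<open>S\<close> has at most one element per label. Mapping \<open>S\<close> into itself thus
  forces all signs to be 1, which is orthogonality to every label of \<open>S\<close>.\<close>

lemma pauli_normaliser_eq:
  assumes S: "stab_group (S :: ('q, 'n :: finite) op set)"
  shows "pauli_normaliser S = {E \<in> paulis. label E \<in> perp sp (label ` S)}"
proof (intro subset_antisym subsetI)
  fix E assume "E \<in> pauli_normaliser S"
  then have E: "E \<in> paulis" and im: "(\<lambda>A. E ** A ** adj E) ` S = S" by (auto simp: pauli_normaliser_def)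
  have "sp (label F) (label E) = 0" if F: "F \<in> S" for F
  proof -
    have FP: "F \<in> paulis" using F stab_groupD(1)[OF S] by auto
    have "E ** F ** adj E \<in> S" using imageI[OF F, of "\<lambda>A. E ** A ** adj E"] unfolding im .
    then have "scale_op (bit_sign (sp (label E) (label F))) F \<in> S" unfolding paulis_conj[OF E FP] .
    moreover have "label (scale_op (bit_sign b) F) = label F" for b
    proof -
      obtain d where d: "d \<in> phases" "F = pauli d (label F)" using pauliE[OF FP] by blast
      have "label (scale_op (bit_sign b) (pauli d (label F))) = label F" using d(1) by (simp add: phases_closed)
      then show ?thesis unfolding d(2)[symmetric] .
    qed
    ultimately have "scale_op (bit_sign (sp (label E) (label F))) F = F"
      using inj_onD[OF stab_group_label_inj[OF S]] F by blast
    then show ?thesis using scale_op_cancel[OF FP] by (simp add: sp.sym)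
  qed
  then show "E \<in> {E \<in> paulis. label E \<in> perp sp (label ` S)}" using E by (auto simp: perp_def)
next
  fix E assume "E \<in> {E \<in> paulis. label E \<in> perp sp (label ` S)}"
  then have E: "E \<in> paulis" "\<And>F. F \<in> S \<Longrightarrow> sp (label E) (label F) = 0" by (auto simp: perp_def sp.sym)
  have "E ** F ** adj E = F" if "F \<in> S" for F
    using paulis_conj[OF E(1), of F] that stab_groupD(1)[OF S] E(2)[OF that] by auto
  then show "E \<in> pauli_normaliser S" using E(1) by (simp add: pauli_normaliser_def)
qed

lemma phase_closure_eq:
  assumes S: "stab_group (S :: ('q, 'n :: finite) op set)"
  shows "phase_closure S = {E \<in> paulis. label E \<in> label ` S}"
proof (intro subset_antisym subsetI)
  fix E assume "E \<in> phase_closure S"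
  then obtain c F where c: "c \<in> phases" "F \<in> S" "E = scale_op c F" by (auto simp: phase_closure_def)
  obtain d where d: "d \<in> phases" "F = pauli d (label F)"
    using pauliE[of F] c(2) stab_groupD(1)[OF S] by blast
  have "E = pauli (c * d) (label F)" using c(3) d(2) by (metis scale_op_pauli)
  then show "E \<in> {E \<in> paulis. label E \<in> label ` S}" using c d by (simp add: pauli_mem phases_closed)
next
  fix E assume "E \<in> {E \<in> paulis. label E \<in> label ` S}"
  then obtain F where F: "E \<in> paulis" "F \<in> S" "label E = label F" by auto
  obtain c where c: "c \<in> phases" "E = pauli c (label E)" using pauliE[OF F(1)] by blast
  obtain d where d: "d \<in> phases" "F = pauli d (label F)"
    using pauliE[of F] F(2) stab_groupD(1)[OF S] by blast
  have "scale_op (c * cnj d) (pauli d (label F)) = pauli c (label E)"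
    using phases_mult_cnj[OF d(1)] F(3) by (simp add: mult.assoc mult.commute[of "cnj d"])
  then have "E = scale_op (c * cnj d) F" unfolding c(2)[symmetric] d(2)[symmetric] by simp
  then show "E \<in> phase_closure S" unfolding phase_closure_def using F(2) phases_closed phases_cnj c(1) d(1) by blast
qed

lemma isotropic_self_dual:
  fixes C :: "(('q \<times> 'q) ^ 'n :: finite) set"
  assumes C: "add_closed C" "C \<subseteq> perp sp C" and card: "card C = CARD('q) ^ CARD('n)"
  shows "perp sp C = C"
proof -
  have "card C * card (perp sp C) = card C * CARD('q) ^ CARD('n)"
    using sp.card_mult_card_perp[OF C(1)] card by (simp add: power_mult_distrib)
  then have "card (perp sp C) = card C" using card by simp
  then show ?thesis using C(2) by (metis card_subset_eq finite)
qed

lemma label_isotropic: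
  assumes S: "stab_group (S :: ('q, 'n :: finite) op set)"
  shows "label ` S \<subseteq> perp sp (label ` S)"
  using stab_group_isotropic[OF S] by (auto simp: perp_def)

lemma card_label:
  assumes S: "stab_group (S :: ('q, 'n :: finite) op set)"
  shows "card (label ` S) = card S"
  using card_image[OF stab_group_label_inj[OF S]] .

lemma code_min_distance_iff:
  assumes S: "stab_group (stabiliser_of (Q :: ('q, 'n :: finite) state set))"
  shows "code_min_distance Q d \<longleftrightarrow>
    is_minimum d (label_weights (card (stabiliser_of Q) = CARD('q) ^ CARD('n)) (label ` stabiliser_of Q))"
proof -
  let ?S = "stabiliser_of Q" and ?C = "label ` stabiliser_of Q"
  have C0: "0 \<in> ?C" using add_closed_label[OF S] by (simp add: add_closed_def)
  have ex: "\<exists>E\<in>paulis. label E = v" for v :: "('q \<times> 'q) ^ 'n"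
    by (rule bexI[of _ "pauli 1 v"]) (auto intro: pauli_mem)
  have 1: "{weight E | E. E \<in> ?S \<and> weight E \<noteq> 0} = label_weights True ?C" if "card ?S = CARD('q) ^ CARD('n)"
  proof -
    have "perp sp ?C = ?C"
      using that by (intro isotropic_self_dual add_closed_label S label_isotropic) (simp add: card_label[OF S])
    then show ?thesis by (auto simp: label_weights_def weight_eq)
  qed
  have 2: "{weight E | E. E \<in> pauli_normaliser ?S - phase_closure ?S \<and> weight E \<noteq> 0} = label_weights False ?C"
  proof (intro subset_antisym subsetI)
    fix m assume "m \<in> label_weights False ?C"
    then obtain v where v: "m = wt v" "v \<in> perp sp ?C" "v \<notin> ?C" by (auto simp: label_weights_def)
    obtain E where E: "E \<in> paulis" "label E = v" using ex by blast
    have "E \<in> pauli_normaliser ?S - phase_closure ?S" "weight E = m"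
      using v E by (simp_all add: pauli_normaliser_eq[OF S] phase_closure_eq[OF S] weight_eq)
    moreover have "m \<noteq> 0" using v C0 by auto
    ultimately show "m \<in> {weight E | E. E \<in> pauli_normaliser ?S - phase_closure ?S \<and> weight E \<noteq> 0}" by blast
  qed (auto simp: label_weights_def weight_eq pauli_normaliser_eq[OF S] phase_closure_eq[OF S])
  show ?thesis
    unfolding code_min_distance_def Let_def
  proof (cases "card ?S = CARD('q) ^ CARD('n)")
    case True
    show "is_minimum d {weight E |E. E \<in> (if card ?S = CARD('q) ^ CARD('n) then ?S else pauli_normaliser ?S - phase_closure ?S) \<and> weight E \<noteq> 0} \<longleftrightarrow>
      is_minimum d (label_weights (card ?S = CARD('q) ^ CARD('n)) ?C)"
      unfolding if_P[OF True] 1[OF True] using True by simp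
  next
    case False
    show "is_minimum d {weight E |E. E \<in> (if card ?S = CARD('q) ^ CARD('n) then ?S else pauli_normaliser ?S - phase_closure ?S) \<and> weight E \<noteq> 0} \<longleftrightarrow>
      is_minimum d (label_weights (card ?S = CARD('q) ^ CARD('n)) ?C)"
      unfolding if_not_P[OF False] 2 using False by simp
  qed
qed

text \<open>The binary logarithm of \<open>card S * dim Q = q ^ n\<close>; \<open>k\<close> is a
  real number, so its relation to the order of the stabiliser is read through logarithms.\<close>

lemma log_card_stabiliser:
  assumes Q: "stabiliser_code (Q :: ('q, 'n :: finite) state set)"
  shows "real h * (real CARD('n) - code_k Q) = log 2 (real (card (stabiliser_of Q)))"
proof -
  let ?S = "stabiliser_of Q" and ?D = "vec.dim Q"
  have eq: "card ?S * ?D = 2 ^ (h * CARD('n))"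
    using card_mult_dim_fixed_space[OF stabiliser_code_stab_group(1)[OF Q]]
    unfolding stabiliser_code_stab_group(2)[OF Q] by (simp add: card_q power_mult)
  have "card ?S * ?D > 0" unfolding eq by simp
  then have pos: "real (card ?S) > 0" "real ?D > 0"
    by (simp_all del: vec.dim_eq_0)
  have "real (card ?S) * real ?D = 2 ^ (h * CARD('n))"
    unfolding of_nat_mult[symmetric] eq by simp
  then have "log 2 (real (card ?S) * real ?D) = real (h * CARD('n))" by (simp only:) simp
  then have "log 2 (real (card ?S)) + log 2 (real ?D) = real (h * CARD('n))"
    by (simp only: log_mult_pos[OF pos])
  moreover have "real h * code_k Q = log 2 (real ?D)"
  proof -
    have "log 2 (2 ^ h :: real) = real h" by simp
    then show ?thesis
      using h_pos by (simp add: code_k_def card_q log_base_change[of 2 "2 ^ h"])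
  qed
  ultimately show ?thesis by (simp add: algebra_simps)
qed

lemma card_stabiliser:
  assumes Q: "stabiliser_code (Q :: ('q, 'n :: finite) state set)"
  shows "real CARD('r :: finite) = real h * (real CARD('n) - code_k Q) \<longleftrightarrow> card (stabiliser_of Q) = 2 ^ CARD('r)"
proof -
  let ?S = "stabiliser_of Q"
  have fin: "card ?S > 0"
    using stab_groupD(2,5)[OF stabiliser_code_stab_group(1)[OF Q]] by (auto simp: card_gt_0_iff)
  have "real CARD('r) = log 2 (real (card ?S)) \<longleftrightarrow> real (card ?S) = 2 powr real CARD('r)"
    using fin log_powr_cancel[of 2 "real CARD('r)"] powr_log_cancel[of 2 "real (card ?S)"] by auto
  also have "\<dots> \<longleftrightarrow> card ?S = 2 ^ CARD('r)"
    by (simp add: powr_realpow)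
  finally show ?thesis by (simp only: log_card_stabiliser[OF Q])
qed

lemma wt_axis: "w \<noteq> 0 \<Longrightarrow> wt (axis i w :: ('q \<times> 'q) ^ 'n :: finite) = 1"
  by (simp add: wt_def axis_def if_distrib)

lemma wt_1D:
  assumes "wt (v :: ('q \<times> 'q) ^ 'n :: finite) = 1" obtains i w where "v = axis i w" "w \<noteq> 0"
proof -
  obtain i where i: "{j. v $ j \<noteq> 0} = {i}" using assms card_1_singletonE unfolding wt_def by blast
  then have "v = axis i (v $ i)" by (auto simp: vec_eq_iff axis_def)
  moreover have "v $ i \<noteq> 0" using i by auto
  ultimately show ?thesis using that by blast
qed

lemma card_eq_iff_rank: "(2 :: nat) ^ CARD('r :: finite) = CARD('q) ^ CARD('n :: finite) \<longleftrightarrow> CARD('r) = h * CARD('n)"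
  by (simp add: card_q flip: power_mult)

text \<open>The fourth conclusion combines \<open>d \<ge> 2\<close> with the exclusion of stabiliser
  elements of weight one: a weight-one label in the dual either lies in the label code, which
  \<open>codes\<close> rules out, or lies outside it and makes the distance at most 1.\<close>

lemma codesD:
  fixes Q :: "('q, 'n :: finite) state set"
  assumes Q: "Q \<in> codes k d" and d: "d \<ge> 2" and r: "real CARD('r :: finite) = real h * (real CARD('n) - k)"
  shows "stab_group (stabiliser_of Q)" "card (stabiliser_of Q) = 2 ^ CARD('r)"
    "real CARD('r) = real h * (real CARD('n) - code_k Q)"
    "\<And>(M :: 'r \<Rightarrow> ('q \<times> 'q) ^ 'n) i. bij_betw (comb M) UNIV (label ` stabiliser_of Q) \<Longrightarrow> inj (site_map M i)"
    "is_minimum d (label_weights (CARD('r) = h * CARD('n)) (label ` stabiliser_of Q))"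
proof -
  let ?S = "stabiliser_of Q" and ?C = "label ` stabiliser_of Q"
  have code: "stabiliser_code Q" "code_k Q = k" "code_min_distance Q d" and w1: "\<And>E. E \<in> ?S \<Longrightarrow> weight E \<noteq> 1"
    using Q by (auto simp: codes_def stabiliser_code_params_def)
  show S: "stab_group ?S" by (rule stabiliser_code_stab_group(1)[OF code(1)])
  show k: "real CARD('r) = real h * (real CARD('n) - code_k Q)" using r code(2) by simp
  then show card: "card ?S = 2 ^ CARD('r)" using card_stabiliser[OF code(1), where 'r = 'r] by simp
  show min: "is_minimum d (label_weights (CARD('r) = h * CARD('n)) ?C)"
    using code(3) unfolding code_min_distance_iff[OF S] card card_eq_iff_rank .
  fix M :: "'r \<Rightarrow> ('q \<times> 'q) ^ 'n" and i
  assume "bij_betw (comb M) UNIV ?C"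
  then have C: "range (comb M) = ?C" by (simp add: bij_betw_def)
  have "w = 0" if "axis i w \<in> perp sp ?C" for w
  proof (rule ccontr)
    assume w: "w \<noteq> 0"
    have "axis i w \<notin> ?C"
    proof
      assume "axis i w \<in> ?C"
      then obtain E where "E \<in> ?S" "label E = axis i w" by auto
      then show False using w1[of E] wt_axis[OF w, of i] by (simp add: weight_eq)
    qed
    moreover have "axis i w \<noteq> (0 :: ('q \<times> 'q) ^ 'n)" using w by (auto simp: vec_eq_iff axis_def)
    ultimately have "wt (axis i w) \<in> label_weights (CARD('r) = h * CARD('n)) ?C"
      using that unfolding label_weights_def by auto
    then show False using min d wt_axis[OF w, of i] by (auto simp: is_minimum_def)
  qed
  then show "inj (site_map M i)" by (simp add: inj_site_map_iff C)
qed

lemma codes_corresponds_iff: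
  fixes Q :: "('q, 'n :: finite) state set" and X :: "('n, 'r :: finite) polar_family"
  assumes Q: "Q \<in> codes k d" and d: "d \<ge> 2" and r: "real CARD('r) = real h * (real CARD('n) - k)"
  shows "corresponds h e Q X \<longleftrightarrow> (\<exists>M. bij_betw (comb M) UNIV (label ` stabiliser_of Q) \<and> X = polar_system M)"
  by (rule corresponds_iff) (rule codesD[OF Q d r])+

lemma codes_ex_corresponds:
  fixes Q :: "('q, 'n :: finite) state set"
  assumes Q: "Q \<in> codes k d" and d: "d \<ge> 2" and r: "real CARD('r :: finite) = real h * (real CARD('n) - k)"
  shows "\<exists>X :: ('n, 'r) polar_family. corresponds h e Q X"
proof -
  note c = codesD[OF Q d r]
  have "\<exists>M :: 'r \<Rightarrow> _. bij_betw (comb M) UNIV (label ` stabiliser_of Q)"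
    by (intro ex_comb_bij sp.add_self add_closed_label c(1)) (simp add: card_label[OF c(1)] c(2))
  then show ?thesis unfolding codes_corresponds_iff[OF Q d r] by blast
qed

lemma corresponds_quantum_set:
  fixes Q :: "('q, 'n :: finite) state set" and X :: "('n, 'r :: finite) polar_family"
  assumes Q: "Q \<in> codes k d" and d: "d \<ge> 2" and r: "real CARD('r) = real h * (real CARD('n) - k)"
    and X: "corresponds h e Q X"
  shows "X \<in> quantum_sets h d"
proof -
  note c = codesD[OF Q d r]
  obtain M where M: "bij_betw (comb M) UNIV (label ` stabiliser_of Q)" "X = polar_system M"
    using X unfolding codes_corresponds_iff[OF Q d r] by blast
  have inj: "inj (site_map M i)" for i by (rule c(4)[OF M(1)])
  have injc: "inj (comb M)" and C: "range (comb M) = label ` stabiliser_of Q" using M(1) by (auto simp: bij_betw_def)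
  have iso: "sp (comb M u) (comb M v) = 0" for u v
    using label_isotropic[OF c(1)] unfolding C[symmetric] perp_def by blast
  have "quantum_set h X" using quantum_set_polar_system_iff[OF inj] injc iso M(2) by blast
  moreover have "quantum_set_min_distance h X d"
    using quantum_set_min_distance_iff[OF inj injc iso, of d] c(5) unfolding M(2) C by blast
  ultimately show ?thesis by (simp add: quantum_sets_def)
qed

text \<open>Symplectic Gram-Schmidt: the hyperbolic pairs found so far are extended by some
  \<open>v\<close> orthogonal to all of them together with a partner \<open>w\<close>.
  \<open>F\<close> is additive on the whole space, so sums expand without membership
  conditions.\<close>

lemma hyperbolic_family_extend:
  fixes F :: "bit ^ 'r :: finite \<Rightarrow> bit ^ 'r \<Rightarrow> bit"
  assumes Fl: "\<And>x y z. F (x + y) z = F x z + F y z" and Fr: "\<And>x y z. F z (x + y) = F z x + F z y"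
    and alt: "\<And>x. F x x = 0" and V: "add_closed V" and nondeg: "\<And>v. v \<in> V \<Longrightarrow> (\<And>w. w \<in> V \<Longrightarrow> F v w = 0) \<Longrightarrow> v = 0"
    and card: "card V = 2 ^ (2 * m)" and j: "j \<le> m"
  shows "\<exists>x z. \<forall>l<j. x l \<in> V \<and> z l \<in> V \<and>
    (\<forall>k<j. F (x l) (x k) = 0 \<and> F (z l) (z k) = 0 \<and> F (x l) (z k) = (if l = k then 1 else 0))"
  using j
proof (induction j)
  case (Suc j)
  then obtain x z where xz': "\<forall>l<j. x l \<in> V \<and> z l \<in> V \<and>
    (\<forall>k<j. F (x l) (x k) = 0 \<and> F (z l) (z k) = 0 \<and> F (x l) (z k) = (if l = k then 1 else 0))"
    using Suc_leD by blast
  have xz: "\<And>l. l < j \<Longrightarrow> x l \<in> V" "\<And>l. l < j \<Longrightarrow> z l \<in> V"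
    "\<And>l k. l < j \<Longrightarrow> k < j \<Longrightarrow> F (x l) (x k) = 0" "\<And>l k. l < j \<Longrightarrow> k < j \<Longrightarrow> F (z l) (z k) = 0"
    "\<And>l k. l < j \<Longrightarrow> k < j \<Longrightarrow> F (x l) (z k) = (if l = k then 1 else 0)"
    using xz' by blast+
  have sym: "F a b = F b a" for a b
  proof -
    have "F a b + F b a = F (a + b) (a + b)" unfolding Fl Fr by (simp add: alt)
    then show ?thesis by (simp only: alt bit_add_eq_0_iff)
  qed
  \<comment> \<open>\<open>T v\<close> records the products of \<open>v\<close> with the
    \<open>2 * j\<close> vectors chosen so far. There are only \<open>4 ^ j\<close> records, fewer
    than elements of \<open>V\<close>; two distinct vectors share one, and their sum is orthogonal
    to all chosen vectors.\<close>
  define T where "T v = ({l. l < j \<and> F v (x l) = 1}, {l. l < j \<and> F v (z l) = 1})" for v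
  have "T ` V \<subseteq> Pow {..<j} \<times> Pow {..<j}" by (auto simp: T_def)
  then have "card (T ` V) \<le> card (Pow {..<j} \<times> Pow {..<j})" by (intro card_mono) auto
  also have "\<dots> = 2 ^ (2 * j)" by (simp add: card_cartesian_product card_Pow mult_2 power_add)
  also have "\<dots> < card V" using Suc.prems by (simp add: card)
  finally have "\<not> inj_on T V" by (metis card_image less_irrefl)
  then obtain a b where ab: "a \<in> V" "b \<in> V" "a \<noteq> b" "T a = T b" by (auto simp: inj_on_def)
  define v where "v = a + b"
  have v: "v \<in> V" "v \<noteq> 0" using ab V by (auto simp: v_def add_closed_def bdot.add_eq_0_iff_eq)
  have orth: "F v (x l) = 0" "F v (z l) = 0" if "l < j" for l
  proof -
    have "{l. l < j \<and> F a (x l) = 1} = {l. l < j \<and> F b (x l) = 1}" "{l. l < j \<and> F a (z l) = 1} = {l. l < j \<and> F b (z l) = 1}"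
      using ab(4) by (simp_all add: T_def)
    then have "F a (x l) = 1 \<longleftrightarrow> F b (x l) = 1" "F a (z l) = 1 \<longleftrightarrow> F b (z l) = 1" using that by blast+
    then have "F a (x l) = F b (x l)" "F a (z l) = F b (z l)" by (metis bit_not_one_iff)+
    then show "F v (x l) = 0" "F v (z l) = 0" by (simp_all add: v_def Fl)
  qed
  obtain w0 where w0: "w0 \<in> V" "F v w0 = 1" using nondeg[OF v(1)] v(2) by (metis bit_not_zero_iff)
  \<comment> \<open>Removes from \<open>w0\<close> its components along the chosen pairs; the
    coefficient of each vector is the product of \<open>w0\<close> with its partner. The product
    with \<open>v\<close> does not change.\<close>
  define w where "w = w0 + (\<Sum>l<j. bit_smult (F w0 (z l)) (x l)) + (\<Sum>l<j. bit_smult (F w0 (x l)) (z l))"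
  have sm: "bit_smult c (y :: bit) = c * y" for c y by (cases c) auto
  have F_w: "F y w = F y w0 + (\<Sum>l<j. F w0 (z l) * F y (x l)) + (\<Sum>l<j. F w0 (x l) * F y (z l))" for y
    unfolding w_def by (simp add: Fr additive_sum[of "F y", OF Fr] additive_bit_smult[of "F y", OF Fr] sm)
  have "w \<in> V"
  proof -
    have "bit_smult c y \<in> V" if "y \<in> V" for c y using that V by (cases c) (auto simp: add_closed_def)
    then have "(\<Sum>l<j. bit_smult (F w0 (z l)) (x l)) \<in> V" "(\<Sum>l<j. bit_smult (F w0 (x l)) (z l)) \<in> V"
      using xz(1,2) by (auto intro!: add_closed_sum[OF V])
    then show ?thesis using V w0(1) by (auto simp: w_def add_closed_def)
  qed
  moreover have vw: "F v w = 1" by (simp add: F_w w0 orth)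
  moreover have xw: "F (x k) w = 0" if "k < j" for k
  proof -
    have "(\<Sum>l<j. F w0 (z l) * F (x k) (x l)) = 0" using that by (simp add: xz(3))
    moreover have "(\<Sum>l<j. F w0 (x l) * F (x k) (z l)) = (\<Sum>l<j. if l = k then F w0 (x k) else 0)"
      using that by (intro sum.cong) (auto simp: xz(5))
    ultimately show ?thesis using that by (simp add: F_w sym[of w0])
  qed
  moreover have zw: "F (z k) w = 0" if "k < j" for k
  proof -
    have "(\<Sum>l<j. F w0 (x l) * F (z k) (z l)) = 0" using that by (simp add: xz(4))
    moreover have "(\<Sum>l<j. F w0 (z l) * F (z k) (x l)) = (\<Sum>l<j. if l = k then F w0 (z k) else 0)"
      using that by (intro sum.cong) (auto simp: xz(5) sym[of "z _"])
    ultimately show ?thesis using that by (simp add: F_w sym[of w0])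
  qed
  moreover have "F (x k) v = 0" "F w (x k) = 0" "F w (z k) = 0" "F (z k) v = 0" if "k < j" for k
    using orth[OF that] xw[OF that] zw[OF that] by (simp_all only: sym[of _ v] sym[of w])
  ultimately show ?case
    using v(1) xz orth alt
    by (intro exI[of _ "x(j := v)"] exI[of _ "z(j := w)"]) (simp add: less_Suc_eq)
qed simp

text \<open>Sending \<open>(e l, 0)\<close> and \<open>(0, e l)\<close> to the pairs of a symplectic
  basis of \<open>V\<close> is an isometry of F_q x F_q onto \<open>V\<close>.\<close>

lemma ex_site_polar:
  fixes V :: "(bit ^ 'r :: finite) set"
  assumes V: "vec.subspace V" "vec.dim V = 2 * h" and p: "symplectic_polarity V p"
  shows "\<exists>\<phi> :: 'q \<times> 'q \<Rightarrow> _. (\<forall>x y. \<phi> (x + y) = \<phi> x + \<phi> y) \<and> inj \<phi> \<and> (V, p) = site_polar \<phi>"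
proof -
  obtain f where f: "nondegenerate_symplectic_form V f"
    and pf: "p = restrict (\<lambda>W. {v \<in> V. \<forall>w\<in>W. f v w = 0}) {W. vec.subspace W \<and> W \<subseteq> V}"
    using p by (auto simp: symplectic_polarity_def)
  note f' = f[unfolded nondegenerate_symplectic_form_def]
  note f_add = f'[THEN conjunct1] and f_alt = f'[THEN conjunct2, THEN conjunct2, THEN conjunct1]
    and f_nd = f'[THEN conjunct2, THEN conjunct2, THEN conjunct2]
  \<comment> \<open>The form \<open>f\<close> is bilinear only on \<open>V\<close>; a linear
    projection \<open>g\<close> onto \<open>V\<close> extends it to a form \<open>F\<close> on the
    whole space.\<close>
  have "\<exists>g. g ` UNIV \<subseteq> V \<and> Vector_Spaces.linear (*s) (*s) g \<and> (\<forall>v\<in>V. g (id v) = v)"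
    by (rule vec.linear_exists_left_inverse_on[OF vec.linear_id V(1)]) simp
  then obtain g where g: "range g \<subseteq> V" "Vector_Spaces.linear (*s) (*s) g" "\<And>v. v \<in> V \<Longrightarrow> g v = v"
    unfolding id_apply by blast
  have g_add: "g (x + y) = g x + g y" for x y
    by (rule vec.linear_add[OF g(2)])
  have gV: "g x \<in> V" for x using g(1) by auto
  define F where "F x y = f (g x) (g y)" for x y
  have Fl: "F (x + y) z = F x z + F y z" and Fr: "F z (x + y) = F z x + F z y" and alt: "F x x = 0" for x y z
    unfolding F_def g_add using f_add f_alt gV by blast+
  have FV: "F x y = f x y" if "x \<in> V" "y \<in> V" for x y using that by (simp add: F_def g(3))
  have sym: "F a b = F b a" for a b
  proof -
    have "F a b + F b a = F (a + b) (a + b)" unfolding Fl Fr by (simp add: alt)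
    then show ?thesis by (simp only: alt bit_add_eq_0_iff)
  qed
  have V': "add_closed V" using V(1) by (simp only: subspace_bit_iff)
  have cardV: "card V = 2 ^ (2 * h)" using card_subspace_bit[OF V(1)] V(2) by simp
  have nd: "v = 0" if "v \<in> V" "\<And>w. w \<in> V \<Longrightarrow> F v w = 0" for v
    using that f_nd FV by auto
  obtain x z where xz': "\<forall>l<h. x l \<in> V \<and> z l \<in> V \<and>
    (\<forall>k<h. F (x l) (x k) = 0 \<and> F (z l) (z k) = 0 \<and> F (x l) (z k) = (if l = k then 1 else 0))"
    using hyperbolic_family_extend[OF Fl Fr alt V' nd cardV order_refl] by blast
  have xz: "\<And>l. l < h \<Longrightarrow> x l \<in> V" "\<And>l. l < h \<Longrightarrow> z l \<in> V"
    "\<And>l k. l < h \<Longrightarrow> k < h \<Longrightarrow> F (x l) (x k) = 0" "\<And>l k. l < h \<Longrightarrow> k < h \<Longrightarrow> F (z l) (z k) = 0"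
    "\<And>l k. l < h \<Longrightarrow> k < h \<Longrightarrow> F (x l) (z k) = (if l = k then 1 else 0)"
    using xz' by blast+
  define \<phi> :: "'q \<times> 'q \<Rightarrow> bit ^ 'r" where
    "\<phi> w = (\<Sum>l<h. bit_smult (coord h e l (fst w)) (x l)) + (\<Sum>l<h. bit_smult (coord h e l (snd w)) (z l))" for w
  have add: "\<phi> (v + w) = \<phi> v + \<phi> w" for v w
    by (simp add: \<phi>_def coord_add bit_smult_add_left bdot.add_self sum.distrib)
  have \<phi>V: "\<phi> w \<in> V" for w
  proof -
    have "bit_smult c y \<in> V" if "y \<in> V" for c y using that V' by (cases c) (auto simp: add_closed_def)
    then have "(\<Sum>l<h. bit_smult (coord h e l (fst w)) (x l)) \<in> V" "(\<Sum>l<h. bit_smult (coord h e l (snd w)) (z l)) \<in> V"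
      using xz(1,2) by (auto intro!: add_closed_sum[OF V'])
    then show ?thesis using V' by (auto simp: \<phi>_def add_closed_def)
  qed
  have \<phi>_basis: "\<phi> (e k, 0) = x k" "\<phi> (0, e k) = z k" if "k < h" for k
  proof -
    have 1: "(\<Sum>l<h. bit_smult (coord h e l (e k)) (y l)) = y k" for y :: "nat \<Rightarrow> bit ^ 'r"
    proof -
      have "(\<Sum>l<h. bit_smult (coord h e l (e k)) (y l)) = (\<Sum>l<h. if l = k then y k else 0)"
        using that by (intro sum.cong) (auto simp: coord_basis)
      then show ?thesis using that by simp
    qed
    show "\<phi> (e k, 0) = x k" "\<phi> (0, e k) = z k" by (simp_all add: \<phi>_def 1)
  qed
  have A: "(\<lambda>v. F (\<phi> v) (\<phi> (e l, 0))) = (\<lambda>v. sp1 v (e l, 0))" if "l < h" for l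
    by (rule additive_ext) (use that in \<open>simp_all add: add Fl sp1.add_left sp1_basis_pairs \<phi>_basis xz sym[of "z _" "x _"]\<close>)
  have B: "(\<lambda>v. F (\<phi> v) (\<phi> (0, e l))) = (\<lambda>v. sp1 v (0, e l))" if "l < h" for l
    by (rule additive_ext) (use that in \<open>auto simp: add Fl sp1.add_left sp1_basis_pairs \<phi>_basis xz\<close>)
  have C: "(\<lambda>w. F (\<phi> v) (\<phi> w)) = sp1 v" for v
    by (rule additive_ext) (simp_all only: add Fr sp1.add_right fun_cong[OF A] fun_cong[OF B])
  have form: "f (\<phi> v) (\<phi> w) = sp1 v w" for v w
    using fun_cong[OF C[of v], of w] FV[OF \<phi>V \<phi>V] by simp
  have inj: "inj \<phi>"
    unfolding additive_inj_iff[of \<phi>, OF add]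
  proof (intro allI impI)
    fix v assume v: "\<phi> v = 0"
    have "F 0 y = 0" for y using Fl[of 0 0 y] by (cases "F 0 y") auto
    then have "sp1 v w = 0" for w using fun_cong[OF C[of v], of w] v by simp
    then show "v = 0" by (rule sp1.nondeg)
  qed
  have range: "range \<phi> = V"
  proof (rule card_subset_eq)
    show "card (range \<phi>) = card V" using card_image[OF inj] card_site cardV by simp
  qed (use \<phi>V in auto)
  have "p = snd (site_polar \<phi>)"
    unfolding pf range[symmetric] by (rule snd_site_polar_form[symmetric]) (rule form)
  then have "(V, p) = site_polar \<phi>" using range by (simp add: prod_eq_iff)
  then show ?thesis using add inj by blast
qed

lemma quantum_set_ex_polar_system:
  fixes X :: "('n :: finite, 'r :: finite) polar_family"
  assumes "quantum_set h X"
  shows "\<exists>M :: 'r \<Rightarrow> ('q \<times> 'q) ^ 'n. X = polar_system M \<and> (\<forall>i. inj (site_map M i))"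
proof -
  have "\<exists>\<phi> :: 'q \<times> 'q \<Rightarrow> _. (\<forall>x y. \<phi> (x + y) = \<phi> x + \<phi> y) \<and> inj \<phi> \<and> (fst (X i), snd (X i)) = site_polar \<phi>" for i
    using assms unfolding quantum_set_def by (intro ex_site_polar) blast+
  then obtain \<phi> :: "'n \<Rightarrow> 'q \<times> 'q \<Rightarrow> bit ^ 'r" where \<phi>: "\<And>i x y. \<phi> i (x + y) = \<phi> i x + \<phi> i y"
    "\<And>i. inj (\<phi> i)" "\<And>i. (fst (X i), snd (X i)) = site_polar (\<phi> i)" by metis
  obtain M where "\<phi> = site_map M" using additive_eq_site_map[of \<phi>, OF \<phi>(1)] by blast
  with \<phi>(2,3) have "inj (site_map M i)" "X i = polar_system M i" for i by (simp_all add: polar_system_def)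
  then show ?thesis by blast
qed

lemma quantum_set_ex_code:
  fixes X :: "('n :: finite, 'r :: finite) polar_family"
  assumes X: "X \<in> quantum_sets h d" and d: "d \<ge> 2" and r: "real CARD('r) = real h * (real CARD('n) - k)"
  shows "\<exists>Q \<in> codes k d :: ('q, 'n) state set set. corresponds h e Q X"
proof -
  have qs: "quantum_set h X" "quantum_set_min_distance h X d" using X by (auto simp: quantum_sets_def)
  obtain M :: "'r \<Rightarrow> ('q \<times> 'q) ^ 'n" where M: "X = polar_system M" "\<And>i. inj (site_map M i)"
    using quantum_set_ex_polar_system[OF qs(1)] by blast
  have injc: "inj (comb M)" and iso: "\<And>u v. sp (comb M u) (comb M v) = 0"
    using quantum_set_polar_system_iff[OF M(2)] qs(1) M(1) by auto
  let ?C = "range (comb M)"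
  have C: "add_closed ?C" by (rule add_closed_image) (auto simp: add_closed_def comb_add_label)
  obtain S :: "('q, 'n) op set" where S: "stab_group S" "label ` S = ?C"
    using ex_stab_group[OF C] iso by blast
  define Q where "Q = fixed_space S"
  have code: "stabiliser_code Q" and SQ: "stabiliser_of Q = S"
    using fixed_space_stab_group[OF S(1)] by (auto simp: Q_def)
  have card: "card S = 2 ^ CARD('r)"
    using card_label[OF S(1)] card_image[OF injc] by (simp add: S(2))
  have r': "real CARD('r) = real h * (real CARD('n) - code_k Q)"
    using card_stabiliser[OF code, where 'r = 'r] card SQ by simp
  \<comment> \<open>\<open>r\<close> fixes the order of the stabiliser and thereby \<open>k\<close>;
    the cancellation uses \<open>h > 0\<close>.\<close>
  have k: "code_k Q = k" using r r' h_pos by simp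
  have SQ': "stab_group (stabiliser_of Q)" by (simp add: SQ S(1))
  have "is_minimum d (label_weights (CARD('r) = h * CARD('n)) ?C)"
    using quantum_set_min_distance_iff[OF M(2) injc iso, of d] qs(2) M(1) by blast
  then have dist: "code_min_distance Q d"
    unfolding code_min_distance_iff[OF SQ'] SQ card S(2) card_eq_iff_rank .
  have "weight E \<noteq> 1" if E: "E \<in> S" for E
  proof
    assume "weight E = 1"
    then obtain i w where w: "label E = axis i w" "w \<noteq> 0" unfolding weight_eq by (rule wt_1D)
    \<comment> \<open>A stabiliser element of weight one would lie in the dual code by isotropy,
      against the injectivity of the site map.\<close>
    have "axis i w \<in> perp sp ?C" using label_isotropic[OF S(1)] E w(1) unfolding S(2)[symmetric] by force
    then show False using M(2)[of i] w(2) unfolding inj_site_map_iff by blast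
  qed
  then have Qc: "Q \<in> codes k d" using code k dist by (simp add: codes_def stabiliser_code_params_def SQ)
  have "bij_betw (comb M) UNIV (label ` stabiliser_of Q)" using injc by (simp add: bij_betw_def SQ S(2))
  then have "corresponds h e Q X" unfolding codes_corresponds_iff[OF Qc d r] using M(1) by blast
  then show ?thesis using Qc by blast
qed

end

section \<open>Equivalence\<close>

text \<open>Isometries over F_2, not over F_q, because Clifford operators respect addition of labels
  but not scaling by the field. They are bijective by nondegeneracy.\<close>

definition site_symplectic :: "('q :: {field, finite} \<times> 'q \<Rightarrow> 'q \<times> 'q) \<Rightarrow> bool" where
  "site_symplectic T \<longleftrightarrow> (\<forall>x y. T (x + y) = T x + T y) \<and> (\<forall>x y. sp1 (T x) (T y) = sp1 x y)"

text \<open>Position \<open>j\<close> of the image is read from position \<open>\<sigma> j\<close>,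
  so the permutations compose contravariantly.\<close>

definition label_map :: "('n \<Rightarrow> 'n) \<Rightarrow> ('n \<Rightarrow> 'a \<Rightarrow> 'b) \<Rightarrow> 'a ^ 'n :: finite \<Rightarrow> 'b ^ 'n" where
  "label_map \<sigma> T v = (\<chi> j. T j (v $ \<sigma> j))"

definition label_equiv ::
  "(('q :: {field, finite} \<times> 'q) ^ 'n :: finite) set \<Rightarrow> (('q \<times> 'q) ^ 'n) set \<Rightarrow> bool" where
  "label_equiv C C' \<longleftrightarrow> (\<exists>\<sigma> T. bij \<sigma> \<and> (\<forall>j. site_symplectic (T j)) \<and> C' = label_map \<sigma> T ` C)"

lemma label_equivI:
  "bij \<sigma> \<Longrightarrow> (\<And>j. site_symplectic (T j)) \<Longrightarrow> C' = label_map \<sigma> T ` C \<Longrightarrow> label_equiv C C'"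
  unfolding label_equiv_def by blast

lemma site_symplecticI:
  "(\<And>x y. T (x + y) = T x + T y) \<Longrightarrow> (\<And>x y. sp1 (T x) (T y) = sp1 x y) \<Longrightarrow> site_symplectic T"
  unfolding site_symplectic_def by blast

lemma site_symplecticD:
  assumes "site_symplectic T" shows "T (x + y) = T x + T y" "sp1 (T x) (T y) = sp1 x y"
  using assms unfolding site_symplectic_def by blast+

lemma site_symplectic_id: "site_symplectic id"
  by (rule site_symplecticI) simp_all

lemma site_symplectic_comp: "site_symplectic S \<Longrightarrow> site_symplectic T \<Longrightarrow> site_symplectic (S \<circ> T)"
  by (rule site_symplecticI) (simp_all add: site_symplecticD)

lemma label_map_comp: "label_map \<sigma>' T' (label_map \<sigma> T v) = label_map (\<sigma> \<circ> \<sigma>') (\<lambda>j. T' j \<circ> T (\<sigma>' j)) v"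
  by (simp add: label_map_def)

lemma label_map_id: "label_map id (\<lambda>_. id) v = v"
  by (simp add: label_map_def)

lemma label_equiv_trans:
  assumes "label_equiv A B" "label_equiv B C" shows "label_equiv A C"
proof -
  obtain \<sigma> T \<sigma>' T' where *: "bij \<sigma>" "\<And>j. site_symplectic (T j)" "B = label_map \<sigma> T ` A"
    "bij \<sigma>'" "\<And>j. site_symplectic (T' j)" "C = label_map \<sigma>' T' ` B"
    using assms unfolding label_equiv_def by blast
  have "C = label_map (\<sigma> \<circ> \<sigma>') (\<lambda>j. T' j \<circ> T (\<sigma>' j)) ` A"
    unfolding *(3,6) image_image label_map_comp ..
  moreover have "bij (\<sigma> \<circ> \<sigma>')" using *(1,4) by (rule bij_comp[rotated])
  ultimately show ?thesis using site_symplectic_comp[OF *(5,2)] by (intro label_equivI)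
qed

lemma label_equiv_refl: "label_equiv A A"
  unfolding label_equiv_def
  by (intro exI[of _ id] exI[of _ "\<lambda>_. id"]) (simp add: site_symplectic_id label_map_id)

context trace_basis
begin

lemma site_symplectic_bij:
  assumes "site_symplectic (T :: 'q \<times> 'q \<Rightarrow> 'q \<times> 'q)" shows "bij T"
proof -
  have add: "T (x + y) = T x + T y" and T: "sp1 (T x) (T y) = sp1 x y" for x y
    by (rule site_symplecticD[OF assms])+
  have "inj T"
    unfolding additive_inj_iff[of T, OF add]
  proof (intro allI impI)
    fix x assume "T x = 0"
    then have "sp1 x y = 0" for y using T[of x y] by simp
    then show "x = 0" by (rule sp1.nondeg)
  qed
  then show ?thesis using finite_UNIV_inj_surj[of T] by (simp add: bij_def)
qed

lemma label_equiv_sym: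
  assumes "label_equiv C (C' :: (('q \<times> 'q) ^ 'n :: finite) set)" shows "label_equiv C' C"
proof -
  obtain \<sigma> T where *: "bij \<sigma>" "\<And>j. site_symplectic (T j)" "C' = label_map \<sigma> T ` C"
    using assms unfolding label_equiv_def by blast
  define \<tau> where "\<tau> = inv_into UNIV \<sigma>"
  define S where "S j = inv_into UNIV (T (\<tau> j))" for j
  have b: "bij (T j)" for j by (rule site_symplectic_bij[OF *(2)])
  have "T (\<tau> j) (S j x) = x" for j x
    unfolding S_def using b by (simp add: bij_is_surj surj_f_inv_f)
  note TS = this
  have "S j (x + y) = S j x + S j y" for j x y
  proof (rule injD[OF bij_is_inj[OF b[of "\<tau> j"]]])
    show "T (\<tau> j) (S j (x + y)) = T (\<tau> j) (S j x + S j y)"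
      by (simp add: TS site_symplecticD[OF *(2)])
  qed
  moreover have "sp1 (S j x) (S j y) = sp1 x y" for j x y
    using site_symplecticD(2)[OF *(2), of "\<tau> j" "S j x" "S j y"] by (simp add: TS)
  ultimately have S: "site_symplectic (S j)" for j by (rule site_symplecticI)
  have ST: "S j (T (\<tau> j) x) = x" for j x unfolding S_def using b by (simp add: bij_is_inj)
  have st: "\<sigma> (\<tau> j) = j" for j unfolding \<tau>_def using *(1) by (simp add: bij_is_surj surj_f_inv_f)
  have "label_map \<tau> S (label_map \<sigma> T v) = v" for v
    by (simp add: label_map_def ST st)
  then have "C = label_map \<tau> S ` C'" unfolding *(3) image_image by simp
  moreover have "bij \<tau>" unfolding \<tau>_def by (rule bij_imp_bij_inv[OF *(1)])
  ultimately show ?thesis unfolding label_equiv_def using S by blast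
qed

text \<open>Between corresponding spaces \<open>g\<close> becomes an additive map \<open>S i\<close>
  in symplectic coordinates. Respecting the polarities, it preserves the vectors orthogonal to a
  given one, which over F_2 is preservation of \<open>sp1\<close>. The transpose \<open>A\<close> of
  \<open>g\<close> is the change of generators that matches the code words.\<close>

lemma proj_equiv_imp_label_equiv:
  fixes M :: "'r :: finite \<Rightarrow> ('q \<times> 'q) ^ 'n :: finite" and M' :: "'s :: finite \<Rightarrow> ('q \<times> 'q) ^ 'n"
  assumes inj: "\<And>i. inj (site_map M i)" and inj': "\<And>i. inj (site_map M' i)"
    and eq: "proj_equiv (polar_system M) (polar_system M')"
  shows "label_equiv (range (comb M)) (range (comb M'))"
proof -
  obtain g \<sigma> where g: "Vector_Spaces.linear (*s) (*s) g" "bij g" and \<sigma>: "bij \<sigma>"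
    and gs: "\<forall>i. fst (polar_system M' (\<sigma> i)) = g ` fst (polar_system M i) \<and>
             (\<forall>W. vec.subspace W \<and> W \<subseteq> fst (polar_system M i) \<longrightarrow>
                snd (polar_system M' (\<sigma> i)) (g ` W) = g ` snd (polar_system M i) W)"
    using eq unfolding proj_equiv_def by blast
  have g_add: "g (x + y) = g x + g y" for x y by (rule vec.linear_add[OF g(1)])
  have rg: "range (site_map M' (\<sigma> i)) = g ` range (site_map M i)" for i
    using gs unfolding polar_system_def fst_site_polar by blast
  have pg: "snd (site_polar (site_map M' (\<sigma> i))) (g ` W) = g ` snd (site_polar (site_map M i)) W"
    if "vec.subspace W" "W \<subseteq> range (site_map M i)" for i W
    using gs that unfolding polar_system_def fst_site_polar by blast
  have "\<exists>s. site_map M' (\<sigma> i) s = g (site_map M i w)" for i w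
    using rg[of i] by (metis rangeE rangeI image_eqI)
  then obtain S where S: "\<And>i w. site_map M' (\<sigma> i) (S i w) = g (site_map M i w)" by metis
  have S_add: "S i (x + y) = S i x + S i y" for i x y
    by (rule injD[OF inj'[of "\<sigma> i"]]) (simp add: S site_map_add g_add)
  have S_inj: "inj (S i)" for i
    by (rule injI) (metis S injD[OF inj] injD[OF bij_is_inj[OF g(2)]])
  have S_sp: "sp1 (S i x) (S i y) = sp1 x y" for i x y
  proof -
    have add: "add_closed {0, y}" "add_closed {0, S i y}" by (rule sp1.add_closed_single)+
    have gim: "g ` site_map M i ` A = site_map M' (\<sigma> i) ` S i ` A" for A
      by (simp add: image_image S)
    have S0: "S i 0 = 0" by (rule additive_zero[of "S i", OF S_add])
    have "site_map M' (\<sigma> i) ` S i ` perp sp1 {0, y} = g ` snd (site_polar (site_map M i)) (site_map M i ` {0, y})"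
      using snd_site_polar_image[of "site_map M i", OF site_map_add inj add(1)] by (simp only: gim)
    also have "\<dots> = snd (site_polar (site_map M' (\<sigma> i))) (g ` site_map M i ` {0, y})"
      by (rule pg[symmetric]) (intro subspace_additive_image site_map_add add, rule image_mono, simp)
    also have "g ` site_map M i ` {0, y} = site_map M' (\<sigma> i) ` {0, S i y}"
      unfolding gim by (simp add: S0)
    also have "snd (site_polar (site_map M' (\<sigma> i))) (site_map M' (\<sigma> i) ` {0, S i y}) = site_map M' (\<sigma> i) ` perp sp1 {0, S i y}"
      by (rule snd_site_polar_image[OF site_map_add inj' add(2)])
    finally have "S i ` perp sp1 {0, y} = perp sp1 {0, S i y}"
      by (simp only: inj_image_eq_iff[OF inj'])
    then have "S i x \<in> perp sp1 {0, S i y} \<longleftrightarrow> x \<in> perp sp1 {0, y}"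
      by (metis inj_image_mem_iff[OF S_inj])
    then have "sp1 (S i y) (S i x) = 0 \<longleftrightarrow> sp1 y x = 0" by (simp add: perp_def)
    then show ?thesis by (metis bit_eqI sp1.sym)
  qed
  have Ssymp: "site_symplectic (S i)" for i by (rule site_symplecticI[OF S_add S_sp])
  have "\<exists>m. \<forall>x. bdot u (g x) = bdot x m" for u
    using bdot.additive_functional_ex1[of "\<lambda>x. bdot u (g x)"] by (auto simp: g_add bdot.add_right)
  then obtain A where A: "\<And>u x. bdot u (g x) = bdot x (A u)" by metis
  have A_inj: "inj A"
  proof (rule injI, rule bdot.eqI)
    fix u v z assume eq: "A u = A v"
    obtain x where "z = g x" using bij_is_surj[OF g(2)] by (metis surjD)
    then show "bdot z u = bdot z v" using A[of u x] A[of v x] eq by (simp add: bdot.sym)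
  qed
  have "CARD(bit ^ 's) = CARD(bit ^ 'r)" using bij_betw_same_card[OF g(2)] by simp
  then have A_surj: "range A = UNIV"
    using A_inj by (intro card_subset_eq) (auto simp: card_image)
  \<comment> \<open>The two sides are compared by their products with an arbitrary
    \<open>z = S i w\<close>: products with code words are dot products with points, and
    \<open>g\<close> moves across a dot product as \<open>A\<close>.\<close>
  have key: "comb M' u $ \<sigma> i = S i (comb M (A u) $ i)" for u i
  proof (rule sp1.eqI)
    fix z
    obtain w where z: "z = S i w" using bij_is_surj[OF site_symplectic_bij[OF Ssymp]] by (metis surjD)
    have "sp1 z (comb M' u $ \<sigma> i) = bdot u (g (site_map M i w))"
      unfolding z S[symmetric] bdot_site_map ..
    also have "\<dots> = bdot (A u) (site_map M i w)" by (simp only: A bdot.sym)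
    also have "\<dots> = sp1 z (S i (comb M (A u) $ i))" unfolding z S_sp bdot_site_map ..
    finally show "sp1 z (comb M' u $ \<sigma> i) = sp1 z (S i (comb M (A u) $ i))" .
  qed
  define \<tau> where "\<tau> = inv_into UNIV \<sigma>"
  have st: "\<sigma> (\<tau> j) = j" for j unfolding \<tau>_def using \<sigma> by (simp add: bij_is_surj surj_f_inv_f)
  have "comb M' u = label_map \<tau> (\<lambda>j. S (\<tau> j)) (comb M (A u))" for u
    using key[of u "\<tau> _"] by (simp add: vec_eq_iff label_map_def st)
  then have "range (comb M') = label_map \<tau> (\<lambda>j. S (\<tau> j)) ` comb M ` range A"
    by (simp add: image_image)
  then show ?thesis
    unfolding A_surj using Ssymp bij_imp_bij_inv[OF \<sigma>] unfolding \<tau>_def[symmetric] by (intro label_equivI)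
qed

lemma label_map_add:
  assumes "\<And>j. site_symplectic (T j)"
  shows "label_map \<sigma> T (v + w :: ('q \<times> 'q) ^ 'n :: finite) = label_map \<sigma> T v + label_map \<sigma> T w"
  by (simp add: label_map_def vec_eq_iff site_symplecticD[OF assms])

lemma inj_label_map:
  assumes "bij \<sigma>" and "\<And>j. site_symplectic (T j)"
  shows "inj (label_map \<sigma> T :: ('q \<times> 'q) ^ 'n :: finite \<Rightarrow> _)"
proof (rule injI)
  fix v w :: "('q \<times> 'q) ^ 'n" assume eq: "label_map \<sigma> T v = label_map \<sigma> T w"
  have "v $ \<sigma> j = w $ \<sigma> j" for j
    using arg_cong[OF eq, of "\<lambda>v. v $ j"] bij_is_inj[OF site_symplectic_bij[OF assms(2)]]
    by (auto simp: label_map_def dest: injD)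
  then show "v = w" using bij_is_surj[OF assms(1)] by (metis vec_eq_iff surjD)
qed

text \<open>Comparing the coefficients of corresponding code words gives an additive bijection
  \<open>A\<close> between the coordinate spaces; its transpose \<open>g\<close> is the projective
  map. On the polar spaces \<open>g\<close> acts through the isometries \<open>T j\<close> and so
  carries polarities to polarities.\<close>

lemma label_equiv_imp_proj_equiv:
  fixes M :: "'r :: finite \<Rightarrow> ('q \<times> 'q) ^ 'n :: finite" and M' :: "'s :: finite \<Rightarrow> ('q \<times> 'q) ^ 'n"
  assumes inj: "\<And>i. inj (site_map M i)" and inj': "\<And>i. inj (site_map M' i)"
    and injc: "inj (comb M)" and injc': "inj (comb M')"
    and eq: "label_equiv (range (comb M)) (range (comb M'))"
  shows "proj_equiv (polar_system M) (polar_system M')"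
proof -
  obtain \<sigma> T where \<sigma>: "bij \<sigma>" and T: "\<And>j. site_symplectic (T j)"
    and C: "range (comb M') = label_map \<sigma> T ` range (comb M)"
    using eq unfolding label_equiv_def by blast
  have T_add: "T j (x + y) = T j x + T j y" and T_sp: "sp1 (T j x) (T j y) = sp1 x y" for j x y
    by (rule site_symplecticD[OF T])+
  have T_bij: "bij (T j)" for j by (rule site_symplectic_bij[OF T])
  have "\<exists>u. comb M' u' = label_map \<sigma> T (comb M u)" for u'
    using C by (metis (no_types, lifting) image_iff rangeI)
  then obtain A where A: "\<And>u. comb M' u = label_map \<sigma> T (comb M (A u))" by metis
  have A_add: "A (u + v) = A u + A v" for u v
  proof -
    have "label_map \<sigma> T (comb M (A (u + v))) = label_map \<sigma> T (comb M (A u + A v))"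
      by (simp only: A[symmetric] comb_add_label label_map_add[OF T])
    then show ?thesis by - (rule injD[OF injc], rule injD[OF inj_label_map[OF \<sigma> T]])
  qed
  have A_surj: "surj A"
  proof (rule surjI[of _ "\<lambda>u. SOME u'. comb M' u' = label_map \<sigma> T (comb M u)"])
    fix u
    have "\<exists>u'. comb M' u' = label_map \<sigma> T (comb M u)" using C by (metis (no_types, lifting) image_iff rangeI)
    then have "comb M' (SOME u'. comb M' u' = label_map \<sigma> T (comb M u)) = label_map \<sigma> T (comb M u)" by (rule someI_ex)
    then have "label_map \<sigma> T (comb M (A (SOME u'. comb M' u' = label_map \<sigma> T (comb M u)))) = label_map \<sigma> T (comb M u)"
      by (simp only: A)
    then show "A (SOME u'. comb M' u' = label_map \<sigma> T (comb M u)) = u"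
      by - (rule injD[OF injc], rule injD[OF inj_label_map[OF \<sigma> T]])
  qed
  have A_inj: "inj A" by (rule injI) (metis A injD[OF injc'])
  have "\<exists>m. \<forall>u. bdot (A u) x = bdot u m" for x
    using bdot.additive_functional_ex1[of "\<lambda>u. bdot (A u) x"] by (auto simp: A_add bdot.add_left)
  then obtain g where g: "\<And>u x. bdot (A u) x = bdot u (g x)" by metis
  have g_add: "g (x + y) = g x + g y" for x y
    by (rule bdot.eqI) (simp add: g[symmetric] bdot.add_right)
  have "g x = 0 \<Longrightarrow> x = 0" for x
  proof (rule bdot.nondeg)
    fix y assume "g x = 0"
    obtain u where "y = A u" using A_surj by (metis surjD)
    then show "bdot x y = 0" using g[of u x] \<open>g x = 0\<close> by (simp add: bdot.sym)
  qed
  then have g_inj: "inj g" by (simp add: additive_inj_iff g_add)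
  have "CARD(bit ^ 's) = CARD(bit ^ 'r)" using bij_betw_same_card[of A UNIV UNIV] A_inj A_surj by (simp add: bij_def)
  then have "range g = UNIV" using g_inj by (intro card_subset_eq) (auto simp: card_image)
  then have g_bij: "bij g" using g_inj by (simp add: bij_def)
  have g_lin: "Vector_Spaces.linear (*s) (*s) g"
  proof -
    have "g (c *s x) = c *s g x" for c x
      unfolding bit_smult_eq_scale[symmetric] by (rule additive_bit_smult[of g, OF g_add])
    then show ?thesis by (intro Vector_Spaces.linear.intro vec.vector_space_axioms module_hom.intro
      vec.module_axioms module_hom_axioms.intro g_add) 
  qed
  have key: "g (site_map M (\<sigma> j) w) = site_map M' j (T j w)" for j w
  proof (rule bdot.eqI)
    fix u
    have "bdot u (site_map M' j (T j w)) = sp1 (T j w) (T j (comb M (A u) $ \<sigma> j))"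
      by (simp add: bdot_site_map A label_map_def)
    also have "\<dots> = bdot (A u) (site_map M (\<sigma> j) w)" by (simp add: T_sp bdot_site_map)
    finally show "bdot u (g (site_map M (\<sigma> j) w)) = bdot u (site_map M' j (T j w))" by (simp add: g)
  qed
  have im: "g ` site_map M (\<sigma> j) ` B = site_map M' j ` T j ` B" for j B by (simp add: image_image key)
  define \<tau> where "\<tau> = inv_into UNIV \<sigma>"
  have st: "\<sigma> (\<tau> i) = i" for i unfolding \<tau>_def using \<sigma> by (simp add: bij_is_surj surj_f_inv_f)
  have "fst (polar_system M' (\<tau> i)) = g ` fst (polar_system M i)" for i
    using im[of "\<tau> i" UNIV] bij_is_surj[OF T_bij[of "\<tau> i"]] by (simp add: polar_system_def st)
  moreover have "snd (polar_system M' (\<tau> i)) (g ` W) = g ` snd (polar_system M i) W"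
    if W: "vec.subspace W" "W \<subseteq> fst (polar_system M i)" for i W
  proof -
    define B where "B = site_map M i -` W"
    have WB: "W = site_map M i ` B" using W(2) by (auto simp: B_def polar_system_def)
    have B: "add_closed B" using W(1) unfolding subspace_bit_iff by (simp add: B_def add_closed_def site_map_add)
    have TB: "add_closed (T (\<tau> i) ` B)" by (rule add_closed_image[OF B T_add])
    have "perp sp1 (T (\<tau> i) ` B) = T (\<tau> i) ` perp sp1 B"
    proof (intro subset_antisym subsetI)
      fix x assume x: "x \<in> perp sp1 (T (\<tau> i) ` B)"
      obtain y where "x = T (\<tau> i) y" using bij_is_surj[OF T_bij] by (metis surjD)
      then show "x \<in> T (\<tau> i) ` perp sp1 B" using x by (auto simp: perp_def T_sp)
    qed (auto simp: perp_def T_sp)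
    then have "snd (polar_system M' (\<tau> i)) (site_map M' (\<tau> i) ` T (\<tau> i) ` B) = site_map M' (\<tau> i) ` T (\<tau> i) ` perp sp1 B"
      using snd_site_polar_image[OF site_map_add inj' TB] by (simp add: polar_system_def)
    moreover have "snd (polar_system M i) W = site_map M i ` perp sp1 B"
      unfolding WB polar_system_def by (rule snd_site_polar_image[OF site_map_add inj B])
    ultimately show ?thesis using im[of "\<tau> i"] by (simp add: WB st)
  qed
  ultimately show ?thesis
    unfolding proj_equiv_def using g_lin g_bij bij_imp_bij_inv[OF \<sigma>] unfolding \<tau>_def[symmetric] by blast
qed

end

section \<open>Operations on codes and their effect on labels\<close>

lemma adj_add: "adj (A + B) = adj A + adj B"
  by (simp add: adj_def vec_eq_iff)

lemma scale_op_add: "scale_op c (A + B) = scale_op c A + scale_op c B"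
  by (simp add: scale_op_def vec_eq_iff distrib_left)

lemma permute_op_mult:
  fixes E F :: "('q :: finite, 'n :: finite) op"
  assumes \<sigma>: "bij \<sigma>"
  shows "permute_op \<sigma> (E ** F) = permute_op \<sigma> E ** permute_op \<sigma> F"
proof -
  define \<tau> where "\<tau> = inv_into UNIV \<sigma>"
  have st: "\<sigma> (\<tau> i) = i" "\<tau> (\<sigma> i) = i" for i
    unfolding \<tau>_def using \<sigma> by (simp_all add: bij_is_surj surj_f_inv_f bij_is_inj)
  have "(\<Sum>z\<in>UNIV. E $ y $ z * F $ z $ x) = (\<Sum>z\<in>UNIV. E $ y $ (\<chi> j. z $ \<sigma> j) * F $ (\<chi> j. z $ \<sigma> j) $ x)" for x y
    by (rule sum.reindex_bij_witness[of _ "\<lambda>z. \<chi> j. z $ \<sigma> j" "\<lambda>z. \<chi> j. z $ \<tau> j"]) (simp_all add: st vec_eq_iff)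
  then show ?thesis by (simp add: vec_eq_iff permute_op_def matrix_matrix_mult_def)
qed

definition transvection :: "'q :: {field, finite} \<times> 'q \<Rightarrow> 'q \<times> 'q \<Rightarrow> 'q \<times> 'q" where
  "transvection t w = w + bit_smult (sp1 w t) t"

inductive transvection_product :: "('q :: {field, finite} \<times> 'q \<Rightarrow> 'q \<times> 'q) \<Rightarrow> bool" where
  id: "transvection_product id"
| step: "transvection_product T \<Longrightarrow> transvection_product (transvection t \<circ> T)"

lemma transvection_product_comp:
  "transvection_product S \<Longrightarrow> transvection_product T \<Longrightarrow> transvection_product (S \<circ> T)"
  by (induction S rule: transvection_product.induct) (auto simp: comp_assoc intro: transvection_product.intros)

lemma transvection_product_single: "transvection_product (transvection t)"
  using transvection_product.step[OF transvection_product.id, of t] by simp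

text \<open>Realisable by operations on codes up to phases: only the labels of the resulting group
  are prescribed. Quantification over all \<open>S\<close> makes the property closed under
  composition.\<close>

definition reachable :: "(('q :: {field, finite} \<times> 'q) ^ 'n :: finite \<Rightarrow> ('q \<times> 'q) ^ 'n) \<Rightarrow> bool" where
  "reachable L \<longleftrightarrow> (\<forall>S. stab_group S \<longrightarrow> (\<exists>S'. code_step\<^sup>*\<^sup>* S S' \<and> stab_group S' \<and> label ` S' = L ` label ` S))"

lemma reachable_id: "reachable (\<lambda>v. v)"
  unfolding reachable_def by auto

lemma reachable_comp:
  assumes L: "reachable L" and L': "reachable L'" shows "reachable (\<lambda>v. L' (L v))"
  unfolding reachable_def
proof (intro allI impI)
  fix S :: "('a, 'b) op set" assume "stab_group S"
  then obtain S1 where 1: "code_step\<^sup>*\<^sup>* S S1" "stab_group S1" "label ` S1 = L ` label ` S"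
    using L unfolding reachable_def by blast
  then obtain S2 where 2: "code_step\<^sup>*\<^sup>* S1 S2" "stab_group S2" "label ` S2 = L' ` label ` S1"
    using L' unfolding reachable_def by blast
  have "label ` S2 = (\<lambda>v. L' (L v)) ` label ` S" using 1(3) 2(3) by (simp add: image_image)
  then show "\<exists>S'. code_step\<^sup>*\<^sup>* S S' \<and> stab_group S' \<and> label ` S' = (\<lambda>v. L' (L v)) ` label ` S"
    using rtranclp_trans[OF 1(1) 2(1)] 2(2) by blast
qed

context trace_basis
begin

lemma stab_groupE:
  assumes "stab_group (S :: ('q, 'n :: finite) op set)" "E \<in> S"
  obtains c where "c \<in> phases" "E = pauli c (label E)"
  using pauliE[of E] stab_groupD(1)[OF assms(1)] assms(2) by blast

text \<open>Serves all three kinds of operation, each multiplicative on \<open>S\<close> and acting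
  on labels. A scalar in the image has label 0, so it comes from an element with label 0, which is
  the identity.\<close>

lemma stab_group_image:
  fixes S :: "('q, 'n :: finite) op set" and f :: "('q, 'n) op \<Rightarrow> ('q, 'n) op"
  assumes S: "stab_group S" and one: "f (mat 1) = mat 1"
    and mult: "\<And>E F. E \<in> S \<Longrightarrow> F \<in> S \<Longrightarrow> f (E ** F) = f E ** f F"
    and P: "\<And>E. E \<in> S \<Longrightarrow> f E \<in> paulis" and lab: "\<And>E. E \<in> S \<Longrightarrow> label (f E) = L (label E)"
    and L0: "\<And>v. L v = 0 \<Longrightarrow> v = 0"
  shows "stab_group (f ` S)" "label ` f ` S = L ` label ` S"
proof -
  show "label ` f ` S = L ` label ` S" using lab by (auto simp: image_iff)
  show "stab_group (f ` S)"
    unfolding stab_group_def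
  proof (intro conjI ballI allI impI)
    show "f ` S \<subseteq> paulis" using P by auto
    show "mat 1 \<in> f ` S" using one stab_groupD(2)[OF S] by (metis image_eqI)
    fix E F assume "E \<in> f ` S" "F \<in> f ` S"
    then obtain E' F' where EF: "E' \<in> S" "F' \<in> S" "E = f E'" "F = f F'" by auto
    then have "E ** F = f (E' ** F')" by (simp add: mult)
    then show "E ** F \<in> f ` S" using stab_groupD(3)[OF S EF(1,2)] by blast
  next
    fix c assume "pauli c 0 \<in> f ` S"
    then obtain E where E: "E \<in> S" "f E = pauli c 0" by auto
    obtain d where d: "d \<in> phases" "f E = pauli d (label (f E))" using pauliE[OF P[OF E(1)]] by blast
    have "label (f E) = 0" using d(2) pauli_inject[OF phases_nonzero[OF d(1)], of "label (f E)" c 0] by (simp add: E(2))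
    then have "label E = 0" using L0 lab[OF E(1)] by metis
    then have "label E = label (mat 1 :: ('q, 'n) op)" by simp
    then have "E = mat 1" using inj_onD[OF stab_group_label_inj[OF S]] E(1) stab_groupD(2)[OF S] by blast
    then have "pauli c 0 = pauli 1 (0 :: ('q \<times> 'q) ^ 'n)" using E(2) one by (simp add: pauli_one)
    then show "c = 1" using pauli_inject[of 1 "0 :: ('q \<times> 'q) ^ 'n" c 0] by auto
  qed
qed

text \<open>Basis states are reindexed by \<open>\<sigma>\<close>, and labels consequently by its
  inverse.\<close>

lemma permute_pauli:
  fixes v :: "('q \<times> 'q) ^ 'n :: finite"
  assumes \<sigma>: "bij \<sigma>"
  shows "permute_op \<sigma> (pauli c v) = pauli c (\<chi> j. v $ inv_into UNIV \<sigma> j)"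
proof -
  define \<tau> where "\<tau> = inv_into UNIV \<sigma>"
  have st: "\<sigma> (\<tau> i) = i" "\<tau> (\<sigma> i) = i" for i
    unfolding \<tau>_def using \<sigma> by (simp_all add: bij_is_surj surj_f_inv_f bij_is_inj)
  have "permute_op \<sigma> (pauli c v) $ y $ x = pauli c (\<chi> j. v $ \<tau> j) $ y $ x" for y x
  proof -
    have "(\<Sum>j\<in>UNIV. tr (snd (v $ j) * x $ \<sigma> j)) = (\<Sum>i\<in>UNIV. tr (snd (v $ \<tau> i) * x $ i))"
      using sum.reindex_bij_betw[OF \<sigma>, of "\<lambda>i. tr (snd (v $ \<tau> i) * x $ i)"] by (simp add: st)
    moreover have "(\<forall>j. y $ \<sigma> j = x $ \<sigma> j + fst (v $ j)) \<longleftrightarrow> (\<forall>i. y $ i = x $ i + fst (v $ \<tau> i))"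
      by (metis st)
    ultimately show ?thesis by (simp add: permute_op_def pauli_entry)
  qed
  then show ?thesis unfolding \<tau>_def[symmetric] by (simp add: vec_eq_iff)
qed

lemma permutation_step:
  assumes S: "stab_group (S :: ('q, 'n :: finite) op set)" and \<sigma>: "bij \<sigma>"
  shows "stab_group (permute_op \<sigma> ` S)" "label ` permute_op \<sigma> ` S = label_map (inv_into UNIV \<sigma>) (\<lambda>_. id) ` label ` S"
proof -
  have one: "permute_op \<sigma> (mat 1 :: ('q, 'n) op) = mat 1"
    unfolding pauli_one by (simp add: permute_pauli[OF \<sigma>]) (simp add: vec_eq_iff zero_vec_def)
  have f: "permute_op \<sigma> E \<in> paulis \<and> label (permute_op \<sigma> E) = label_map (inv_into UNIV \<sigma>) (\<lambda>_. id) (label E)" if E: "E \<in> S" for E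
  proof -
    obtain c where c: "c \<in> phases" "E = pauli c (label E)" using stab_groupE[OF S E] by blast
    have "permute_op \<sigma> (pauli c (label E)) = pauli c (label_map (inv_into UNIV \<sigma>) (\<lambda>_. id) (label E))"
      by (simp add: permute_pauli[OF \<sigma>] label_map_def)
    then have "permute_op \<sigma> E = pauli c (label_map (inv_into UNIV \<sigma>) (\<lambda>_. id) (label E))" unfolding c(2)[symmetric] .
    then show ?thesis using c(1) by (simp add: pauli_mem)
  qed
  have inj: "inj (label_map (inv_into UNIV \<sigma>) (\<lambda>_. id) :: ('q \<times> 'q) ^ 'n \<Rightarrow> _)"
    by (rule inj_label_map) (auto simp: \<sigma> bij_imp_bij_inv site_symplectic_id)
  have 0: "v = 0" if "label_map (inv_into UNIV \<sigma>) (\<lambda>_. id) v = (0 :: ('q \<times> 'q) ^ 'n)" for v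
    by (rule injD[OF inj]) (simp only: that, simp add: label_map_def vec_eq_iff)
  have "stab_group (permute_op \<sigma> ` S) \<and> label ` permute_op \<sigma> ` S = label_map (inv_into UNIV \<sigma>) (\<lambda>_. id) ` label ` S"
    using stab_group_image[where f = "permute_op \<sigma>" and L = "label_map (inv_into UNIV \<sigma>) (\<lambda>_. id)",
        OF S one permute_op_mult[OF \<sigma>]] f 0 by blast
  then show "stab_group (permute_op \<sigma> ` S)" "label ` permute_op \<sigma> ` S = label_map (inv_into UNIV \<sigma>) (\<lambda>_. id) ` label ` S"
    by blast+
qed

lemma tensor_mat_1: "tensor_op (\<lambda>j. mat 1) = (mat 1 :: ('q, 'n :: finite) op)"
  using tensor_site_pauli[of "\<lambda>_. 1" "0 :: ('q \<times> 'q) ^ 'n"] by (simp add: site_pauli_one pauli_one)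

lemma clifford_step:
  assumes S: "stab_group (S :: ('q, 'n :: finite) op set)" and U: "local_clifford U"
    and UT: "\<And>j w. \<exists>c\<in>phases. U j ** site_pauli 1 w ** adj (U j) = site_pauli c (T j w)"
    and T: "\<And>j. site_symplectic (T j)"
  shows "stab_group ((\<lambda>E. tensor_op U ** E ** adj (tensor_op U)) ` S)"
    "label ` (\<lambda>E. tensor_op U ** E ** adj (tensor_op U)) ` S = label_map id T ` label ` S"
proof -
  let ?f = "\<lambda>E. tensor_op U ** E ** adj (tensor_op U) :: ('q, 'n) op"
  have un: "adj (tensor_op U) ** tensor_op U = (mat 1 :: ('q, 'n) op)" "tensor_op U ** adj (tensor_op U) = (mat 1 :: ('q, 'n) op)"
    using U by (simp_all add: adj_tensor_op tensor_op_mult local_clifford_def tensor_mat_1)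
  have one: "?f (mat 1) = mat 1" by (simp add: un)
  have mult: "?f (E ** F) = ?f E ** ?f F" for E F
  proof -
    have "?f E ** ?f F = tensor_op U ** E ** (adj (tensor_op U) ** tensor_op U) ** F ** adj (tensor_op U)"
      by (simp only: matrix_mul_assoc)
    then show ?thesis by (simp add: un matrix_mul_assoc)
  qed
  have f: "?f E \<in> paulis \<and> label (?f E) = label_map id T (label E)" if E: "E \<in> S" for E
  proof -
    obtain c where c: "c \<in> phases" "E = pauli c (label E)" using stab_groupE[OF S E] by blast
    have "\<forall>j. \<exists>d. d \<in> phases \<and> U j ** site_pauli 1 (label E $ j) ** adj (U j) = site_pauli d (T j (label E $ j))"
      using UT by blast
    from choice[OF this] obtain d where d: "\<And>j. d j \<in> phases"
      "\<And>j. U j ** site_pauli 1 (label E $ j) ** adj (U j) = site_pauli (d j) (T j (label E $ j))"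
      by blast
    have "?f (pauli c (label E)) = scale_op c (tensor_op (\<lambda>j. site_pauli (d j) (label_map id T (label E) $ j)))"
      by (simp add: pauli_eq_tensor adj_tensor_op scale_op_mult_left scale_op_mult_right tensor_op_mult d(2) label_map_def)
    also have "\<dots> = pauli (c * (\<Prod>j\<in>UNIV. d j)) (label_map id T (label E))"
      unfolding tensor_site_pauli by simp
    finally have "?f E = pauli (c * (\<Prod>j\<in>UNIV. d j)) (label_map id T (label E))" unfolding c(2)[symmetric] .
    moreover have "c * (\<Prod>j\<in>UNIV. d j) \<in> phases" by (intro phases_closed phases_prod c(1) d(1))
    ultimately show ?thesis by (simp add: pauli_mem)
  qed
  have 0: "v = 0" if "label_map id T v = (0 :: ('q \<times> 'q) ^ 'n)" for v
  proof (rule injD[OF inj_label_map[OF bij_id T]])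
    have "T j 0 = 0" for j by (rule additive_zero[of "T j", OF site_symplecticD(1)[OF T]])
    then show "label_map id T v = label_map id T 0" unfolding that by (simp add: label_map_def vec_eq_iff)
  qed
  have "stab_group (?f ` S) \<and> label ` ?f ` S = label_map id T ` label ` S"
    using stab_group_image[where f = ?f and L = "label_map id T", OF S one mult] f 0 by blast
  then show "stab_group (?f ` S)" "label ` ?f ` S = label_map id T ` label ` S" by blast+
qed

lemma site_pauli_commute:
  "site_pauli c v ** site_pauli d (w :: 'q \<times> 'q) = scale_op (bit_sign (sp1 v w)) (site_pauli d w ** site_pauli c v)"
proof -
  have "bit_sign (tr (snd v * fst w)) = (bit_sign (sp1 v w) * bit_sign (tr (snd w * fst v)) :: complex)"
    by (simp add: sp1_def tr_add bit_sign_add mult.commute)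
  then show ?thesis by (simp add: site_pauli_mult mult_ac add.commute)
qed

lemma site_scale_cancel:
  assumes "A = site_pauli c (w :: 'q \<times> 'q)" "c \<in> phases" "scale_op (bit_sign a) A = scale_op (bit_sign b) A"
  shows "a = b"
proof -
  have "bit_sign a * c \<noteq> 0" using phases_nonzero[OF assms(2)] by (cases a) auto
  then have "bit_sign a * c = bit_sign b * c"
    using assms(1,3) site_pauli_inject[of "bit_sign a * c" w "bit_sign b * c" w] by simp
  then show ?thesis using phases_nonzero[OF assms(2)] by (simp add: bit_sign_eq_iff)
qed

text \<open>Conjugation is multiplicative, so products of Pauli operators give additivity of
  \<open>T j\<close>; commutation signs, which phases do not affect, give preservation of
  \<open>sp1\<close>.\<close>

lemma local_clifford_symplectic:
  assumes U: "local_clifford (U :: 'n :: finite \<Rightarrow> 'q site_op)"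
  shows "\<exists>T. (\<forall>j. site_symplectic (T j)) \<and> (\<forall>j w. \<exists>c\<in>phases. U j ** site_pauli 1 w ** adj (U j) = site_pauli c (T j w))"
proof -
  have un: "adj (U j) ** U j = mat 1" and im: "(\<lambda>A. U j ** A ** adj (U j)) ` paulis1 = paulis1" for j
    using U by (auto simp: local_clifford_def)
  have "\<exists>c w'. c \<in> phases \<and> U j ** site_pauli 1 w ** adj (U j) = site_pauli c w'" for j w
  proof -
    have "site_pauli 1 w \<in> paulis1" unfolding paulis1_eq using one_in_phases by blast
    then have "U j ** site_pauli 1 w ** adj (U j) \<in> paulis1" using im[of j] by blast
    then show ?thesis unfolding paulis1_eq by blast
  qed
  then obtain c T where cT: "\<And>j w. c j w \<in> phases" "\<And>j w. U j ** site_pauli 1 w ** adj (U j) = site_pauli (c j w) (T j w)"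
    by metis
  have mult: "U j ** (A ** B) ** adj (U j) = (U j ** A ** adj (U j)) ** (U j ** B ** adj (U j))" for j A B
  proof -
    have "(U j ** A ** adj (U j)) ** (U j ** B ** adj (U j)) = U j ** A ** (adj (U j) ** U j) ** B ** adj (U j)"
      by (simp only: matrix_mul_assoc)
    then show ?thesis by (simp add: un matrix_mul_assoc)
  qed
  have scale: "U j ** scale_op d A ** adj (U j) = scale_op d (U j ** A ** adj (U j))" for j d A
    by (simp add: scale_op_mult_left scale_op_mult_right)
  have "T j (v + w) = T j v + T j w" for j v w
  proof -
    have eq: "site_pauli 1 v ** site_pauli 1 w = scale_op (bit_sign (tr (snd v * fst w))) (site_pauli 1 (v + w))"
      by (simp add: site_pauli_mult)
    have "site_pauli (c j v) (T j v) ** site_pauli (c j w) (T j w) = U j ** (site_pauli 1 v ** site_pauli 1 w) ** adj (U j)"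
      by (simp only: mult cT(2))
    also have "\<dots> = scale_op (bit_sign (tr (snd v * fst w))) (U j ** site_pauli 1 (v + w) ** adj (U j))"
      by (simp only: eq scale)
    also have "\<dots> = site_pauli (bit_sign (tr (snd v * fst w)) * c j (v + w)) (T j (v + w))"
      by (simp only: cT(2) scale_op_site_pauli)
    finally have "site_pauli (c j v) (T j v) ** site_pauli (c j w) (T j w) =
        site_pauli (bit_sign (tr (snd v * fst w)) * c j (v + w)) (T j (v + w))" .
    moreover have "bit_sign (tr (snd v * fst w)) * c j (v + w) \<noteq> 0"
      by (rule phases_nonzero[OF phases_closed[OF phases_bit_sign cT(1)]])
    ultimately show ?thesis unfolding site_pauli_mult by (metis site_pauli_inject)
  qed
  moreover have "sp1 (T j v) (T j w) = sp1 v w" for j v w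
  proof (rule site_scale_cancel)
    let ?v = "site_pauli (c j v) (T j v)" and ?w = "site_pauli (c j w) (T j w)"
    show "?w ** ?v = site_pauli (c j w * c j v * bit_sign (tr (snd (T j w) * fst (T j v)))) (T j w + T j v)"
      by (rule site_pauli_mult)
    show "c j w * c j v * bit_sign (tr (snd (T j w) * fst (T j v))) \<in> phases"
      by (intro phases_closed cT(1) phases_bit_sign)
    have "?v ** ?w = scale_op (bit_sign (sp1 v w)) (?w ** ?v)"
      using mult[of j "site_pauli 1 v" "site_pauli 1 w"] mult[of j "site_pauli 1 w" "site_pauli 1 v"]
      unfolding site_pauli_commute[of 1 v 1 w] scale cT(2) by simp
    then show "scale_op (bit_sign (sp1 (T j v) (T j w))) (?w ** ?v) = scale_op (bit_sign (sp1 v w)) (?w ** ?v)"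
      using site_pauli_commute[of "c j v" "T j v" "c j w" "T j w"] by simp
  qed
  ultimately have "site_symplectic (T j)" for j by (rule site_symplecticI)
  then show ?thesis using cT by blast
qed

lemma sign_step:
  fixes S :: "('q, 'n :: finite) op set"
  assumes S: "stab_group S" and s: "\<And>E. E \<in> S \<Longrightarrow> s E \<in> {1, - 1}"
    and mult: "\<And>E F. E \<in> S \<Longrightarrow> F \<in> S \<Longrightarrow> s (E ** F) = s E * s F"
  shows "stab_group ((\<lambda>E. scale_op (s E) E) ` S)" "label ` (\<lambda>E. scale_op (s E) E) ` S = label ` S"
proof -
  let ?f = "\<lambda>E. scale_op (s E) E"
  have "s (mat 1) = s (mat 1) * s (mat 1)" using mult[of "mat 1" "mat 1"] stab_groupD(2)[OF S] by simp
  then have one: "?f (mat 1) = mat 1" using s[OF stab_groupD(2)[OF S]] by auto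
  have m: "?f (E ** F) = ?f E ** ?f F" if "E \<in> S" "F \<in> S" for E F
    using mult[OF that] by (simp add: scale_op_mult_left scale_op_mult_right mult.commute)
  have f: "?f E \<in> paulis \<and> label (?f E) = label E" if E: "E \<in> S" for E
  proof -
    obtain c where c: "c \<in> phases" "E = pauli c (label E)" using stab_groupE[OF S E] by blast
    have "scale_op (s E) (pauli c (label E)) = pauli (s E * c) (label E)" by simp
    then have "?f E = pauli (s E * c) (label E)" unfolding c(2)[symmetric] .
    moreover have "s E * c \<in> phases" using s[OF E] c(1) by (auto intro!: phases_closed simp: phases_def)
    ultimately show ?thesis by (simp add: pauli_mem)
  qed
  have "stab_group (?f ` S) \<and> label ` ?f ` S = (\<lambda>v. v) ` label ` S"
    using stab_group_image[where f = ?f and L = "\<lambda>v. v", OF S one m] f by blast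
  then show "stab_group (?f ` S)" "label ` ?f ` S = label ` S" by auto
qed

lemma code_step_label_equiv:
  assumes "code_step (S :: ('q, 'n :: finite) op set) S'" and S: "stab_group S"
  shows "stab_group S' \<and> label_equiv (label ` S) (label ` S')"
  using assms(1)
proof cases
  case (permutation \<sigma>)
  have "label_equiv (label ` S) (label ` permute_op \<sigma> ` S)"
    by (rule label_equivI[OF bij_imp_bij_inv[OF permutation(2)] site_symplectic_id permutation_step(2)[OF S permutation(2)]])
  then show ?thesis using permutation_step(1)[OF S permutation(2)] permutation(1) by simp
next
  case (sign_change s)
  then show ?thesis using sign_step[OF S sign_change(2,3)] by (simp add: label_equiv_refl)
next
  case (clifford U)
  obtain T where T: "\<And>j. site_symplectic (T j)"
    "\<And>j w. \<exists>c\<in>phases. U j ** site_pauli 1 w ** adj (U j) = site_pauli c (T j w)"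
    using local_clifford_symplectic[OF clifford(2)] by blast
  note c = clifford_step[where T = T, OF S clifford(2) T(2) T(1)]
  show ?thesis
    unfolding clifford(1) using c(1) label_equivI[OF bij_id T(1) c(2)] by simp
qed

lemma code_steps_label_equiv:
  assumes "code_step\<^sup>*\<^sup>* (S :: ('q, 'n :: finite) op set) S'" and S: "stab_group S"
  shows "stab_group S' \<and> label_equiv (label ` S) (label ` S')"
  using assms(1)
proof (induction rule: rtranclp_induct)
  case base
  then show ?case using S by (simp add: label_equiv_refl)
next
  case (step S1 S2)
  then show ?case using code_step_label_equiv label_equiv_trans by blast
qed

text \<open>The lifts of a label to \<open>S\<close> and to \<open>S'\<close> are both involutions,
  so their phases have the same square and agree up to sign. The sign is multiplicative because an
  element of \<open>S'\<close> is determined by its label.\<close>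

lemma equal_labels_code_step:
  assumes S: "stab_group (S :: ('q, 'n :: finite) op set)" and S': "stab_group S'" and eq: "label ` S = label ` S'"
  shows "code_step S S'"
proof -
  define s where "s E = (if E \<in> S' then 1 else - 1 :: complex)" for E :: "('q, 'n) op"
  have sS': "scale_op (s E) E \<in> S'" if E: "E \<in> S" for E
  proof (cases "E \<in> S'")
    case False
    obtain F where F: "F \<in> S'" "label F = label E" using eq E by (metis imageE imageI)
    obtain c where c: "c \<in> phases" "E = pauli c (label E)" using stab_groupE[OF S E] by blast
    obtain d where d: "d \<in> phases" "F = pauli d (label E)" using stab_groupE[OF S' F(1)] F(2) by metis
    let ?x = "bit_sign (xz (label E) (label E)) :: complex"
    have "pauli (c * c * ?x) (label E + label E) = pauli 1 0"
      using stab_group_square[OF S E] unfolding pauli_mult[symmetric] c(2)[symmetric] pauli_one .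
    then have "c * c * ?x = 1" by (metis pauli_inject zero_neq_one)
    moreover have "pauli (d * d * ?x) (label E + label E) = pauli 1 0"
      using stab_group_square[OF S' F(1)] unfolding pauli_mult[symmetric] d(2)[symmetric] pauli_one .
    then have "d * d * ?x = 1" by (metis pauli_inject zero_neq_one)
    ultimately have "c * c * ?x = d * d * ?x" by simp
    then have "c * c = d * d" by (cases "xz (label E) (label E)") simp_all
    then have "(c - d) * (c + d) = 0" by (simp add: algebra_simps)
    moreover have "c \<noteq> d" using False F(1) c(2) d(2) by metis
    ultimately have "d = - c" by (simp add: add_eq_0_iff)
    then have "F = scale_op (- 1) (pauli c (label E))" using d(2) by simp
    then have "F = scale_op (- 1) E" unfolding c(2)[symmetric] .
    then show ?thesis using F(1) False by (simp add: s_def)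
  qed (simp add: s_def)
  have s1: "s E \<in> {1, - 1}" for E by (simp add: s_def)
  have lab: "label (scale_op (s E) E) = label E" if E: "E \<in> S" for E
  proof -
    obtain c where c: "c \<in> phases" "E = pauli c (label E)" using stab_groupE[OF S E] by blast
    have "s E * c \<in> phases" using s1[of E] c(1) by (auto intro!: phases_closed simp: phases_def)
    then have "label (scale_op (s E) (pauli c (label E))) = label E" by simp
    then show ?thesis unfolding c(2)[symmetric] .
  qed
  have mult: "s (E ** F) = s E * s F" if E: "E \<in> S" and F: "F \<in> S" for E F
  proof -
    have EF: "E ** F \<in> S" by (rule stab_groupD(3)[OF S E F])
    have "scale_op (s E) E ** scale_op (s F) F \<in> S'" by (rule stab_groupD(3)[OF S' sS'[OF E] sS'[OF F]])
    then have 1: "scale_op (s E * s F) (E ** F) \<in> S'" by (simp add: scale_op_mult_left scale_op_mult_right mult.commute)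
    obtain c where c: "c \<in> phases" "E ** F = pauli c (label (E ** F))" using stab_groupE[OF S EF] by blast
    have ph: "s E * s F * c \<in> phases" "s (E ** F) * c \<in> phases"
      using s1[of E] s1[of F] s1[of "E ** F"] c(1) by (auto intro!: phases_closed simp: phases_def)
    have eqs: "scale_op (s E * s F) (E ** F) = pauli (s E * s F * c) (label (E ** F))"
      "scale_op (s (E ** F)) (E ** F) = pauli (s (E ** F) * c) (label (E ** F))"
      using scale_op_pauli[of _ c "label (E ** F)"] unfolding c(2)[symmetric] by simp_all
    have "label (scale_op (s E * s F) (E ** F)) = label (scale_op (s (E ** F)) (E ** F))"
      unfolding eqs using ph by simp
    then have "scale_op (s E * s F) (E ** F) = scale_op (s (E ** F)) (E ** F)"
      using inj_onD[OF stab_group_label_inj[OF S']] 1 sS'[OF EF] by blast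
    then have "s E * s F * c = s (E ** F) * c"
      unfolding eqs using pauli_inject[OF phases_nonzero[OF ph(1)]] by blast
    then show ?thesis using phases_nonzero[OF c(1)] by simp
  qed
  have "S' = (\<lambda>E. scale_op (s E) E) ` S"
  proof (intro subset_antisym subsetI)
    fix F assume F: "F \<in> S'"
    then obtain E where E: "E \<in> S" "label E = label F" using eq by (metis imageE imageI)
    have "scale_op (s E) E = F" using inj_onD[OF stab_group_label_inj[OF S']] sS'[OF E(1)] F lab[OF E(1)] E(2) by metis
    then show "F \<in> (\<lambda>E. scale_op (s E) E) ` S" using E(1) by blast
  qed (use sS' in auto)
  then show ?thesis using code_step.sign_change[of S s, OF s1 mult] by simp
qed

end

section \<open>Symplectic maps as products of transvections, and their unitaries\<close>

lemma matrix_add_rdistrib: "(B + C) ** A = B ** A + C ** A"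
  by (simp add: matrix_matrix_mult_def vec_eq_iff distrib_right sum.distrib)

context trace_basis
begin

lemma site_symplectic_transvection: "site_symplectic (transvection (t :: 'q \<times> 'q))"
proof (rule site_symplecticI)
  fix x y :: "'q \<times> 'q"
  show "transvection t (x + y) = transvection t x + transvection t y"
    by (simp add: transvection_def sp1.add_left bit_smult_add_left sp1.add_self)
  show "sp1 (transvection t x) (transvection t y) = sp1 x y"
    by (cases "sp1 x t"; cases "sp1 y t")
       (simp_all add: transvection_def sp1.add_left sp1.add_right sp1.sym[of t])
qed

lemma transvection_product_symplectic:
  "transvection_product T \<Longrightarrow> site_symplectic (T :: 'q \<times> 'q \<Rightarrow> 'q \<times> 'q)"
proof (induction T rule: transvection_product.induct)
  case id
  show ?case by (rule site_symplectic_id)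
next
  case (step T t)
  show ?case by (rule site_symplectic_comp[OF site_symplectic_transvection step.IH])
qed

lemma transvection_fixes: "sp1 k t = 0 \<Longrightarrow> transvection t k = k"
  by (simp add: transvection_def)

lemma transvection_maps: "sp1 y x = 1 \<Longrightarrow> transvection (y + x) y = (x :: 'q \<times> 'q)"
  by (simp add: transvection_def sp1.add_right add.assoc[symmetric] sp1.add_self)

text \<open>Two vectors with product 1 are exchanged by the transvection along their sum. Otherwise
  the way leads through some \<open>w\<close> that has product 1 with both; one of
  \<open>p'\<close>, \<open>p\<close> and \<open>p + p'\<close> qualifies. All these vectors are
  orthogonal to \<open>K\<close>, so \<open>K\<close> stays fixed.\<close>

lemma move_vector:
  assumes "sp1 y p = 1" "sp1 x' p' = 1" "{y, p, x', p'} \<subseteq> perp sp1 K"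
  shows "\<exists>A. transvection_product A \<and> (\<forall>k\<in>K. A k = k) \<and> A y = (x' :: 'q \<times> 'q)"
proof -
  have direct: "transvection_product (transvection (a + b)) \<and> (\<forall>k\<in>K. transvection (a + b) k = k) \<and> transvection (a + b) a = b"
    if "sp1 a b = 1" "a \<in> perp sp1 K" "b \<in> perp sp1 K" for a b
    using that by (auto simp: transvection_product_single transvection_maps perp_def sp1.add_right intro!: transvection_fixes)
  show ?thesis
  proof (cases "sp1 y x' = 1")
    case True
    then show ?thesis using direct[of y x'] assms(3) by blast
  next
    case 0: False
    show ?thesis
    proof (cases "y = x'")
      case True
      then show ?thesis by (intro exI[of _ id]) (simp add: transvection_product.id)
    next
      case False
      have "\<exists>w. w \<in> perp sp1 K \<and> sp1 y w = 1 \<and> sp1 w x' = 1"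
      proof (cases "sp1 y p' = 1")
        case True
        then show ?thesis using assms by (intro exI[of _ p']) (auto simp: sp1.sym[of p'])
      next
        case a: False
        show ?thesis
        proof (cases "sp1 x' p = 1")
          case True
          then show ?thesis using assms by (intro exI[of _ p]) (auto simp: sp1.sym[of p])
        next
          case b: False
          have "p + p' \<in> perp sp1 K" using assms(3) sp1.add_closed_perp[of K] unfolding add_closed_def by blast
          moreover have "sp1 y (p + p') = 1" using a assms by (simp add: sp1.add_right)
          moreover have "sp1 (p + p') x' = 1" using b assms by (simp add: sp1.add_left sp1.sym[of p] sp1.sym[of p'])
          ultimately show ?thesis by blast
        qed
      qed
      then obtain w where w: "w \<in> perp sp1 K" "sp1 y w = 1" "sp1 w x' = 1" by blast
      show ?thesis
        using direct[of y w] direct[of w x'] w assms(3)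
        by (intro exI[of _ "transvection (w + x') \<circ> transvection (y + w)"])
           (auto intro: transvection_product_comp)
    qed
  qed
qed

text \<open>\<open>z + z'\<close> is orthogonal to \<open>x\<close>, so the transvection along it
  fixes \<open>x\<close>. If \<open>z\<close> and \<open>z'\<close> have product 0, the transvection
  along \<open>x\<close> first replaces \<open>z\<close> by \<open>z + x\<close>, whose product with
  \<open>z'\<close> is 1.\<close>

lemma move_partner:
  assumes "sp1 x z = 1" "sp1 x z' = 1" "{x, z, z'} \<subseteq> perp sp1 K"
  shows "\<exists>A. transvection_product A \<and> (\<forall>k\<in>K. A k = k) \<and> A x = x \<and> A z = (z' :: 'q \<times> 'q)"
proof -
  have direct: "transvection_product (transvection (a + z')) \<and> (\<forall>k\<in>K. transvection (a + z') k = k) \<and>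
      transvection (a + z') x = x \<and> transvection (a + z') a = z'"
    if "sp1 a z' = 1" "a \<in> perp sp1 K" "sp1 x a = 1" for a
    using that assms
    by (auto simp: transvection_product_single transvection_maps perp_def sp1.add_right intro!: transvection_fixes)
  show ?thesis
  proof (cases "sp1 z z' = 1")
    case True
    then show ?thesis using direct[of z] assms by blast
  next
    case 0: False
    show ?thesis
    proof (cases "z = z'")
      case True
      then show ?thesis by (intro exI[of _ id]) (simp add: transvection_product.id)
    next
      case False
      have tz: "transvection x z = z + x" using assms(1) by (simp add: transvection_def sp1.sym[of z])
      have "z + x \<in> perp sp1 K" using assms(3) sp1.add_closed_perp[of K] unfolding add_closed_def by blast
      moreover have "sp1 (z + x) z' = 1" using 0 assms by (simp add: sp1.add_left)
      moreover have "sp1 x (z + x) = 1" using assms by (simp add: sp1.add_right)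
      moreover have "transvection x k = k" if "k \<in> K" for k
        using that assms(3) by (intro transvection_fixes) (auto simp: perp_def)
      moreover have "transvection x x = x" by (intro transvection_fixes) simp
      ultimately show ?thesis
        using direct[of "z + x"] tz
        by (intro exI[of _ "transvection (z + x + z') \<circ> transvection x"])
           (auto intro: transvection_product_comp transvection_product_single)
    qed
  qed
qed

text \<open>The hyperbolic pairs of the basis are put in place one at a time. Each correction moves
  the first vector of the new pair and then its partner, by transvections that fix the pairs already
  placed.\<close>

lemma site_symplectic_transvection_product:
  assumes T: "site_symplectic (T :: 'q \<times> 'q \<Rightarrow> 'q \<times> 'q)"
  shows "transvection_product T"
proof -
  have T_sp: "sp1 (T x) (T y) = sp1 x y" for x y by (rule site_symplecticD(2)[OF T])
  have "\<exists>A. transvection_product A \<and> (\<forall>l<j. A (e l, 0) = T (e l, 0) \<and> A (0, e l) = T (0, e l))" if "j \<le> h" for j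
    using that
  proof (induction j)
    case 0
    then show ?case using transvection_product.id by blast
  next
    case (Suc j)
    then have j: "j < h" by simp
    obtain A where A: "transvection_product A" "\<And>l. l < j \<Longrightarrow> A (e l, 0) = T (e l, 0)" "\<And>l. l < j \<Longrightarrow> A (0, e l) = T (0, e l)"
      using Suc by auto
    have A_sp: "sp1 (A x) (A y) = sp1 x y" for x y
      by (rule site_symplecticD(2)[OF transvection_product_symplectic[OF A(1)]])
    \<comment> \<open>\<open>K\<close> holds the images already in place. Both the current and the
      desired position of the next pair are orthogonal to \<open>K\<close>, since \<open>A\<close>
      and \<open>T\<close> are isometries that agree on the earlier pairs.\<close>
    define K where "K = (\<Union>l<j. {T (e l, 0), T (0, e l)})"
    have K: "A (e j, 0) \<in> perp sp1 K" "A (0, e j) \<in> perp sp1 K" "T (e j, 0) \<in> perp sp1 K" "T (0, e j) \<in> perp sp1 K"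
    proof -
      have "x \<in> perp sp1 K" if x: "\<And>l. l < j \<Longrightarrow> sp1 (T (e l, 0)) x = 0" "\<And>l. l < j \<Longrightarrow> sp1 (T (0, e l)) x = 0" for x
        using x by (auto simp: perp_def K_def)
      note KI = this
      have "sp1 (T (e l, 0)) (A y) = sp1 (e l, 0) y" "sp1 (T (0, e l)) (A y) = sp1 (0, e l) y" if "l < j" for l y
        by (simp_all only: A(2,3)[OF that, symmetric] A_sp)
      note TA = this
      show "A (e j, 0) \<in> perp sp1 K" "A (0, e j) \<in> perp sp1 K"
        by (rule KI; use j sp1_basis_pairs[of j] in \<open>simp add: TA\<close>)+
      show "T (e j, 0) \<in> perp sp1 K" "T (0, e j) \<in> perp sp1 K"
        by (rule KI; use j sp1_basis_pairs[of j] in \<open>simp add: T_sp\<close>)+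
    qed
    have 1: "sp1 (A (e j, 0)) (A (0, e j)) = 1" "sp1 (T (e j, 0)) (T (0, e j)) = 1"
      using j by (simp_all add: A_sp T_sp sp1_basis_pairs)
    obtain B where B: "transvection_product B" "\<And>k. k \<in> K \<Longrightarrow> B k = k" "B (A (e j, 0)) = T (e j, 0)"
      using move_vector[OF 1, of K] K by auto
    have B_sp: "sp1 (B x) (B y) = sp1 x y" for x y
      by (rule site_symplecticD(2)[OF transvection_product_symplectic[OF B(1)]])
    have "sp1 (T (e j, 0)) (B (A (0, e j))) = 1"
      unfolding B(3)[symmetric] B_sp by (rule 1(1))
    moreover have "B (A (0, e j)) \<in> perp sp1 K"
    proof (rule sp1.perpI)
      fix k assume k: "k \<in> K"
      have "sp1 (B k) (B (A (0, e j))) = 0" unfolding B_sp using K(2) k by (rule sp1.perpD)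
      then show "sp1 k (B (A (0, e j))) = 0" by (simp add: B(2)[OF k])
    qed
    ultimately obtain D where D: "transvection_product D" "\<And>k. k \<in> K \<Longrightarrow> D k = k" "D (T (e j, 0)) = T (e j, 0)"
      "D (B (A (0, e j))) = T (0, e j)"
      using move_partner[of "T (e j, 0)" "B (A (0, e j))" "T (0, e j)" K] K(3,4) 1(2) by auto
    have "T (e l, 0) \<in> K" "T (0, e l) \<in> K" if "l < j" for l using that by (auto simp: K_def)
    then have "(D \<circ> B \<circ> A) (e l, 0) = T (e l, 0) \<and> (D \<circ> B \<circ> A) (0, e l) = T (0, e l)" if "l < Suc j" for l
      using that A(2,3) B(2,3) D(2,3,4) by (cases "l = j") (auto simp: less_Suc_eq)
    moreover have "transvection_product (D \<circ> B \<circ> A)" using A(1) B(1) D(1) by (intro transvection_product_comp)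
    ultimately show ?case by blast
  qed
  from this[of h] obtain A where A: "transvection_product A" "\<And>l. l < h \<Longrightarrow> A (e l, 0) = T (e l, 0)"
    "\<And>l. l < h \<Longrightarrow> A (0, e l) = T (0, e l)" by auto
  have "A = T"
    by (rule additive_ext[OF site_symplecticD(1)[OF transvection_product_symplectic[OF A(1)]] site_symplecticD(1)[OF T] A(2,3)])
  then show ?thesis using A(1) by simp
qed

text \<open>A transvection is realised by the unitary \<open>(1 + \<i> P) / \<surd>2\<close> for a Hermitian Pauli operator \<open>P\<close>:
  conjugation fixes the operators commuting with \<open>P\<close> and multiplies the others by \<open>- \<i> P\<close>.\<close>

lemma ex_transvection_unitary:
  "\<exists>U. U ** adj U = mat 1 \<and> adj U ** U = mat 1 \<and>
    (\<forall>w. \<exists>c\<in>phases. U ** site_pauli 1 w ** adj U = site_pauli c (transvection (t :: 'q \<times> 'q) w))"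
proof -
  \<comment> \<open>This phase makes \<open>P\<close> a Hermitian involution: with phase 1 the
    square would be the sign of \<open>tr (snd t * fst t)\<close>.\<close>
  define c where "c = (if tr (snd t * fst t) = 0 then 1 else \<i>)"
  define P where "P = site_pauli c t"
  have c: "c \<in> phases" by (simp add: c_def phases_def)
  have PP: "P ** P = mat 1" and adjP: "adj P = P"
    by (auto simp: P_def c_def site_pauli_mult site_pauli_adj site_pauli_one sp1.add_self)
  define r where "r = complex_of_real (1 / sqrt 2)"
  have r: "r * r = 1 / 2" "cnj r = r"
    unfolding r_def by (simp_all flip: of_real_mult add: real_sqrt_mult_self)
  have r_mult: "r * (r * x) = x / 2" for x
    by (simp add: mult.assoc[symmetric] r(1))
  have r_i: "r * (r * \<i>) = \<i> / 2" "r * \<i> * r = \<i> / 2" "r * \<i> * (r * \<i>) = - (1 / 2)"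
    by (simp_all only: r_mult mult.assoc mult.left_commute[of \<i> r] mult.commute[of \<i> r]) simp_all
  define U where "U = scale_op r (mat 1 + scale_op \<i> P)"
  have adjU: "adj U = scale_op r (mat 1 + scale_op (- \<i>) P)"
    by (simp add: U_def adj_scale_op adj_add adjP r)
  \<comment> \<open>The expansion of \<open>(1 + i P) A (1 - i P) / 2\<close>. If \<open>A\<close>
    commutes with \<open>P\<close>, the mixed terms cancel and the outer terms are both
    \<open>A\<close>; if it anticommutes, the outer terms cancel and the mixed ones
    coincide.\<close>
  have conj: "U ** A ** adj U = scale_op (1 / 2) (A + scale_op (- \<i>) (A ** P) + scale_op \<i> (P ** A) + P ** A ** P)" for A
    unfolding adjU unfolding U_def
    by (simp add: scale_op_mult_left scale_op_mult_right matrix_add_ldistrib matrix_add_rdistrib scale_op_add r)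
       (simp add: matrix_mul_assoc add_ac r_i)
  have half: "scale_op (1 / 2) (A + A) = A" for A :: "'q site_op"
    by (simp add: vec_eq_iff scale_op_def)
  have 1: "U ** adj U = mat 1"
    using conj[of "mat 1"] by (simp add: PP) (simp add: vec_eq_iff scale_op_def)
  have 2: "adj U ** U = mat 1"
    using 1 by (simp only: matrix_left_right_inverse)
  have "\<exists>d\<in>phases. U ** site_pauli 1 w ** adj U = site_pauli d (transvection t w)" for w
  proof -
    have PA: "P ** site_pauli 1 w = scale_op (bit_sign (sp1 t w)) (site_pauli 1 w ** P)"
      unfolding P_def by (rule site_pauli_commute)
    have APP: "site_pauli 1 w ** P ** P = site_pauli 1 w" by (simp add: matrix_mul_assoc[symmetric] PP)
    show ?thesis
    proof (cases "sp1 t w = 0")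
      case True
      have "U ** site_pauli 1 w ** adj U = site_pauli 1 w"
        unfolding conj PA using True by (simp add: APP) (simp add: vec_eq_iff scale_op_def field_simps)
      moreover have "transvection t w = w" using True by (simp add: transvection_def sp1.sym[of w])
      ultimately show ?thesis by (metis one_in_phases)
    next
      case False
      have "U ** site_pauli 1 w ** adj U = scale_op (- \<i>) (site_pauli 1 w ** P)"
        unfolding conj PA using False by (simp add: scale_op_mult_left APP del: scale_op_site_pauli) (simp add: vec_eq_iff scale_op_def field_simps)
      also have "\<dots> = site_pauli (- \<i> * (c * bit_sign (tr (snd w * fst t)))) (transvection t w)"
        unfolding P_def using False by (simp add: site_pauli_mult transvection_def sp1.sym[of w])
      finally have "U ** site_pauli 1 w ** adj U = site_pauli (- \<i> * (c * bit_sign (tr (snd w * fst t)))) (transvection t w)" .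
      moreover have "- \<i> * (c * bit_sign (tr (snd w * fst t))) \<in> phases"
        by (intro phases_closed c phases_bit_sign) (simp add: phases_def)
      ultimately show ?thesis by blast
    qed
  qed
  then show ?thesis using 1 2 by blast
qed

section \<open>Realising label maps by operations on codes\<close>

lemma finite_paulis1: "finite (paulis1 :: 'q site_op set)"
proof -
  have "paulis1 = (\<lambda>(c, w). site_pauli c w) ` (phases \<times> (UNIV :: ('q \<times> 'q) set))"
    by (auto simp: paulis1_eq image_iff)
  moreover have "finite phases" by (simp add: phases_def)
  ultimately show ?thesis by (metis finite_SigmaI finite_imageI finite)
qed

text \<open>Conjugation by a unitary is injective and \<open>paulis1\<close> is finite, so mapping
  \<open>paulis1\<close> into itself already gives equality.\<close>

lemma local_cliffordI:
  fixes U :: "'n :: finite \<Rightarrow> 'q site_op"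
  assumes U: "\<And>j. U j ** adj (U j) = mat 1" "\<And>j. adj (U j) ** U j = mat 1"
    and UT: "\<And>j w. \<exists>c\<in>phases. U j ** site_pauli 1 w ** adj (U j) = site_pauli c (T j w)"
  shows "local_clifford U"
proof -
  have "(\<lambda>A. U j ** A ** adj (U j)) ` paulis1 = paulis1" for j
  proof (rule endo_inj_surj[OF finite_paulis1])
    show "(\<lambda>A. U j ** A ** adj (U j)) ` paulis1 \<subseteq> paulis1"
    proof (rule image_subsetI)
      fix A :: "'q site_op" assume "A \<in> paulis1"
      then obtain d w where d: "d \<in> phases" "A = site_pauli d w" by (auto simp: paulis1_eq)
      obtain c where c: "c \<in> phases" "U j ** site_pauli 1 w ** adj (U j) = site_pauli c (T j w)" using UT by blast
      have "A = scale_op d (site_pauli 1 w)" by (simp add: d(2))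
      then have "U j ** A ** adj (U j) = scale_op d (U j ** site_pauli 1 w ** adj (U j))"
        by (simp only: scale_op_mult_left scale_op_mult_right)
      then have "U j ** A ** adj (U j) = site_pauli (d * c) (T j w)"
        by (simp only: c(2) scale_op_site_pauli)
      then show "U j ** A ** adj (U j) \<in> paulis1" unfolding paulis1_eq using phases_closed[OF d(1) c(1)] by blast
    qed
    show "inj_on (\<lambda>A. U j ** A ** adj (U j)) paulis1"
    proof (rule inj_on_inverseI)
      fix A :: "'q site_op"
      have "adj (U j) ** (U j ** A ** adj (U j)) ** U j = (adj (U j) ** U j) ** A ** (adj (U j) ** U j)"
        by (simp only: matrix_mul_assoc)
      then show "adj (U j) ** (U j ** A ** adj (U j)) ** U j = A" by (simp add: U)
    qed
  qed
  then show ?thesis by (simp add: local_clifford_def U)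
qed

lemma reachable_transvection:
  "reachable (label_map id (\<lambda>j. if j = i then transvection t else id) :: ('q \<times> 'q) ^ 'n :: finite \<Rightarrow> _)"
  unfolding reachable_def
proof (intro allI impI)
  fix S :: "('q, 'n) op set" assume S: "stab_group S"
  obtain V where V: "V ** adj V = mat 1" "adj V ** V = mat 1"
    "\<And>w. \<exists>c\<in>phases. V ** site_pauli 1 w ** adj V = site_pauli c (transvection t w)"
    using ex_transvection_unitary[of t] by blast
  define U where "U j = (if j = i then V else mat 1)" for j
  define T where "T j = (if j = i then transvection t else id)" for j
  have UT: "\<exists>c\<in>phases. U j ** site_pauli 1 w ** adj (U j) = site_pauli c (T j w)" for j w
    using V(3) by (auto simp: U_def T_def intro: bexI[of _ 1])
  have lc: "local_clifford U"
    by (rule local_cliffordI[OF _ _ UT]) (simp_all add: U_def V)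
  have T: "site_symplectic (T j)" for j
    by (simp add: T_def site_symplectic_transvection site_symplectic_id)
  note c = clifford_step[OF S lc UT T]
  show "\<exists>S'. code_step\<^sup>*\<^sup>* S S' \<and> stab_group S' \<and>
      label ` S' = label_map id (\<lambda>j. if j = i then transvection t else id) ` label ` S"
    using c r_into_rtranclp[of code_step, OF code_step.clifford[OF lc, of S]] unfolding T_def by blast
qed

lemma reachable_site:
  assumes "transvection_product T"
  shows "reachable (label_map id (\<lambda>j. if j = i then T else id) :: ('q \<times> 'q) ^ 'n :: finite \<Rightarrow> _)"
  using assms
proof (induction T rule: transvection_product.induct)
  case id
  have eq: "label_map id (\<lambda>j. if j = i then id else id) = (\<lambda>v :: ('q \<times> 'q) ^ 'n. v)"
    by (simp add: fun_eq_iff label_map_def)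
  show ?case unfolding eq by (rule reachable_id)
next
  case (step T t)
  have eq: "label_map id (\<lambda>j. if j = i then transvection t \<circ> T else id) =
      (\<lambda>v :: ('q \<times> 'q) ^ 'n. label_map id (\<lambda>j. if j = i then transvection t else id) (label_map id (\<lambda>j. if j = i then T else id) v))"
    by (auto simp: fun_eq_iff label_map_def vec_eq_iff)
  show ?case unfolding eq by (rule reachable_comp[OF step.IH reachable_transvection])
qed

text \<open>The positions are treated one after another; each \<open>T j\<close> is a product of
  transvections, and each transvection is induced by a Clifford operator that is the identity at all
  other positions.\<close>

lemma reachable_local:
  assumes T: "\<And>j. site_symplectic (T j)"
  shows "reachable (label_map id T :: ('q \<times> 'q) ^ 'n :: finite \<Rightarrow> _)"
proof -
  have "reachable (label_map id (\<lambda>j. if j \<in> A then T j else id) :: ('q \<times> 'q) ^ 'n \<Rightarrow> _)" for A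
    using finite[of A]
  proof (induction A rule: finite_induct)
    case empty
    have eq: "label_map id (\<lambda>j. if j \<in> {} then T j else id) = (\<lambda>v :: ('q \<times> 'q) ^ 'n. v)"
      by (simp add: fun_eq_iff label_map_def)
    show ?case unfolding eq by (rule reachable_id)
  next
    case (insert i A)
    have eq: "label_map id (\<lambda>j. if j \<in> insert i A then T j else id) =
        (\<lambda>v :: ('q \<times> 'q) ^ 'n. label_map id (\<lambda>j. if j = i then T i else id) (label_map id (\<lambda>j. if j \<in> A then T j else id) v))"
      using insert(2) by (auto simp: fun_eq_iff label_map_def vec_eq_iff)
    show ?case
      unfolding eq by (rule reachable_comp[OF insert.IH reachable_site[OF site_symplectic_transvection_product[OF T]]])
  qed
  from this[of UNIV] show ?thesis by simp
qed

lemma reachable_permutation: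
  assumes \<sigma>: "bij \<sigma>"
  shows "reachable (label_map \<sigma> (\<lambda>_. id) :: ('q \<times> 'q) ^ 'n :: finite \<Rightarrow> _)"
  unfolding reachable_def
proof (intro allI impI)
  fix S :: "('q, 'n) op set" assume S: "stab_group S"
  \<comment> \<open>Permuting operators by a bijection permutes labels by its inverse, so the
    operation is applied with the inverse of \<open>\<sigma>\<close>.\<close>
  have b: "bij (inv_into UNIV \<sigma>)" by (rule bij_imp_bij_inv[OF \<sigma>])
  have ii: "inv_into UNIV (inv_into UNIV \<sigma>) = \<sigma>" by (rule inv_inv_eq[OF \<sigma>])
  show "\<exists>S'. code_step\<^sup>*\<^sup>* S S' \<and> stab_group S' \<and> label ` S' = label_map \<sigma> (\<lambda>_. id) ` label ` S"
    using permutation_step[OF S b] r_into_rtranclp[of code_step, OF code_step.permutation[OF b, of S]] unfolding ii by blast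
qed

text \<open>From right to left, reachability leads to a group with the labels of \<open>S'\<close>,
  and one sign change then adjusts the phases.\<close>

lemma code_steps_iff:
  assumes S: "stab_group (S :: ('q, 'n :: finite) op set)" and S': "stab_group S'"
  shows "code_step\<^sup>*\<^sup>* S S' \<longleftrightarrow> label_equiv (label ` S) (label ` S')"
proof
  assume "label_equiv (label ` S) (label ` S')"
  then obtain \<sigma> T where T: "bij \<sigma>" "\<And>j. site_symplectic (T j)" "label ` S' = label_map \<sigma> T ` label ` S"
    unfolding label_equiv_def by blast
  have "label_map \<sigma> T = (\<lambda>v. label_map id T (label_map \<sigma> (\<lambda>_. id) v))"
    by (simp add: fun_eq_iff label_map_def)
  then have "reachable (label_map \<sigma> T)"
    using reachable_comp[OF reachable_permutation[OF T(1)] reachable_local[OF T(2)]] by simp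
  then obtain S1 where S1: "code_step\<^sup>*\<^sup>* S S1" "stab_group S1" "label ` S1 = label ` S'"
    using S T(3) unfolding reachable_def by metis
  then show "code_step\<^sup>*\<^sup>* S S'" using equal_labels_code_step[OF S1(2) S' S1(3)] by simp
qed (use code_steps_label_equiv S in blast)

lemma code_equiv_iff_label_equiv:
  fixes Q Q' :: "('q, 'n :: finite) state set"
  assumes "Q \<in> codes k d" "Q' \<in> codes k' d'"
  shows "code_equiv Q Q' \<longleftrightarrow> label_equiv (label ` stabiliser_of Q) (label ` stabiliser_of Q')"
  unfolding code_equiv_def
  by (rule code_steps_iff; rule stabiliser_code_stab_group(1); use assms in \<open>simp add: codes_def stabiliser_code_params_def\<close>)

lemma code_equiv_iff_proj_equiv:
  fixes Q Q' :: "('q, 'n :: finite) state set"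
    and X :: "('n, 'r :: finite) polar_family" and Y :: "('n, 's :: finite) polar_family"
  assumes Q: "Q \<in> codes k d" and d: "d \<ge> 2" and r: "real CARD('r) = real h * (real CARD('n) - k)"
    and Q': "Q' \<in> codes k' d'" and d': "d' \<ge> 2" and s: "real CARD('s) = real h * (real CARD('n) - k')"
    and X: "corresponds h e Q X" and Y: "corresponds h e Q' Y"
  shows "code_equiv Q Q' \<longleftrightarrow> proj_equiv X Y"
proof -
  obtain M where M: "bij_betw (comb M) UNIV (label ` stabiliser_of Q)" "X = polar_system M"
    using X unfolding codes_corresponds_iff[OF Q d r] by blast
  obtain M' where M': "bij_betw (comb M') UNIV (label ` stabiliser_of Q')" "Y = polar_system M'"
    using Y unfolding codes_corresponds_iff[OF Q' d' s] by blast
  have inj: "inj (site_map M i)" "inj (site_map M' i)" for i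
    by (rule codesD(4)[OF Q d r M(1)], rule codesD(4)[OF Q' d' s M'(1)])
  have injc: "inj (comb M)" "inj (comb M')" and C: "label ` stabiliser_of Q = range (comb M)" "label ` stabiliser_of Q' = range (comb M')"
    using M(1) M'(1) by (auto simp: bij_betw_def)
  show ?thesis
    unfolding code_equiv_iff_label_equiv[OF Q Q'] C M(2) M'(2)
    using proj_equiv_imp_label_equiv[OF inj] label_equiv_imp_proj_equiv[OF inj injc] by blast
qed

text \<open>A code corresponds to one quantum set for each basis of its labels, and codes that
  differ only in phases share theirs, so the correspondence becomes a map on equivalence classes.
  Reflexivity of projective equivalence is borrowed from codes through \<open>iff\<close>.\<close>

lemma bij_betw_code_classes:
  assumes d: "d \<ge> 2" and r: "real CARD('r :: finite) = real h * (real CARD('n :: finite) - k)"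
  shows "bij_betw (\<lambda>K. {X :: ('n, 'r) polar_family. \<exists>Q\<in>K. corresponds h e Q X})
       ((codes k d :: ('q, 'n) state set set) // code_rel k d)
       ((quantum_sets h d :: ('n, 'r) polar_family set) // proj_rel h d)"
proof -
  let ?A = "codes k d :: ('q, 'n) state set set" and ?B = "quantum_sets h d :: ('n, 'r) polar_family set"
  let ?F = "\<lambda>K. {X :: ('n, 'r) polar_family. \<exists>Q\<in>K. corresponds h e Q X}"
  have ex: "\<exists>X :: ('n, 'r) polar_family. corresponds h e Q X" if "Q \<in> ?A" for Q
    by (rule codes_ex_corresponds[OF that d r])
  have qs: "X \<in> ?B" if "Q \<in> ?A" "corresponds h e Q X" for Q X
    by (rule corresponds_quantum_set[OF that(1) d r that(2)])
  have ex': "\<exists>Q\<in>?A. corresponds h e Q X" if "X \<in> ?B" for X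
    by (rule quantum_set_ex_code[OF that d r])
  have iff: "code_equiv Q Q' \<longleftrightarrow> proj_equiv X Y"
    if "Q \<in> ?A" "Q' \<in> ?A" "corresponds h e Q X" "corresponds h e Q' Y" for Q Q' and X Y :: "('n, 'r) polar_family"
    by (rule code_equiv_iff_proj_equiv[OF that(1) d r that(2) d r that(3,4)])
  have refl: "code_equiv Q Q" for Q :: "('q, 'n) state set" by (simp add: code_equiv_def)
  have trans: "code_equiv Q1 Q3" if "code_equiv Q1 Q2" "code_equiv Q2 Q3" for Q1 Q2 Q3 :: "('q, 'n) state set"
    using that unfolding code_equiv_def by (rule rtranclp_trans)
  have sym: "code_equiv Q' Q" if "Q \<in> ?A" "Q' \<in> ?A" "code_equiv Q Q'" for Q Q'
    using that label_equiv_sym code_equiv_iff_label_equiv by blast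
  \<comment> \<open>The class of \<open>Q\<close> goes to the class of any single \<open>X\<close>
    that corresponds to \<open>Q\<close>, which reduces all claims to representatives.\<close>
  have F: "?F (code_rel k d `` {Q}) = proj_rel h d `` {X}" if Q: "Q \<in> ?A" and X: "corresponds h e Q X" for Q X
  proof (intro subset_antisym subsetI)
    fix Y assume "Y \<in> ?F (code_rel k d `` {Q})"
    then obtain Q' where Q': "Q' \<in> ?A" "code_equiv Q Q'" "corresponds h e Q' Y" unfolding code_rel_def by blast
    then show "Y \<in> proj_rel h d `` {X}"
      using iff[OF Q Q'(1) X Q'(3)] qs[OF Q X] qs[OF Q'(1,3)] by (simp add: proj_rel_def)
  next
    fix Y assume "Y \<in> proj_rel h d `` {X}"
    then have Y: "Y \<in> ?B" "proj_equiv X Y" by (auto simp: proj_rel_def)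
    obtain Q' where Q': "Q' \<in> ?A" "corresponds h e Q' Y" using ex'[OF Y(1)] by blast
    have "(Q, Q') \<in> code_rel k d" using iff[OF Q Q'(1) X Q'(2)] Y(2) Q Q'(1) by (simp add: code_rel_def)
    then show "Y \<in> ?F (code_rel k d `` {Q})" using Q'(2) by blast
  qed
  show ?thesis
  proof (rule bij_betwI')
    fix K K' assume "K \<in> ?A // code_rel k d" "K' \<in> ?A // code_rel k d"
    then obtain Q Q' where Q: "Q \<in> ?A" "K = code_rel k d `` {Q}" and Q': "Q' \<in> ?A" "K' = code_rel k d `` {Q'}"
      by (auto simp: quotient_def)
    obtain X Y :: "('n, 'r) polar_family" where X: "corresponds h e Q X" and Y: "corresponds h e Q' Y" using ex[OF Q(1)] ex[OF Q'(1)] by blast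
    show "?F K = ?F K' \<longleftrightarrow> K = K'"
    proof
      assume "?F K = ?F K'"
      then have "proj_rel h d `` {X} = proj_rel h d `` {Y}" unfolding Q(2) Q'(2) F[OF Q(1) X] F[OF Q'(1) Y] .
      moreover have "Y \<in> proj_rel h d `` {Y}"
        using iff[OF Q'(1) Q'(1) Y Y] refl qs[OF Q'(1) Y] by (simp add: proj_rel_def)
      ultimately have "proj_equiv X Y" by (auto simp: proj_rel_def)
      then have eq: "code_equiv Q Q'" using iff[OF Q(1) Q'(1) X Y] by simp
      show "K = K'"
        unfolding Q(2) Q'(2) code_rel_def using Q(1) Q'(1) eq sym[OF Q(1) Q'(1) eq] trans by blast
    qed simp
  next
    fix K assume "K \<in> ?A // code_rel k d"
    then obtain Q where Q: "Q \<in> ?A" "K = code_rel k d `` {Q}" by (auto simp: quotient_def)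
    obtain X :: "('n, 'r) polar_family" where X: "corresponds h e Q X" using ex[OF Q(1)] by blast
    show "?F K \<in> ?B // proj_rel h d"
      unfolding Q(2) F[OF Q(1) X] by (rule quotientI[OF qs[OF Q(1) X]])
  next
    fix L assume "L \<in> ?B // proj_rel h d"
    then obtain X where X: "X \<in> ?B" "L = proj_rel h d `` {X}" by (auto simp: quotient_def)
    obtain Q where Q: "Q \<in> ?A" "corresponds h e Q X" using ex'[OF X(1)] by blast
    show "\<exists>K \<in> ?A // code_rel k d. L = ?F K"
      using F[OF Q] X(2) quotientI[OF Q(1), of "code_rel k d"] by (intro bexI[of _ "code_rel k d `` {Q}"]) simp_all
  qed
qed

end

theorem theorem48:
  fixes e :: "nat \<Rightarrow> 'q :: {field, finite}"
    and h d d' :: nat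
    and k k' :: real
  assumes q: "CARD('q) = 2 ^ h"
    and basis: "trace_orthogonal_basis h e"
    and d: "d \<ge> 2" and d': "d' \<ge> 2"
    and r: "real CARD('r :: finite) = real h * (real CARD('n :: finite) - k)"
    and s: "real CARD('s :: finite) = real h * (real CARD('n) - k')"
  shows
    "(\<forall>Q \<in> codes k d :: ('q, 'n) state set set.
        (\<exists>X :: ('n, 'r) polar_family. corresponds h e Q X) \<and>
        (\<forall>X :: ('n, 'r) polar_family. corresponds h e Q X \<longrightarrow> X \<in> quantum_sets h d)) \<and>
     (\<forall>X \<in> quantum_sets h d :: ('n, 'r) polar_family set.
        \<exists>Q \<in> codes k d :: ('q, 'n) state set set. corresponds h e Q X) \<and>
     bij_betw (\<lambda>K. {X :: ('n, 'r) polar_family. \<exists>Q\<in>K. corresponds h e Q X})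
       ((codes k d :: ('q, 'n) state set set) // code_rel k d)
       ((quantum_sets h d :: ('n, 'r) polar_family set) // proj_rel h d) \<and>
     (\<forall>Q \<in> codes k d :: ('q, 'n) state set set. \<forall>Q' \<in> codes k' d' :: ('q, 'n) state set set.
        \<forall>(X :: ('n, 'r) polar_family) (Y :: ('n, 's) polar_family).
          corresponds h e Q X \<and> corresponds h e Q' Y \<longrightarrow>
            (code_equiv Q Q' \<longleftrightarrow> proj_equiv X Y))"
proof -
  interpret trace_basis e h by unfold_locales (rule q, rule basis)
  show ?thesis
    using codes_ex_corresponds[OF _ d r] corresponds_quantum_set[OF _ d r] quantum_set_ex_code[OF _ d r]
      bij_betw_code_classes[OF d r] code_equiv_iff_proj_equiv[OF _ d r _ d' s]
    by (intro conjI ballI allI impI) (blast | (elim conjE, blast))+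
qed

end
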